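(* Let $d\ge 2$ be an integer and $D=d^2-1$. Let $\mathcal{S}_d=\{\rho\in M_d(\mathbb{C})\,:\,\rho=\rho^*,\ \mathrm{Tr}(\rho)=1,\ \rho\ge 0\}$ be the set of $d\times d$ density matrices, viewed as a $D$-dimensional compact convex body in the $D$-dimensional real affine space $S_1(\mathbb{C}^d)=\{A\in M_d(\mathbb{C})\,:\,A=A^*,\ \mathrm{Tr}(A)=1\}$, equipped with the Euclidean metric induced by the Hilbert–Schmidt inner product $\langle A,B\rangle=\mathrm{Tr}(A^*B)$. For $\varepsilon\ge 0$ let $\mathcal{S}_{d,\varepsilon}$ be the set of points of $S_1(\mathbb{C}^d)$ at distance at most $\varepsilon$ from $\mathcal{S}_d$, and let $p_d(\varepsilon)=\mathrm{vol}_D(\mathcal{S}_{d,\varepsilon})$ (a polynomial in $\varepsilon$). Then $$p_d''(0)=(d-1)\,d^{3/2}\,(2\pi)^{\frac{d(d-1)}{2}}\,\frac{\Gamma(1)\cdots\Gamma(d)}{\Gamma(d^2-2)},$$ $$p_d'''(0)=d\,(d-1)^{3/2}\,(2\pi)^{\frac{d(d-1)}{2}}\,\frac{\Gamma(1)\cdots\Gamma(d+1)}{\Gamma(d)\,\Gamma(d^2-3)}.$$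
   Context: $\mathrm{vol}_D$ denotes $D$-dimensional Lebesgue measure in the $D$-dimensional Euclidean affine space $S_1(\mathbb{C}^d)$ (with the Hilbert–Schmidt metric). $p_d''$ and $p_d'''$ denote the second and third derivatives of $p_d$ with respect to $\varepsilon$. *)

theory Defs
  imports "HOL-Analysis.Analysis" "HOL-Computational_Algebra.Polynomial"
begin

text \<open>Complex d x d matrices are modelled as complex^'n^'n with d = CARD('n).
  As a real vector space this type carries the inner product
  inner A B = Re (Tr (A^* B)) (the Hilbert-Schmidt inner product, which is real
  on Hermitian matrices), hence the induced norm/distance is Hilbert-Schmidt.\<close>

definition hermitian :: "complex^'n^'n \<Rightarrow> bool" where
  "hermitian A \<longleftrightarrow> (\<forall>i j. A $ i $ j = cnj (A $ j $ i))"

definition mtrace :: "complex^'n^'n \<Rightarrow> complex" where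
  "mtrace A = (\<Sum>i\<in>UNIV. A $ i $ i)"

definition psd :: "complex^'n^'n \<Rightarrow> bool" where
  "psd A \<longleftrightarrow> (\<forall>v::complex^'n.
     let q = (\<Sum>i\<in>UNIV. \<Sum>j\<in>UNIV. cnj (v $ i) * A $ i $ j * v $ j)
     in Im q = 0 \<and> 0 \<le> Re q)"

definition trace_one_herm :: "(complex^'n^'n) set" where
  "trace_one_herm = {A. hermitian A \<and> mtrace A = 1}"

definition density_matrices :: "(complex^'n^'n) set" where
  "density_matrices = {A. hermitian A \<and> mtrace A = 1 \<and> psd A}"

definition density_nbhd :: "real \<Rightarrow> (complex^'n^'n) set" where
  "density_nbhd eps = {A \<in> trace_one_herm. infdist A density_matrices \<le> eps}"

text \<open>B is an orthonormal basis (HS inner product) of the traceless Hermitian matrices,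
  i.e. of the tangent space of S_1(C^d).\<close>
definition traceless_herm_onb :: "('m \<Rightarrow> complex^'n^'n) \<Rightarrow> bool" where
  "traceless_herm_onb B \<longleftrightarrow>
     (\<forall>i. hermitian (B i) \<and> mtrace (B i) = 0) \<and>
     (\<forall>i j. inner (B i) (B j) = (if i = j then 1 else 0)) \<and>
     (\<forall>H. hermitian H \<and> mtrace H = 0 \<longrightarrow> H \<in> span (range B))"

text \<open>D-dimensional Lebesgue measure on S_1(C^d), computed in the affine isometric
  coordinates x \<mapsto> I/d + sum_i x_i B_i (x in R^D, D = CARD('m)).\<close>
definition vol_S1 :: "('m::finite \<Rightarrow> complex^'n^'n) \<Rightarrow> (complex^'n^'n) set \<Rightarrow> real" where
  "vol_S1 B S = measure lborel
     {x :: real^'m. mat (1 / of_nat CARD('n)) + (\<Sum>i\<in>UNIV. (x $ i) *\<^sub>R B i) \<in> S}"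

definition p_vol :: "('m::finite \<Rightarrow> complex^'n^'n) \<Rightarrow> real \<Rightarrow> real" where
  "p_vol B eps = vol_S1 B (density_nbhd eps)"

end

theory Submission
  imports Defs "HOL-Probability.Probability"
begin

text \<open>
  Polynomiality is Steiner's formula. For the derivatives, put \<open>t = e * sqrt (1 - 1 / d)\<close>. The parallel
  body at distance \<open>e\<close> is contained in the set of all trace-one Hermitian \<open>A \<ge> - t * I\<close>, because a
  traceless \<open>N\<close> has least eigenvalue at least \<open>- norm N * sqrt (1 - 1 / d)\<close>. That larger set is the set of
  density matrices dilated about \<open>I / d\<close> by the factor \<open>1 + d * t = 1 + e * sqrt (d * (d - 1))\<close>, so its
  volume is \<open>V * (1 + e * sqrt (d * (d - 1))) ^ (d\<^sup>2 - 1)\<close>. A matrix in the difference has two eigenvalues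
  of order \<open>e\<close>; matrices of corank two form a stratum of codimension four, so the difference has
  volume \<open>O(e ^ 4)\<close> and does not influence the derivatives of order at most three. The volume \<open>V\<close>
  follows from the integral of \<open>exp (- Tr X)\<close> over the positive semidefinite cone, computed by
  splitting off one row and column at a time with the Schur complement.
\<close>

subsection \<open>Translation-invariant measures and orthonormal coordinates\<close>

text \<open>Steiner's formula does more than supply polynomiality: it turns the bound
  \<open>O(e ^ 4)\<close>, obtained for small positive \<open>e\<close>, into equality of the
  coefficients of degree 0 to 3. The constant \<open>sqrt (1 - 1 / d)\<close> is the Hilbert-Schmidt
  norm of the traceless part of a rank-one projection. By Cauchy-Schwarz that direction is the
  cheapest way to raise one eigenvalue at fixed trace. A single negative eigenvalue can be cleared
  along it within distance \<open>e\<close>, unless the accompanying decrease of the other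
  eigenvalues makes one of them negative; hence the two eigenvalues of order \<open>e\<close>. The
  corank-two stratum is never parametrised. Its neighbourhood is covered by finitely many sets, one
  for each pair of coordinates, and translates of each set along a four-dimensional space of
  Hermitian blocks are packed into a ball. These blocks have nonzero trace in general, so the
  packing takes place in the space of all Hermitian matrices, and the trace-one slice is thickened
  to traces between 1 and 2.\<close>

lemma borel_measurable_linear:
  fixes f :: "'a::euclidean_space \<Rightarrow> 'b::euclidean_space"
  assumes "linear f"
  shows "f \<in> borel_measurable borel"
  using assms by (intro borel_measurable_continuous_onI linear_continuous_on linear_conv_bounded_linear[THEN iffD1])

text \<open>Both sides are the integral of \<open>indicator B y * indicator A (x + y)\<close>, evaluated in the two orders.\<close>
lemma translation_invariant_measure_proportional_lborel:
  fixes M :: "'a::euclidean_space measure"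
  assumes sets: "sets M = sets borel" and sf: "sigma_finite_measure M"
    and inv: "\<And>a. distr M borel (\<lambda>x. x + a) = M"
    and A[measurable]: "A \<in> sets borel" and B[measurable]: "B \<in> sets borel"
    and sym: "\<And>x. - x \<in> B \<longleftrightarrow> x \<in> B"
  shows "emeasure M A * emeasure lborel B = emeasure lborel A * emeasure M B"
proof -
  interpret M: sigma_finite_measure M by fact
  interpret P: pair_sigma_finite M lborel ..
  note [measurable_cong] = sets
  have tr: "(\<integral>\<^sup>+x. f (x + a) \<partial>M) = (\<integral>\<^sup>+x. f x \<partial>M)"
    if [measurable]: "f \<in> borel_measurable borel" for f and a :: 'a
  proof -
    have "(\<integral>\<^sup>+x. f x \<partial>M) = (\<integral>\<^sup>+x. f x \<partial>distr M borel (\<lambda>x. x + a))" by (simp add: inv)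
    also have "\<dots> = (\<integral>\<^sup>+x. f (x + a) \<partial>M)" by (subst nn_integral_distr) auto
    finally show ?thesis by simp
  qed
  have trl: "(\<integral>\<^sup>+x. f (x + a) \<partial>lborel) = (\<integral>\<^sup>+x. f x \<partial>lborel)"
    if [measurable]: "f \<in> borel_measurable borel" for f and a :: 'a
  proof -
    have "(\<integral>\<^sup>+x. f x \<partial>lborel) = (\<integral>\<^sup>+x. f x \<partial>distr lborel borel ((+) a))" by (simp add: lborel_distr_plus)
    also have "\<dots> = (\<integral>\<^sup>+x. f (x + a) \<partial>lborel)" by (subst nn_integral_distr) (auto simp: add.commute)
    finally show ?thesis by simp
  qed
  have "emeasure M A * emeasure lborel B = (\<integral>\<^sup>+y. indicator B y * emeasure M A \<partial>lborel)"
    by (simp add: nn_integral_multc mult.commute)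
  also have "\<dots> = (\<integral>\<^sup>+y. (\<integral>\<^sup>+x. indicator B y * indicator A (x + y) \<partial>M) \<partial>lborel)"
  proof (rule nn_integral_cong)
    fix y :: 'a
    have "emeasure M A = (\<integral>\<^sup>+x. indicator A (x + y) \<partial>M)"
      using tr[of "indicator A" y] by (simp add: sets)
    then show "indicator B y * emeasure M A = (\<integral>\<^sup>+x. indicator B y * indicator A (x + y) \<partial>M)"
      by (subst nn_integral_cmult) auto
  qed
  also have "\<dots> = (\<integral>\<^sup>+x. (\<integral>\<^sup>+y. indicator B y * indicator A (x + y) \<partial>lborel) \<partial>M)"
    by (rule P.Fubini') measurable
  also have "\<dots> = (\<integral>\<^sup>+x. (\<integral>\<^sup>+y. indicator B (y - x) * indicator A y \<partial>lborel) \<partial>M)"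
  proof (rule nn_integral_cong)
    fix x :: 'a
    show "(\<integral>\<^sup>+y. indicator B y * indicator A (x + y) \<partial>lborel)
      = (\<integral>\<^sup>+y. indicator B (y - x) * indicator A y \<partial>lborel)"
      using trl[of "\<lambda>y. indicator B (y - x) * indicator A y" x] by (simp add: add.commute)
  qed
  also have "\<dots> = (\<integral>\<^sup>+y. (\<integral>\<^sup>+x. indicator B (y - x) * indicator A y \<partial>M) \<partial>lborel)"
    by (rule P.Fubini'[symmetric]) measurable
  also have "\<dots> = (\<integral>\<^sup>+y. emeasure M B * indicator A y \<partial>lborel)"
  proof (rule nn_integral_cong)
    fix y :: 'a
    have "(\<integral>\<^sup>+x. indicator B (y - x) \<partial>M) = (\<integral>\<^sup>+x. indicator B (x + (- y)) \<partial>M)"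
    proof (rule nn_integral_cong)
      show "indicator B (y - x) = (indicator B (x + (- y)) :: ennreal)" for x
        using sym[of "y - x"] by (simp add: indicator_def)
    qed
    also have "\<dots> = emeasure M B" by (subst tr) (auto simp: sets)
    finally have "(\<integral>\<^sup>+x. indicator B (y - x) \<partial>M) = emeasure M B" .
    then show "(\<integral>\<^sup>+x. indicator B (y - x) * indicator A y \<partial>M) = emeasure M B * indicator A y"
      by (subst nn_integral_multc) auto
  qed
  also have "\<dots> = emeasure lborel A * emeasure M B"
    by (subst nn_integral_cmult) (auto simp: mult.commute)
  finally show ?thesis .
qed

text \<open>The image measure is again translation invariant: since \<open>T\<close> is onto,
  translation by \<open>a\<close> is the image of translation by a preimage of \<open>a\<close>. It
  is therefore proportional to Lebesgue measure, and the factor is one because a linear isometry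
  preserves the unit ball, whose volume is positive and finite.\<close>

lemma lborel_distr_linear_isometry:
  fixes T :: "'a::euclidean_space \<Rightarrow> 'a"
  assumes lin: "linear T" and norm: "\<And>x. norm (T x) = norm x"
  shows "distr lborel borel T = lborel"
proof (rule measure_eqI)
  have [measurable]: "T \<in> borel_measurable borel"
    using lin by (rule borel_measurable_linear)
  have inj: "inj T"
    using norm by (auto simp: linear_injective_0[OF lin]) (metis norm_eq_zero)
  have surj: "surj T"
    using linear_injective_imp_surjective[OF lin inj] by simp
  show sets: "sets (distr lborel borel T) = sets lborel" by simp
  define M where "M = distr lborel borel T"
  have vimage_cball: "T -` cball 0 r = cball 0 r" for r by (auto simp: norm)
  have Mcball: "emeasure M (cball 0 r) = emeasure lborel (cball (0::'a) r)" for r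
    by (simp add: M_def emeasure_distr vimage_cball)
  have sf: "sigma_finite_measure M"
  proof
    show "\<exists>A. countable A \<and> A \<subseteq> sets M \<and> \<Union> A = space M \<and> (\<forall>a\<in>A. emeasure M a \<noteq> \<infinity>)"
    proof (intro exI[of _ "range (\<lambda>n. cball 0 (real n))"] conjI)
      show "\<Union> (range (\<lambda>n. cball 0 (real n))) = space M"
        by (auto simp: M_def real_arch_simple)
      show "\<forall>a\<in>range (\<lambda>n. cball 0 (real n)). emeasure M a \<noteq> \<infinity>"
        using emeasure_lborel_cball_finite by (auto simp: Mcball less_top)
    qed (auto simp: M_def)
  qed
  have inv: "distr M borel (\<lambda>x. x + a) = M" for a
  proof -
    obtain a' where a': "a = T a'" using surj by blast
    have "distr M borel (\<lambda>x. x + a) = distr lborel borel (\<lambda>x. T (a' + x))"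
      unfolding M_def by (subst distr_distr) (auto simp: o_def a' linear_add[OF lin] add.commute)
    also have "\<dots> = distr (distr lborel borel ((+) a')) borel T"
      by (subst distr_distr) (auto simp: o_def)
    also have "\<dots> = M" by (simp add: lborel_distr_plus M_def)
    finally show ?thesis .
  qed
  fix A assume "A \<in> sets (distr lborel borel T)"
  then have A: "A \<in> sets borel" by simp
  have "emeasure M A * emeasure lborel (cball (0::'a) 1) = emeasure lborel A * emeasure M (cball 0 1)"
    by (rule translation_invariant_measure_proportional_lborel[OF _ sf inv A]) (auto simp: M_def)
  moreover have "emeasure lborel (cball (0::'a) 1) \<noteq> \<infinity>"
    using emeasure_lborel_cball_finite[of "0::'a" 1] by (simp add: less_top)
  moreover have "emeasure lborel (cball (0::'a) 1) \<noteq> 0"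
    by (simp add: emeasure_cball unit_ball_vol_pos[THEN less_imp_neq, symmetric])
  ultimately show "emeasure (distr lborel borel T) A = emeasure lborel A"
    unfolding Mcball M_def[symmetric]
    by (metis ennreal_mult_cancel_left infinity_ennreal_def mult.commute)
qed

lemma PiM_lborel_reindex:
  assumes "finite I" and bij: "bij_betw s J I"
  shows "distr (\<Pi>\<^sub>M i\<in>I. lborel) (\<Pi>\<^sub>M j\<in>J. lborel) (\<lambda>f. \<lambda>j\<in>J. f (s j))
    = (\<Pi>\<^sub>M j\<in>J. (lborel :: 'a::euclidean_space measure))"
proof -
  interpret product_sigma_finite "\<lambda>_. lborel :: 'a measure" ..
  have fJ: "finite J" using assms bij_betw_finite by auto
  have sJ: "s j \<in> I" if "j \<in> J" for j using bij that by (auto simp: bij_betw_def)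
  define r where "r = the_inv_into J s"
  have r: "r i \<in> J" "s (r i) = i" if "i \<in> I" for i
    using bij that f_the_inv_into_f_bij_betw[of s J I i] the_inv_into_into[of s J i J]
    by (auto simp: r_def bij_betw_def)
  have rs: "r (s j) = j" if "j \<in> J" for j
    using bij that by (simp add: r_def bij_betw_def the_inv_into_f_f)
  have [measurable]: "(\<lambda>f. \<lambda>j\<in>J. f (s j)) \<in> (\<Pi>\<^sub>M i\<in>I. (lborel::'a measure)) \<rightarrow>\<^sub>M (\<Pi>\<^sub>M j\<in>J. (lborel::'a measure))"
    by (rule measurable_restrict) (auto simp: sJ intro!: measurable_component_singleton)
  show ?thesis
  proof (rule PiM_eqI[OF fJ])
    fix A :: "_ \<Rightarrow> 'a set" assume A: "\<And>j. j \<in> J \<Longrightarrow> A j \<in> sets lborel"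
    have "(\<lambda>f. \<lambda>j\<in>J. f (s j)) -` Pi\<^sub>E J A \<inter> space (\<Pi>\<^sub>M i\<in>I. (lborel::'a measure)) = Pi\<^sub>E I (\<lambda>i. A (r i))"
      by (auto simp: space_PiM PiE_iff sJ r rs) (metis r rs sJ)+
    then have "emeasure (distr (\<Pi>\<^sub>M i\<in>I. (lborel::'a measure)) (\<Pi>\<^sub>M j\<in>J. (lborel::'a measure)) (\<lambda>f. \<lambda>j\<in>J. f (s j))) (Pi\<^sub>E J A)
      = (\<Prod>i\<in>I. emeasure lborel (A (r i)))"
      using A r by (subst emeasure_distr) (auto intro!: sets_PiM_I_finite fJ emeasure_PiM assms)
    also have "\<dots> = (\<Prod>j\<in>J. emeasure lborel (A j))"
      by (rule prod.reindex_bij_betw[symmetric, OF bij, THEN trans]) (auto simp: rs intro!: prod.cong)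
    finally show "emeasure (distr (\<Pi>\<^sub>M i\<in>I. (lborel::'a measure)) (\<Pi>\<^sub>M j\<in>J. (lborel::'a measure)) (\<lambda>f. \<lambda>j\<in>J. f (s j))) (Pi\<^sub>E J A)
      = (\<Prod>j\<in>J. emeasure lborel (A j))" .
  qed simp
qed

text \<open>This is the substitution behind the Schur complement: with the last row and column
  fixed, subtracting \<open>schur_shift\<close> from the remaining block is a translation.\<close>

lemma PiM_lborel_translate:
  assumes "finite I"
  shows "distr (\<Pi>\<^sub>M i\<in>I. lborel) (\<Pi>\<^sub>M i\<in>I. lborel) (\<lambda>f. \<lambda>i\<in>I. f i + t i)
    = (\<Pi>\<^sub>M i\<in>I. (lborel :: 'a::euclidean_space measure))"
proof -
  interpret product_sigma_finite "\<lambda>_. lborel :: 'a measure" ..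
  have [measurable]: "(\<lambda>f. \<lambda>i\<in>I. f i + t i) \<in> (\<Pi>\<^sub>M i\<in>I. (lborel::'a measure)) \<rightarrow>\<^sub>M (\<Pi>\<^sub>M i\<in>I. (lborel::'a measure))"
    by measurable
  show ?thesis
  proof (rule PiM_eqI[OF assms])
    fix A :: "_ \<Rightarrow> 'a set" assume A: "\<And>i. i \<in> I \<Longrightarrow> A i \<in> sets lborel"
    have A': "(\<lambda>x. x + t i) -` A i \<in> sets lborel" if "i \<in> I" for i
      using measurable_sets[of "\<lambda>x. x + t i" lborel lborel "A i"] A[OF that] by simp
    have e: "emeasure lborel ((\<lambda>x. x + t i) -` A i) = emeasure lborel (A i)" if "i \<in> I" for i
    proof -
      have "emeasure lborel (A i) = emeasure (distr lborel borel ((+) (t i))) (A i)"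
        by (simp add: lborel_distr_plus)
      also have "\<dots> = emeasure lborel ((\<lambda>x. x + t i) -` A i)"
        using A[OF that] by (subst emeasure_distr) (auto simp: add.commute[of "t i" for i] intro!: arg_cong[where f="emeasure lborel"])
      finally show ?thesis by simp
    qed
    have "(\<lambda>f. \<lambda>i\<in>I. f i + t i) -` Pi\<^sub>E I A \<inter> space (\<Pi>\<^sub>M i\<in>I. (lborel::'a measure)) = Pi\<^sub>E I (\<lambda>i. (\<lambda>x. x + t i) -` A i)"
      by (auto simp: space_PiM PiE_iff)
    then show "emeasure (distr (\<Pi>\<^sub>M i\<in>I. (lborel::'a measure)) (\<Pi>\<^sub>M i\<in>I. (lborel::'a measure)) (\<lambda>f. \<lambda>i\<in>I. f i + t i)) (Pi\<^sub>E I A)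
      = (\<Prod>i\<in>I. emeasure lborel (A i))"
      using A A' by (subst emeasure_distr) (auto intro!: sets_PiM_I_finite emeasure_PiM[THEN trans] assms prod.cong e)
  qed simp
qed

text \<open>Along the standard basis \<open>lborel\<close> is a product measure; the isometry
  \<open>T\<close> sending the standard basis to the \<open>b i\<close> carries this over. The index
  set is an arbitrary finite set, so that a Hermitian matrix can be coordinatised by its array of
  \<open>d * d\<close> real numbers.\<close>

lemma lborel_eq_distr_orthonormal:
  fixes b :: "'i \<Rightarrow> 'a::euclidean_space"
  assumes fin: "finite I" and card: "card I = DIM('a)"
    and orth: "\<And>i j. i \<in> I \<Longrightarrow> j \<in> I \<Longrightarrow> inner (b i) (b j) = (if i = j then 1 else 0)"
  shows "distr (\<Pi>\<^sub>M i\<in>I. lborel) borel (\<lambda>f. \<Sum>i\<in>I. f i *\<^sub>R b i) = (lborel :: 'a measure)"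
proof -
  obtain s where s: "bij_betw s (Basis :: 'a set) I"
    using finite_same_card_bij[OF finite_Basis fin] card by auto
  define T where "T x = (\<Sum>e\<in>Basis. (x \<bullet> e) *\<^sub>R b (s e))" for x :: 'a
  have sI: "s e \<in> I" if "e \<in> Basis" for e using s that by (auto simp: bij_betw_def)
  have sinj: "s e = s e' \<longleftrightarrow> e = e'" if "e \<in> Basis" "e' \<in> Basis" for e e'
    using s that by (auto simp: bij_betw_def inj_on_def)
  have lin: "linear T"
    unfolding T_def by (intro linearI)
      (auto simp: inner_left_distrib scaleR_add_left sum.distrib scaleR_sum_right)
  have "T x \<bullet> T x = x \<bullet> x" for x
  proof -
    have "T x \<bullet> T x = (\<Sum>e\<in>Basis. \<Sum>e'\<in>Basis. (x \<bullet> e) * (x \<bullet> e') * (if e = e' then 1 else 0))"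
      unfolding T_def inner_sum_left inner_sum_right
      by (intro sum.cong refl) (simp add: orth sI sinj)
    also have "\<dots> = (\<Sum>e\<in>Basis. (x \<bullet> e) * (x \<bullet> e))" by (simp add: if_distrib cong: if_cong)
    finally show ?thesis by (simp add: euclidean_inner[of x x])
  qed
  then have norm: "norm (T x) = norm x" for x by (simp add: norm_eq_sqrt_inner)
  have Tm[measurable]: "T \<in> borel_measurable borel"
    using lin by (rule borel_measurable_linear)
  have restr[measurable]: "(\<lambda>f. \<lambda>j\<in>Basis. f (s j)) \<in> (\<Pi>\<^sub>M i\<in>I. (lborel::real measure)) \<rightarrow>\<^sub>M (\<Pi>\<^sub>M j\<in>(Basis::'a set). (lborel::real measure))"
    by (rule measurable_restrict) (auto simp: sI intro!: measurable_component_singleton)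
  have "lborel = distr lborel borel T"
    by (rule lborel_distr_linear_isometry[symmetric, OF lin norm])
  also have "\<dots> = distr (distr (\<Pi>\<^sub>M b\<in>Basis. lborel) borel (\<lambda>f. \<Sum>b\<in>Basis. f b *\<^sub>R b)) borel T"
    by (simp add: lborel_eq[symmetric])
  also have "\<dots> = distr (\<Pi>\<^sub>M b\<in>Basis. lborel) borel (\<lambda>f. T (\<Sum>b\<in>Basis. f b *\<^sub>R b))"
    by (subst distr_distr) (auto simp: o_def)
  also have "\<dots> = distr (distr (\<Pi>\<^sub>M i\<in>I. lborel) (\<Pi>\<^sub>M j\<in>(Basis::'a set). lborel) (\<lambda>f. \<lambda>j\<in>Basis. f (s j))) borel (\<lambda>f. T (\<Sum>b\<in>Basis. f b *\<^sub>R b))"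
    by (simp add: PiM_lborel_reindex[OF fin s])
  also have "\<dots> = distr (\<Pi>\<^sub>M i\<in>I. lborel) borel (\<lambda>f. T (\<Sum>e\<in>Basis. f (s e) *\<^sub>R e))"
    by (subst distr_distr) (auto simp: o_def)
  also have "(\<lambda>f. T (\<Sum>e\<in>Basis. f (s e) *\<^sub>R e)) = (\<lambda>f. \<Sum>i\<in>I. f i *\<^sub>R b i)"
  proof
    fix f :: "'i \<Rightarrow> real"
    have "T (\<Sum>e\<in>Basis. f (s e) *\<^sub>R e) = (\<Sum>e\<in>Basis. f (s e) *\<^sub>R b (s e))"
      by (simp add: T_def)
    also have "\<dots> = (\<Sum>i\<in>I. f i *\<^sub>R b i)" by (rule sum.reindex_bij_betw[OF s])
    finally show "T (\<Sum>e\<in>Basis. f (s e) *\<^sub>R e) = (\<Sum>i\<in>I. f i *\<^sub>R b i)" .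
  qed
  finally show ?thesis ..
qed

subsection \<open>The Steiner formula\<close>

text \<open>In an orthonormal basis adapted to \<open>L\<close> the stretch is diagonal, with entry
  1 on \<open>L\<close> and \<open>t\<close> on the complement, so its determinant is
  \<open>t ^ k\<close> with \<open>k\<close> the dimension of the orthogonal complement. The
  isometry \<open>T\<close> takes the standard basis to the adapted one and conjugates the stretch
  into the coordinate scaling \<open>D\<close>.\<close>

lemma lborel_stretch_orthogonal_complement:
  fixes L :: "'a::euclidean_space set"
  assumes L: "subspace L"
  obtains pr :: "'a \<Rightarrow> 'a" and k :: nat where "linear pr" "k \<le> DIM('a)"
    "\<And>x. x \<in> L \<Longrightarrow> pr x = x" "\<And>u. (\<And>x. x \<in> L \<Longrightarrow> u \<bullet> x = 0) \<Longrightarrow> pr u = 0"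
    "\<And>t A. t > 0 \<Longrightarrow> A \<in> sets borel \<Longrightarrow>
      ennreal (t ^ k) * emeasure lborel ((\<lambda>x. pr x + t *\<^sub>R (x - pr x)) -` A) = emeasure lborel A"
proof -
  obtain B1 where B1: "B1 \<subseteq> L" "pairwise orthogonal B1" "\<And>x. x \<in> B1 \<Longrightarrow> norm x = 1"
      "independent B1" "card B1 = dim L" "span B1 = L"
    using orthonormal_basis_subspace[OF L] by blast
  let ?M = "{y. \<forall>x\<in>L. orthogonal x y}"
  have M: "subspace ?M"
    by (auto simp: subspace_def orthogonal_def inner_add_right)
  obtain B2 where B2: "B2 \<subseteq> ?M" "pairwise orthogonal B2" "\<And>x. x \<in> B2 \<Longrightarrow> norm x = 1"
      "independent B2" "card B2 = dim ?M" "span B2 = ?M"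
    using orthonormal_basis_subspace[OF M] by blast
  have fin: "finite B1" "finite B2" using B1(4) B2(4) independent_imp_finite by auto
  have disj: "B1 \<inter> B2 = {}"
  proof -
    have "orthogonal x x" if "x \<in> B1" "x \<in> B2" for x using that B1(1) B2(1) by auto
    then show ?thesis using B1(3) by (auto simp: orthogonal_def) (metis inner_eq_zero_iff norm_zero zero_neq_one)
  qed
  have "card (B1 \<union> B2) = DIM('a)"
    using dim_subspace_orthogonal_to_vectors[OF L subspace_UNIV] fin disj B1(5) B2(5)
    by (simp add: card_Un_disjoint)
  then obtain s where s: "bij_betw s (Basis :: 'a set) (B1 \<union> B2)"
    using finite_same_card_bij[OF finite_Basis, of "B1 \<union> B2"] fin by auto
  have orth: "x \<bullet> y = (if x = y then 1 else 0)" if "x \<in> B1 \<union> B2" "y \<in> B1 \<union> B2" for x y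
  proof (cases "x = y")
    case True
    with that B1(3) B2(3) show ?thesis by (auto simp: dot_square_norm)
  next
    case False
    have "orthogonal a b" if "a \<in> B1" "b \<in> B2" for a b
      using that B1(1) B2(1) by auto
    then have "orthogonal x y"
      using that False B1(2) B2(2) unfolding pairwise_def
      by (metis Un_iff orthogonal_commute)
    with False show ?thesis by (simp add: orthogonal_def)
  qed
  define pr where "pr x = (\<Sum>b\<in>B1. (x \<bullet> b) *\<^sub>R b)" for x
  have lin: "linear pr"
    unfolding pr_def by (intro linearI)
      (auto simp: inner_left_distrib scaleR_add_left sum.distrib scaleR_sum_right)
  have prB: "pr b = b" if "b \<in> B1" for b
  proof -
    have "pr b = (\<Sum>c\<in>B1. (if b = c then b else 0))"
      unfolding pr_def using that by (intro sum.cong) (auto simp: orth)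
    then show ?thesis using that fin by simp
  qed
  have prL: "pr x = x" if "x \<in> L" for x
    using linear_eq_on_span[OF lin linear_ident, of B1 x] prB that B1(6) by auto
  have pr0: "pr u = 0" if "\<And>x. x \<in> L \<Longrightarrow> u \<bullet> x = 0" for u
    unfolding pr_def using that B1(1) by (auto intro!: sum.neutral)
  define T where "T x = (\<Sum>e\<in>Basis. (x \<bullet> e) *\<^sub>R s e)" for x :: 'a
  have sI: "s e \<in> B1 \<union> B2" if "e \<in> Basis" for e using s that by (auto simp: bij_betw_def)
  have sinj: "s e = s e' \<longleftrightarrow> e = e'" if "e \<in> Basis" "e' \<in> Basis" for e e'
    using s that by (auto simp: bij_betw_def inj_on_def)
  have linT: "linear T"
    unfolding T_def by (intro linearI)
      (auto simp: inner_left_distrib scaleR_add_left sum.distrib scaleR_sum_right)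
  have "T x \<bullet> T x = x \<bullet> x" for x
  proof -
    have "T x \<bullet> T x = (\<Sum>e\<in>Basis. \<Sum>e'\<in>Basis. (x \<bullet> e) * (x \<bullet> e') * (if e = e' then 1 else 0))"
      unfolding T_def inner_sum_left inner_sum_right
      by (intro sum.cong refl) (use sI in \<open>simp add: orth sinj\<close>)
    also have "\<dots> = (\<Sum>e\<in>Basis. (x \<bullet> e) * (x \<bullet> e))" by (simp add: if_distrib cong: if_cong)
    finally show ?thesis by (simp add: euclidean_inner[of x x])
  qed
  then have norm: "norm (T x) = norm x" for x by (simp add: norm_eq_sqrt_inner)
  have [measurable]: "T \<in> borel_measurable borel" "pr \<in> borel_measurable borel"
    using lin linT by (auto intro: borel_measurable_linear)
  define k where "k = card {e \<in> Basis. s e \<notin> B1}"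
  show ?thesis
  proof (rule that[OF lin _ prL pr0])
    show "k \<le> DIM('a)" unfolding k_def by (intro card_mono) auto
    fix t :: real and A :: "'a set" assume t: "t > 0" and A[measurable]: "A \<in> sets borel"
    define c where "c e = (if s e \<in> B1 then 1 else t)" for e
    define D where "D x = (\<Sum>e\<in>Basis. (c e * (x \<bullet> e)) *\<^sub>R e)" for x :: 'a
    have [measurable]: "D \<in> borel_measurable borel" unfolding D_def by simp
    define S where "S x = pr x + t *\<^sub>R (x - pr x)" for x
    have [measurable]: "S \<in> borel_measurable borel" unfolding S_def by simp
    have prT: "pr (T x) = (\<Sum>e\<in>Basis. if s e \<in> B1 then (x \<bullet> e) *\<^sub>R s e else 0)" for x
    proof -
      have "pr (s e) = (if s e \<in> B1 then s e else 0)" if "e \<in> Basis" for e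
      proof (cases "s e \<in> B1")
        case False
        then have "s e \<in> B2" using sI[OF that] by auto
        then have "\<And>x. x \<in> L \<Longrightarrow> s e \<bullet> x = 0" using B2(1) by (auto simp: orthogonal_def inner_commute)
        then show ?thesis using False pr0 by auto
      qed (simp add: prB)
      then show ?thesis
        unfolding T_def linear_sum[OF lin] linear_scale[OF lin] by (intro sum.cong) auto
    qed
    have ST: "S (T x) = T (D x)" for x
      unfolding S_def prT unfolding T_def D_def
      by (simp add: scaleR_right_diff_distrib scaleR_sum_right sum_subtractf[symmetric] sum.distrib[symmetric] c_def)
        (intro sum.cong refl, auto)
    have "(\<Prod>j\<in>Basis. \<bar>c j\<bar>) = t ^ k"
      unfolding c_def k_def using t
      by (simp add: if_distrib[of abs] prod.If_cases Int_def)
    then have D: "lborel = density (distr lborel borel D) (\<lambda>_. ennreal (t ^ k))"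
      using lborel_affine_euclidean[of c 0] t by (simp add: c_def D_def[abs_def])
    have "emeasure lborel (S -` A) = emeasure (distr (distr lborel borel T) borel S) A"
      by (simp add: lborel_distr_linear_isometry[OF linT norm] emeasure_distr)
    also have "\<dots> = emeasure (distr lborel borel D) (T -` A)"
      using measurable_sets[of T borel borel A]
      by (simp add: distr_distr emeasure_distr vimage_def ST)
    finally have "ennreal (t ^ k) * emeasure lborel (S -` A) = emeasure (density (distr lborel borel D) (\<lambda>_. ennreal (t ^ k))) (T -` A)"
      using measurable_sets[of T borel borel A]
      by (subst emeasure_density) (auto simp: nn_integral_cmult)
    also have "\<dots> = emeasure (distr lborel borel T) A"
      unfolding D[symmetric] by (simp add: emeasure_distr)
    finally show "ennreal (t ^ k) * emeasure lborel ((\<lambda>x. pr x + t *\<^sub>R (x - pr x)) -` A) = emeasure lborel A"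
      by (simp add: lborel_distr_linear_isometry[OF linT norm] S_def[abs_def])
  qed
qed

section \<open>Nearest points and the fibres of the nearest-point map\<close>

lemma infdist_eq_dist_closest_point:
  fixes S :: "'a::euclidean_space set"
  assumes "closed S" "S \<noteq> {}"
  shows "infdist x S = dist x (closest_point S x)"
proof (rule antisym)
  show "infdist x S \<le> dist x (closest_point S x)"
    using assms by (intro infdist_le closest_point_in_set)
  obtain y where "y \<in> S" "infdist x S = dist x y"
    using infdist_attains_inf[OF assms] by auto
  then show "dist x (closest_point S x) \<le> infdist x S"
    using closest_point_le[OF assms(1)] by auto
qed

lemma compact_parallel_body:
  fixes K :: "'a::euclidean_space set"
  assumes "compact K" "K \<noteq> {}"
  shows "compact {x. infdist x K \<le> e}"
proof -
  have "closed {x. infdist x K \<le> e}"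
    by (intro closed_Collect_le continuous_intros)
  moreover obtain r where r: "\<And>y. y \<in> K \<Longrightarrow> norm y \<le> r"
    using compact_imp_bounded[OF assms(1)] by (auto simp: bounded_iff)
  have "norm x \<le> r + e" if "infdist x K \<le> e" for x
  proof -
    obtain y where y: "y \<in> K" "infdist x K = dist x y"
      using infdist_attains_inf[OF compact_imp_closed[OF assms(1)] assms(2)] by auto
    have "norm x \<le> norm y + dist x y" by (metis dist_norm norm_triangle_sub)
    with y r[of y] that show ?thesis by simp
  qed
  then have "bounded {x. infdist x K \<le> e}" by (auto simp: bounded_iff)
  ultimately show ?thesis by (simp add: compact_eq_bounded_closed)
qed

text \<open>The nearest point \<open>y\<close> is characterised by
  \<open>(x - y) \<bullet> (z - y) \<le> 0\<close> for all \<open>z\<close> in \<open>S\<close>, and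
  this condition survives multiplication of \<open>x - y\<close> by a nonnegative factor.\<close>

lemma closest_point_normal_ray:
  fixes S :: "'a::euclidean_space set" and x :: 'a
  assumes S: "convex S" "closed S" "S \<noteq> {}" and a: "a \<ge> 0"
  defines "y \<equiv> closest_point S x"
  shows "closest_point S (y + a *\<^sub>R (x - y)) = y"
proof -
  have yS: "y \<in> S" using S closest_point_in_set y_def by auto
  have "dist (y + a *\<^sub>R (x - y)) y \<le> dist (y + a *\<^sub>R (x - y)) z" if "z \<in> S" for z
  proof -
    have d: "(x - y) \<bullet> (z - y) \<le> 0" using closest_point_dot[OF S(1,2) that] by (simp add: y_def)
    have "a * ((x - y) \<bullet> (z - y)) \<le> 0" using d a by (simp add: mult_nonneg_nonpos)
    moreover have "y + a *\<^sub>R (x - y) - z = a *\<^sub>R (x - y) - (z - y)" by simp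
    then have "(norm (y + a *\<^sub>R (x - y) - z))\<^sup>2 = (norm (a *\<^sub>R (x - y)))\<^sup>2 + (norm (z - y))\<^sup>2 - 2 * (a * ((x - y) \<bullet> (z - y)))" (is "_ = _ + ?n - _")
      unfolding power2_norm_eq_inner by (simp only:) (simp add: inner_diff_left inner_diff_right inner_commute algebra_simps)
    moreover have "?n \<ge> 0" by simp
    ultimately have "(norm (a *\<^sub>R (x - y)))\<^sup>2 \<le> (norm (y + a *\<^sub>R (x - y) - z))\<^sup>2" by linarith
    then show ?thesis by (simp add: dist_norm)
  qed
  then show ?thesis using closest_point_unique[OF S(1,2) yS] by metis
qed

text \<open>The points whose nearest point lies in the relative interior of \<open>F\<close> are fibred by normal vectors
  orthogonal to \<open>F\<close>; stretching along the orthogonal complement of \<open>F\<close> changes the admissible distance.\<close>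
lemma measure_normal_stratum:
  fixes P F :: "'a::euclidean_space set"
  assumes P: "convex P" "compact P" "P \<noteq> {}" and F: "F \<subseteq> P" "convex F"
  defines "N \<equiv> \<lambda>e. {x. closest_point P x \<in> rel_interior F \<and> infdist x P \<le> e}"
  shows "\<exists>k\<le>DIM('a). \<forall>e>0. measure lborel (N e) = e ^ k * measure lborel (N 1)"
    and "N e \<in> sets borel"
proof -
  have cl: "closed P" using P compact_imp_closed by auto
  have cm[measurable]: "closest_point P \<in> borel_measurable borel"
    using continuous_on_closest_point[OF P(1) cl P(3)] by (intro borel_measurable_continuous_onI)
  obtain U where U: "open U" "rel_interior F = affine hull F \<inter> U"
    using openin_rel_interior[of F] by (auto simp: openin_open)
  have [measurable]: "rel_interior F \<in> sets borel"
    unfolding U(2) using U(1) by (intro sets.Int) (auto intro: borel_closed)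
  have [measurable]: "(\<lambda>x. infdist x P) \<in> borel_measurable borel"
    by (intro borel_measurable_continuous_onI continuous_intros)
  have Nb: "N e \<in> sets borel" for e unfolding N_def by simp
  then show "N e \<in> sets borel" .
  show "\<exists>k\<le>DIM('a). \<forall>e>0. measure lborel (N e) = e ^ k * measure lborel (N 1)"
  proof (cases "rel_interior F = {}")
    case True
    then have "N = (\<lambda>e. {})" by (auto simp: N_def)
    then show ?thesis by auto
  next
    case False
    then obtain y0 where y0: "y0 \<in> rel_interior F" by auto
    define L where "L = span ((\<lambda>y. y - y0) ` rel_interior F)"
    obtain pr k where pr: "linear pr" "k \<le> DIM('a)"
      "\<And>x. x \<in> L \<Longrightarrow> pr x = x" "\<And>u. (\<And>x. x \<in> L \<Longrightarrow> u \<bullet> x = 0) \<Longrightarrow> pr u = 0"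
      "\<And>t A. t > 0 \<Longrightarrow> A \<in> sets borel \<Longrightarrow>
        ennreal (t ^ k) * emeasure lborel ((\<lambda>x. pr x + t *\<^sub>R (x - pr x)) -` A) = emeasure lborel A"
      using lborel_stretch_orthogonal_complement[OF subspace_span[of "(\<lambda>y. y - y0) ` rel_interior F", folded L_def]]
      by blast
    have [measurable]: "pr \<in> borel_measurable borel"
      using pr(1) by (rule borel_measurable_linear)
    \<comment> \<open>\<open>S\<close> is built from the linear projection \<open>pr\<close> and
      does not mention the nearest point, so its effect on volume is known; on the stratum it agrees
      with motion along the normal ray.\<close>
    define S where "S a x = y0 + (pr (x - y0) + a *\<^sub>R ((x - y0) - pr (x - y0)))" for a x
    have step: "S a x = closest_point P x + a *\<^sub>R (x - closest_point P x)"
      if "closest_point P x \<in> rel_interior F" for x a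
    proof -
      define y where "y = closest_point P x"
      have perp: "(x - y) \<bullet> (z - y) = 0" if z: "z \<in> rel_interior F" for z
      proof -
        have zP: "z \<in> P" using z rel_interior_subset F by blast
        have "(x - y) \<bullet> (z - y) \<le> 0" using closest_point_dot[OF P(1) cl zP] by (simp add: y_def)
        moreover have "z \<in> affine hull F" using z rel_interior_subset hull_subset[of F affine] by blast
        \<comment> \<open>Since \<open>y\<close> is a relative interior point of \<open>F\<close>,
          the segment from \<open>z\<close> can be prolonged beyond \<open>y\<close> inside
          \<open>F\<close>. The variational inequality at the prolonged point has the opposite sign,
          which forces orthogonality.\<close>
        then obtain e where e: "e > 1" "(1 - e) *\<^sub>R z + e *\<^sub>R y \<in> F"
          using convex_rel_interior_if2[OF F(2), of y] that \<open>closest_point P x \<in> rel_interior F\<close> y_def by blast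
        have "(x - y) \<bullet> ((1 - e) *\<^sub>R z + e *\<^sub>R y - y) \<le> 0"
          using closest_point_dot[OF P(1) cl, of "(1 - e) *\<^sub>R z + e *\<^sub>R y"] e F by (auto simp: y_def)
        moreover have "(1 - e) *\<^sub>R z + e *\<^sub>R y - y = (1 - e) *\<^sub>R (z - y)" by (simp add: algebra_simps)
        ultimately have "(1 - e) * ((x - y) \<bullet> (z - y)) \<le> 0" by simp
        then have "(x - y) \<bullet> (z - y) \<ge> 0" using e by (simp add: mult_le_0_iff)
        with \<open>(x - y) \<bullet> (z - y) \<le> 0\<close> show ?thesis by simp
      qed
      have "(x - y) \<bullet> l = 0" if "l \<in> L" for l
        using that unfolding L_def
      proof (induction rule: span_induct_alt)
        case (step c b l)
        then obtain z where z: "z \<in> rel_interior F" "b = z - y0" by auto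
        have "(x - y) \<bullet> b = (x - y) \<bullet> (z - y) - (x - y) \<bullet> (y0 - y)" by (simp add: z inner_diff_right)
        then show ?case using step perp[OF z(1)] perp[OF y0] by (simp add: inner_add_right)
      qed simp
      then have p1: "pr (x - y) = 0" using pr(4) by blast
      have p2: "pr (y - y0) = y - y0" using pr(3) that unfolding L_def y_def by (auto intro: span_base)
      have "pr (x - y0) = pr ((y - y0) + (x - y))" by simp
      also have "\<dots> = y - y0" unfolding linear_add[OF pr(1)] p1 p2 by simp
      finally show ?thesis unfolding S_def y_def[symmetric] by simp
    qed
    have fwd: "S a x \<in> N (a * e)" if "x \<in> N e" "a > 0" for a x e
    proof -
      have c: "closest_point P x \<in> rel_interior F" "dist x (closest_point P x) \<le> e"
        using that infdist_eq_dist_closest_point[OF cl P(3)] by (auto simp: N_def)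
      have "closest_point P (S a x) = closest_point P x"
        unfolding step[OF c(1)] using closest_point_normal_ray[OF P(1) cl P(3), of a x] that by simp
      then show ?thesis
        using c that(2) unfolding N_def infdist_eq_dist_closest_point[OF cl P(3)]
        by (simp add: step[OF c(1)] dist_norm)
    qed
    have inv: "S (1 / a) (S a x) = x" if "a > 0" for a x
    proof -
      have "pr (pr (x - y0)) = pr (x - y0)"
      proof -
        obtain l u where "l \<in> L" "\<And>w. w \<in> L \<Longrightarrow> orthogonal u w" "x - y0 = l + u"
          using orthogonal_subspace_decomp_exists[of "(\<lambda>y. y - y0) ` rel_interior F" "x - y0"] unfolding L_def by blast
        then have "pr (x - y0) = l" using pr(1,3,4) by (auto simp: linear_add orthogonal_def)
        with pr(3) \<open>l \<in> L\<close> show ?thesis by simp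
      qed
      then show ?thesis
        using that by (simp add: S_def linear_add[OF pr(1)] linear_diff[OF pr(1)] linear_scale[OF pr(1)])
    qed
    have "measure lborel (N e) = e ^ k * measure lborel (N 1)" if "e > 0" for e
    proof -
      have "x \<in> N e \<longleftrightarrow> S (1 / e) x \<in> N 1" for x
        using fwd[of x e "1/e"] fwd[of "S (1 / e) x" 1 e] inv[of "1/e" x] \<open>e > 0\<close> by auto
      then have "N e = S (1 / e) -` N 1" by auto
      also have "\<dots> = (\<lambda>x. x - y0) -` ((\<lambda>x. pr x + (1 / e) *\<^sub>R (x - pr x)) -` ((\<lambda>x. y0 + x) -` N 1))"
        by (auto simp: S_def)
      finally have Ne: "N e = (\<lambda>x. x - y0) -` ((\<lambda>x. pr x + (1 / e) *\<^sub>R (x - pr x)) -` ((\<lambda>x. y0 + x) -` N 1))" .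
      have shift: "emeasure lborel ((+) a -` A) = emeasure lborel A" if [measurable]: "A \<in> sets borel" for A and a :: 'a
        using emeasure_distr[of "(+) a" lborel borel A] lborel_distr_plus[of a] by simp
      have sh: "(\<lambda>x. y0 + x) -` N 1 \<in> sets borel"
        using measurable_sets[of "(+) y0" borel borel "N 1"] Nb by simp
      have sh2: "(\<lambda>x. pr x + (1 / e) *\<^sub>R (x - pr x)) -` ((\<lambda>x. y0 + x) -` N 1) \<in> sets borel"
        using measurable_sets[of "\<lambda>x. pr x + (1 / e) *\<^sub>R (x - pr x)" borel borel, OF _ sh] by simp
      have "emeasure lborel (N e) = emeasure lborel ((\<lambda>x. pr x + (1 / e) *\<^sub>R (x - pr x)) -` ((\<lambda>x. y0 + x) -` N 1))"
        unfolding Ne using shift[OF sh2, of "- y0"] by (simp add: vimage_def)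
      then have "ennreal ((1 / e) ^ k) * emeasure lborel (N e) = emeasure lborel (N 1)"
        using pr(5)[of "1/e", OF _ sh] that shift[OF Nb, of y0 1] by simp
      then have "measure lborel (N 1) = (1 / e) ^ k * measure lborel (N e)"
        unfolding measure_def using that by (metis enn2real_mult enn2real_ennreal zero_le_power zero_le_divide_1_iff less_imp_le)
      then show ?thesis using that by (simp add: field_simps)
    qed
    with pr(2) show ?thesis by blast
  qed
qed

section \<open>The Steiner polynomial of a polytope\<close>

text \<open>The face is the smallest one containing \<open>y\<close>. A point of its relative
  frontier would lie in a proper face of it, contradicting minimality.\<close>

lemma polytope_point_in_rel_interior_face:
  fixes P :: "'a::euclidean_space set"
  assumes P: "polytope P" and y: "y \<in> P"
  obtains F where "F face_of P" "y \<in> rel_interior F"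
proof -
  define F where "F = \<Inter>{F. F face_of P \<and> y \<in> F}"
  have PP: "P face_of P" using P by (simp add: face_of_refl polytope_imp_convex)
  have F: "F face_of P"
    unfolding F_def using PP y by (intro face_of_Inter) auto
  have yF: "y \<in> F" by (auto simp: F_def)
  have poly: "polyhedron F" using face_of_polytope_polytope[OF P F] polytope_imp_polyhedron by blast
  have "y \<in> rel_interior F"
  proof (rule ccontr)
    assume "y \<notin> rel_interior F"
    then have "y \<in> rel_frontier F" using yF closure_subset by (auto simp: rel_frontier_def)
    then obtain G where G: "G face_of F" "G \<noteq> F" "y \<in> G"
      using rel_frontier_of_polyhedron_alt[OF poly] by auto
    then have "G face_of P" using F face_of_trans by blast
    then have "F \<subseteq> G" using G(3) by (auto simp: F_def)
    then show False using G face_of_imp_subset by blast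
  qed
  with F that show ?thesis by blast
qed

text \<open>The relative interiors of the finitely many faces partition \<open>P\<close>, so the
  normal strata partition the parallel body and each contributes one monomial. Nonnegativity of the
  \<open>c j\<close> prepares the passage to the limit: it bounds every coefficient by the volume at
  \<open>e = 1\<close>.\<close>

lemma polytope_Steiner_formula:
  fixes P :: "'a::euclidean_space set"
  assumes P: "polytope P" "P \<noteq> {}"
  obtains c :: "nat \<Rightarrow> real" where "\<And>j. c j \<ge> 0"
    "\<And>e. e > 0 \<Longrightarrow> measure lborel {x. infdist x P \<le> e} = (\<Sum>j\<le>DIM('a). c j * e ^ j)"
proof -
  have cP: "convex P" "compact P" using P polytope_imp_convex polytope_imp_compact by auto
  define N where "N F e = {x. closest_point P x \<in> rel_interior F \<and> infdist x P \<le> e}" for F e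
  have "\<exists>k. k \<le> DIM('a) \<and> (\<forall>e>0. measure lborel (N F e) = e ^ k * measure lborel (N F 1))" if "F face_of P" for F
    using measure_normal_stratum(1)[OF cP P(2) face_of_imp_subset[OF that] face_of_imp_convex[OF that]]
    unfolding N_def by blast
  then obtain k where k: "\<And>F. F face_of P \<Longrightarrow> k F \<le> DIM('a)"
      "\<And>F e. F face_of P \<Longrightarrow> e > 0 \<Longrightarrow> measure lborel (N F e) = e ^ k F * measure lborel (N F 1)"
    by metis
  have Nb: "N F e \<in> sets borel" if "F face_of P" for F e
    using measure_normal_stratum(2)[OF cP P(2) face_of_imp_subset[OF that] face_of_imp_convex[OF that]]
    unfolding N_def by blast
  let ?\<F> = "{F. F face_of P}"
  have fin: "finite ?\<F>" by (rule finite_polytope_faces[OF P(1)])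
  define c where "c j = (\<Sum>F\<in>{F\<in>?\<F>. k F = j}. measure lborel (N F 1))" for j
  show ?thesis
  proof (rule that)
    show "c j \<ge> 0" for j unfolding c_def by (intro sum_nonneg) auto
    fix e :: real assume e: "e > 0"
    have cl: "closed P" using cP compact_imp_closed by auto
    have U: "{x. infdist x P \<le> e} = (\<Union>F\<in>?\<F>. N F e)"
    proof -
      have "\<exists>F. F face_of P \<and> closest_point P x \<in> rel_interior F" for x
        using polytope_point_in_rel_interior_face[OF P(1) closest_point_in_set[OF cl P(2)]] by metis
      then show ?thesis unfolding N_def by auto
    qed
    have disj: "disjoint_family_on (\<lambda>F. N F e) ?\<F>"
      unfolding disjoint_family_on_def
    proof (intro ballI impI)
      fix F G assume "F \<in> ?\<F>" "G \<in> ?\<F>" "F \<noteq> G"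
      then have "rel_interior F \<inter> rel_interior G = {}" using face_of_eq[of F P G] by auto
      then show "N F e \<inter> N G e = {}" by (auto simp: N_def)
    qed
    have "emeasure lborel (N F e) < \<infinity>" for F
    proof -
      have "emeasure lborel (N F e) \<le> emeasure lborel {x. infdist x P \<le> e}"
        using compact_parallel_body[OF cP(2) P(2), of e]
        by (intro emeasure_mono) (auto simp: N_def intro: borel_compact)
      then show ?thesis using emeasure_compact_finite[OF compact_parallel_body[OF cP(2) P(2), of e]]
        by (auto intro: le_less_trans)
    qed
    then have "measure lborel {x. infdist x P \<le> e} = (\<Sum>F\<in>?\<F>. measure lborel (N F e))"
      unfolding U using fin disj Nb
      by (intro measure_finite_Union) (auto simp: less_top)
    also have "\<dots> = (\<Sum>F\<in>?\<F>. measure lborel (N F 1) * e ^ k F)"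
      using k(2)[OF _ e] by (intro sum.cong) (auto simp: mult.commute)
    also have "\<dots> = (\<Sum>j\<le>DIM('a). \<Sum>F\<in>{F\<in>?\<F>. k F = j}. measure lborel (N F 1) * e ^ k F)"
      using k(1) fin by (intro sum.group[symmetric]) auto
    also have "\<dots> = (\<Sum>j\<le>DIM('a). c j * e ^ j)"
      unfolding c_def sum_distrib_right by (intro sum.cong) auto
    finally show "measure lborel {x. infdist x P \<le> e} = (\<Sum>j\<le>DIM('a). c j * e ^ j)" .
  qed
qed

section \<open>From polytopes to compact convex sets\<close>

text \<open>Induction on the degree bound: for a fixed \<open>a\<close> in \<open>X\<close> the
  difference quotients at \<open>a\<close> are polynomials of smaller degree and converge on
  \<open>X - {a}\<close>, which is still infinite.\<close>

lemma pointwise_limit_of_bounded_degree_polys: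
  fixes p :: "nat \<Rightarrow> real poly"
  assumes "infinite X" "\<And>n. degree (p n) \<le> D" "\<And>x. x \<in> X \<Longrightarrow> (\<lambda>n. poly (p n) x) \<longlonglongrightarrow> f x"
  shows "\<exists>q. \<forall>x\<in>X. f x = poly q x"
  using assms
proof (induction D arbitrary: X p f)
  case 0
  obtain a where a: "a \<in> X" using 0(1) infinite_imp_nonempty by blast
  have "f x = f a" if "x \<in> X" for x
  proof (rule LIMSEQ_unique[OF 0(3)[OF that]])
    have "poly (p n) x = poly (p n) a" for n
      using 0(2)[of n] by (auto elim!: degree_eq_zeroE)
    then show "(\<lambda>n. poly (p n) x) \<longlonglongrightarrow> f a" using 0(3)[OF a] by simp
  qed
  then show ?case by (intro exI[of _ "[:f a:]"]) auto
next
  case (Suc D)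
  obtain a where a: "a \<in> X" using Suc(2) infinite_imp_nonempty by blast
  define r where "r n = synthetic_div (p n) a" for n
  have r: "poly (p n) x = poly (p n) a + (x - a) * poly (r n) x" for n x
    using arg_cong[OF synthetic_div_correct'[of a "p n"], of "\<lambda>q. poly q x"] by (simp add: r_def algebra_simps)
  have "\<exists>q. \<forall>x\<in>X - {a}. (f x - f a) / (x - a) = poly q x"
  proof (rule Suc.IH)
    show "infinite (X - {a})" using Suc(2) by simp
    show "degree (r n) \<le> D" for n using Suc(3)[of n] by (simp add: r_def degree_synthetic_div)
    fix x assume x: "x \<in> X - {a}"
    have "poly (r n) x = (poly (p n) x - poly (p n) a) / (x - a)" for n
      using r[of n x] x by (simp add: field_simps)
    then show "(\<lambda>n. poly (r n) x) \<longlonglongrightarrow> (f x - f a) / (x - a)"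
      using x a by (simp add: tendsto_divide tendsto_diff Suc(4))
  qed
  then obtain q where q: "\<And>x. x \<in> X - {a} \<Longrightarrow> (f x - f a) / (x - a) = poly q x" by blast
  have "f x = poly ([:f a:] + [:-a, 1:] * q) x" if "x \<in> X" for x
  proof (cases "x = a")
    case False
    then show ?thesis using q[of x] that by (simp add: field_simps)
  qed simp
  then show ?case by blast
qed

text \<open>The polytope is the convex hull of a finite \<open>d\<close>-net of \<open>K\<close>.
  Being inside \<open>K\<close>, it allows a sandwich: its parallel body at distance
  \<open>e\<close> lies in that of \<open>K\<close>, which lies in that of \<open>P\<close> at
  distance \<open>e + d\<close>.\<close>

lemma inner_polytope_approximation:
  fixes K :: "'a::euclidean_space set"
  assumes K: "compact K" "convex K" "K \<noteq> {}" and d: "d > 0"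
  obtains P where "polytope P" "P \<noteq> {}" "P \<subseteq> K" "\<And>x. infdist x P \<le> infdist x K + d"
proof -
  obtain k where k: "finite k" "k \<subseteq> K" "K \<subseteq> (\<Union>x\<in>k. ball x d)"
  proof (rule compactE_image[OF K(1), of K "\<lambda>x. ball x d"])
    show "K \<subseteq> (\<Union>x\<in>K. ball x d)" using d by auto
  qed auto
  have ne: "k \<noteq> {}" using k K by auto
  have sub: "convex hull k \<subseteq> K" using k K by (simp add: hull_minimal)
  show ?thesis
  proof (rule that[of "convex hull k"])
    show "polytope (convex hull k)" using k by (simp add: polytope_convex_hull)
    fix x
    obtain y where y: "y \<in> K" "infdist x K = dist x y"
      using infdist_attains_inf[OF compact_imp_closed[OF K(1)] K(3)] by auto
    obtain z where z: "z \<in> k" "dist z y < d" using k y by auto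
    have "infdist x (convex hull k) \<le> dist x z" using z by (intro infdist_le) (simp add: hull_inc)
    also have "\<dots> \<le> dist x y + dist z y" by (simp add: dist_triangle2)
    finally show "infdist x (convex hull k) \<le> infdist x K + d" using y z by simp
  qed (use ne sub in auto)
qed

lemma Steiner_formula:
  fixes K :: "'a::euclidean_space set"
  assumes K: "compact K" "convex K" "K \<noteq> {}"
  shows "\<exists>q :: real poly. \<forall>e\<ge>0. measure lborel {x. infdist x K \<le> e} = poly q e"
proof -
  define f where "f e = measure lborel {x. infdist x K \<le> e}" for e
  have fm: "{x. infdist x Q \<le> e} \<in> fmeasurable lborel" if "compact Q" "Q \<noteq> {}" for e and Q :: "'a set"
    using fmeasurable_compact[OF compact_parallel_body[OF that]] .
  have pm: "{x. infdist x Q \<le> e} \<in> sets lborel" for e and Q :: "'a set"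
    by (simp, intro borel_closed closed_Collect_le continuous_intros)
  have "\<exists>P. polytope P \<and> P \<noteq> {} \<and> P \<subseteq> K \<and> (\<forall>x. infdist x P \<le> infdist x K + 1 / Suc n)" for n
    using inner_polytope_approximation[OF K, of "1 / Suc n"] by (metis of_nat_0_less_iff zero_less_Suc zero_less_divide_1_iff)
  then obtain P where P: "\<And>n. polytope (P n)" "\<And>n. P n \<noteq> {}" "\<And>n. P n \<subseteq> K"
      "\<And>n x. infdist x (P n) \<le> infdist x K + 1 / Suc n" by metis
  define g where "g n e = measure lborel {x. infdist x (P n) \<le> e}" for n e
  have cP: "compact (P n)" for n using P(1) polytope_imp_compact by blast
  have gf: "g n e \<le> f e" for n e
    unfolding g_def f_def using infdist_mono[OF P(3) P(2)]
    by (intro measure_mono_fmeasurable fm K pm) (auto intro: order_trans)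
  have fg: "f e \<le> g n (e + 1 / Suc n)" for n e
    unfolding g_def f_def
    by (intro measure_mono_fmeasurable fm cP P pm) (use P(4) in \<open>fastforce intro: order_trans\<close>)
  have "\<exists>c. (\<forall>j. c j \<ge> 0) \<and> (\<forall>e>0. g n e = (\<Sum>j\<le>DIM('a). c j * e ^ j))" for n
    using polytope_Steiner_formula[OF P(1,2), of n] unfolding g_def by metis
  then obtain c where c: "\<And>n j. c n j \<ge> (0::real)" "\<And>n e. e > 0 \<Longrightarrow> g n e = (\<Sum>j\<le>DIM('a). c n j * e ^ j)"
    by metis
  \<comment> \<open>The nonnegative coefficients add up to \<open>g n 1\<close>, so this bound is
    uniform in \<open>n\<close>; it makes the gap between \<open>g n (e + 1 / Suc n)\<close> and
    \<open>g n e\<close> tend to zero.\<close>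
  have cb: "c n j \<le> f 1" if "j \<le> DIM('a)" for n j
  proof -
    have "c n j \<le> (\<Sum>j\<le>DIM('a). c n j)" using that c(1) by (intro member_le_sum) auto
    also have "\<dots> = g n 1" using c(2)[of 1 n] by simp
    finally show ?thesis using gf[of n 1] by simp
  qed
  have lim: "(\<lambda>n. g n e) \<longlonglongrightarrow> f e" if e: "e > 0" for e
  proof -
    have b: "f e - g n e \<le> f 1 * (\<Sum>j\<le>DIM('a). (e + 1 / Suc n) ^ j - e ^ j)" for n
    proof -
      have "f e - g n e \<le> g n (e + 1 / Suc n) - g n e" using fg[of e n] by simp
      also have "\<dots> = (\<Sum>j\<le>DIM('a). c n j * ((e + 1 / Suc n) ^ j - e ^ j))"
      proof -
        have "e + 1 / Suc n > 0" using e by (simp add: add_pos_pos)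
        then show ?thesis using e by (simp add: c(2) sum_subtractf right_diff_distrib)
      qed
      also have "\<dots> \<le> (\<Sum>j\<le>DIM('a). f 1 * ((e + 1 / Suc n) ^ j - e ^ j))"
        using e by (intro sum_mono mult_right_mono cb) (auto intro!: power_mono)
      finally show ?thesis by (simp add: sum_distrib_left)
    qed
    have "(\<lambda>n. f 1 * (\<Sum>j\<le>DIM('a). (e + 1 / Suc n) ^ j - e ^ j)) \<longlonglongrightarrow> f 1 * (\<Sum>j\<le>DIM('a). (e + 0) ^ j - e ^ j)"
      by (intro tendsto_intros lim_1_over_n LIMSEQ_Suc)
    then have z: "(\<lambda>n. f 1 * (\<Sum>j\<le>DIM('a). (e + 1 / Suc n) ^ j - e ^ j)) \<longlonglongrightarrow> 0" by simp
    have "(\<lambda>n. f e - g n e) \<longlonglongrightarrow> 0"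
      by (rule tendsto_sandwich[OF _ _ tendsto_const z]) (use b gf in auto)
    from tendsto_diff[OF tendsto_const[of "f e"] this] show ?thesis by simp
  qed
  define p where "p n = (\<Sum>j\<le>DIM('a). monom (c n j) j)" for n
  have "\<exists>q. \<forall>x\<in>{0<..}. f x = poly q x"
  proof (rule pointwise_limit_of_bounded_degree_polys)
    show "infinite {0::real<..}" by (rule infinite_Ioi)
    show "degree (p n) \<le> DIM('a)" for n
      unfolding p_def by (intro degree_sum_le) (auto intro: order_trans[OF degree_monom_le])
    show "(\<lambda>n. poly (p n) x) \<longlonglongrightarrow> f x" if "x \<in> {0<..}" for x
      using lim[of x] that by (simp add: p_def poly_sum poly_monom c(2))
  qed
  then obtain q where q: "\<And>x. x > 0 \<Longrightarrow> f x = poly q x" by auto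
  \<comment> \<open>The polytope formula is available for positive \<open>e\<close>; the value at 0
    follows from continuity of the measure along the parallel bodies at distance
    \<open>1 / Suc n\<close>, which decrease to the one at distance 0.\<close>
  have "f 0 = poly q 0"
  proof (rule LIMSEQ_unique)
    let ?A = "\<lambda>n. {x. infdist x K \<le> 1 / Suc n}"
    have "(\<lambda>n. measure lborel (?A n)) \<longlonglongrightarrow> measure lborel (\<Inter>n. ?A n)"
    proof (rule Lim_measure_decseq)
      show "range ?A \<subseteq> sets lborel" using pm by blast
      have "1 / real (Suc n) \<le> 1 / real (Suc m)" if "m \<le> n" for m n using that by (intro divide_left_mono) auto
      then show "decseq ?A" by (force simp: decseq_def simp del: of_nat_Suc intro: order_trans)
      show "emeasure lborel (?A n) \<noteq> \<infinity>" for n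
        using fm[OF K(1,3), of "1 / Suc n"] by (simp add: fmeasurable_def less_top)
    qed
    moreover have "(\<Inter>n. ?A n) = {x. infdist x K \<le> 0}"
    proof -
      have "a \<le> 0" if "\<And>n. a \<le> 1 / Suc n" for a :: real
        using that by (intro LIMSEQ_le_const[OF LIMSEQ_Suc[OF lim_1_over_n]]) auto
      moreover have "a \<le> 1 / Suc n" if "a \<le> 0" for a :: real and n using that
        by (meson divide_nonneg_nonneg of_nat_0_le_iff order_trans zero_le_one)
      ultimately show ?thesis by (auto simp del: of_nat_Suc)
    qed
    ultimately show "(\<lambda>n. f (1 / Suc n)) \<longlonglongrightarrow> f 0" by (simp add: f_def)
    have "(\<lambda>n. poly q (1 / Suc n)) \<longlonglongrightarrow> poly q 0"
      by (intro tendsto_poly LIMSEQ_Suc[OF lim_1_over_n])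
    then show "(\<lambda>n. f (1 / Suc n)) \<longlonglongrightarrow> poly q 0" by (simp add: q)
  qed
  with q have "\<forall>e\<ge>0. f e = poly q e" by (metis less_eq_real_def)
  then show ?thesis unfolding f_def by blast
qed

subsection \<open>The exponential integral over the cone of positive semidefinite matrices\<close>

text \<open>A Hermitian \<open>n \<times> n\<close> matrix is encoded by a real array \<open>c\<close>: the diagonal is \<open>c (i, i)\<close>, and for \<open>i < j\<close>
  the numbers \<open>c (i, j)\<close> and \<open>c (j, i)\<close> are \<open>sqrt 2\<close> times the real and imaginary parts of the \<open>(i, j)\<close>
  entry. The factor makes the coordinates orthonormal for the Hilbert-Schmidt inner product.\<close>
definition hentry :: "(nat \<times> nat \<Rightarrow> real) \<Rightarrow> nat \<Rightarrow> nat \<Rightarrow> complex" where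
  "hentry c i j = Complex (c (i, j)) (c (j, i)) / complex_of_real (sqrt 2)"

text \<open>With the column \<open>j\<close> as outer and \<open>i < j\<close> as inner summation
  index, passing from \<open>n\<close> to \<open>Suc n\<close> splits off exactly the last column.
  The conjugate lower triangle is accounted for by twice the real part.\<close>

definition hquad :: "nat \<Rightarrow> (nat \<times> nat \<Rightarrow> real) \<Rightarrow> (nat \<Rightarrow> complex) \<Rightarrow> real" where
  "hquad n c v = (\<Sum>i<n. c (i, i) * (cmod (v i))\<^sup>2)
     + 2 * Re (\<Sum>j<n. \<Sum>i<j. cnj (v i) * hentry c i j * v j)"

definition hpsd :: "nat \<Rightarrow> (nat \<times> nat \<Rightarrow> real) \<Rightarrow> bool" where
  "hpsd n c \<longleftrightarrow> (\<forall>v. 0 \<le> hquad n c v)"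

text \<open>The coordinates of \<open>z z\<^sup>* / a\<close>, where \<open>z\<close> is the last column without its last entry \<open>a = c (n, n)\<close>.\<close>
definition schur_shift :: "nat \<Rightarrow> (nat \<times> nat \<Rightarrow> real) \<Rightarrow> nat \<times> nat \<Rightarrow> real" where
  "schur_shift n c = (\<lambda>(i, j). (if i = j then ((c (i, n))\<^sup>2 + (c (n, i))\<^sup>2) / 2
      else if i < j then (c (i, n) * c (j, n) + c (n, i) * c (n, j)) / sqrt 2
      else (c (n, j) * c (i, n) - c (j, n) * c (n, i)) / sqrt 2) / c (n, n))"

lemma hquad_Suc:
  "hquad (Suc n) c v = hquad n c v + c (n, n) * (cmod (v n))\<^sup>2
     + 2 * Re ((\<Sum>i<n. cnj (v i) * hentry c i n) * v n)"
  by (simp add: hquad_def sum_distrib_right distrib_left del: Re_sum times_complex.sel)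

lemma hquad_cong:
  assumes "\<And>i. i < n \<Longrightarrow> v i = w i" "\<And>i j. i < n \<Longrightarrow> j < n \<Longrightarrow> c (i, j) = c' (i, j)"
  shows "hquad n c v = hquad n c' w"
  unfolding hquad_def hentry_def using assms
  by (intro arg_cong2[of _ _ _ _ "(+)"] arg_cong2[of _ _ _ _ "(*)"] arg_cong[of _ _ Re] sum.cong refl) auto

lemma hpsd_cong:
  assumes "\<And>i j. i < n \<Longrightarrow> j < n \<Longrightarrow> c (i, j) = c' (i, j)"
  shows "hpsd n c = hpsd n c'"
  unfolding hpsd_def using hquad_cong[of n _ _ c c'] assms by metis

lemma hquad_diff: "hquad n (\<lambda>p. c p - s p) v = hquad n c v - hquad n s v"
proof -
  have e: "hentry (\<lambda>p. c p - s p) i j = hentry c i j - hentry s i j" for i j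
    by (simp add: hentry_def diff_divide_distrib[symmetric] complex_eq_iff)
  show ?thesis unfolding hquad_def e
    by (simp add: algebra_simps sum_subtractf)
qed

lemma cmod_sum_squared:
  fixes w :: "nat \<Rightarrow> complex"
  shows "(cmod (\<Sum>i<n. w i))\<^sup>2 = (\<Sum>i<n. (cmod (w i))\<^sup>2) + 2 * Re (\<Sum>j<n. \<Sum>i<j. w i * cnj (w j))"
proof (induction n)
  case (Suc n)
  have "(cmod (a + b))\<^sup>2 = (cmod a)\<^sup>2 + (cmod b)\<^sup>2 + 2 * Re (a * cnj b)" for a b
    unfolding cmod_power2 by (simp add: power2_eq_square algebra_simps)
  then show ?case using Suc by (simp add: sum_distrib_right distrib_left del: Re_sum times_complex.sel)
qed simp

lemma hquad_schur_shift:
  "hquad n (schur_shift n c) v = (cmod (\<Sum>i<n. cnj (v i) * hentry c i n))\<^sup>2 / c (n, n)"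
proof -
  let ?w = "\<lambda>i. cnj (v i) * hentry c i n"
  have d: "schur_shift n c (i, i) * (cmod (v i))\<^sup>2 = (cmod (?w i))\<^sup>2 / c (n, n)" for i
    unfolding norm_mult power_mult_distrib
    by (simp add: schur_shift_def hentry_def norm_divide power_divide cmod_power2 Complex_eq)
  have o: "cnj (v i) * hentry (schur_shift n c) i j * v j = ?w i * cnj (?w j) / complex_of_real (c (n, n))"
    if "i < j" for i j
  proof -
    have "hentry (schur_shift n c) i j = hentry c i n * cnj (hentry c j n) / complex_of_real (c (n, n))"
      using that by (simp add: hentry_def schur_shift_def complex_eq_iff field_simps)
    then show ?thesis by simp
  qed
  have "(\<Sum>j<n. \<Sum>i<j. cnj (v i) * hentry (schur_shift n c) i j * v j)
    = (\<Sum>j<n. \<Sum>i<j. ?w i * cnj (?w j)) / complex_of_real (c (n, n))"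
    unfolding sum_divide_distrib by (intro sum.cong refl o) auto
  then show ?thesis
    unfolding hquad_def d cmod_sum_squared
    by (simp add: sum_divide_distrib[symmetric] add_divide_distrib del: Re_sum times_complex.sel)
qed

lemma hquad_Suc_complete_square:
  assumes a: "c (n, n) \<noteq> 0"
  shows "hquad (Suc n) c v = hquad n (\<lambda>p. c p - schur_shift n c p) v
     + (cmod ((\<Sum>i<n. cnj (v i) * hentry c i n) + of_real (c (n, n)) * cnj (v n)))\<^sup>2 / c (n, n)"
proof -
  define A where "A = (\<Sum>i<n. cnj (v i) * hentry c i n)"
  have "(cmod (A + of_real (c (n, n)) * cnj (v n)))\<^sup>2
      = (cmod A)\<^sup>2 + c (n, n) * (c (n, n) * (cmod (v n))\<^sup>2 + 2 * Re (A * v n))"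
    unfolding cmod_power2 by (simp add: power2_eq_square algebra_simps)
  then show ?thesis
    using a unfolding hquad_diff hquad_Suc hquad_schur_shift A_def[symmetric]
    by (simp add: field_simps del: times_complex.sel)
qed

text \<open>For given first \<open>n\<close> coordinates the last one can be chosen so that the
  completed square vanishes; the minimum over it is the form of the Schur complement.\<close>

lemma hpsd_Suc_pos:
  assumes a: "c (n, n) > 0"
  shows "hpsd (Suc n) c \<longleftrightarrow> hpsd n (\<lambda>p. c p - schur_shift n c p)"
proof
  assume L: "hpsd (Suc n) c"
  show "hpsd n (\<lambda>p. c p - schur_shift n c p)"
    unfolding hpsd_def
  proof
    fix v
    define A where "A = (\<Sum>i<n. cnj (v i) * hentry c i n)"
    define w where "w = v(n := - cnj A / of_real (c (n, n)))"
    have "A + of_real (c (n, n)) * cnj (w n) = 0" using a by (simp add: w_def)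
    moreover have "(\<Sum>i<n. cnj (w i) * hentry c i n) = A" by (simp add: A_def w_def)
    ultimately have "hquad (Suc n) c w = hquad n (\<lambda>p. c p - schur_shift n c p) w"
      using hquad_Suc_complete_square[of c n w] a by simp
    also have "\<dots> = hquad n (\<lambda>p. c p - schur_shift n c p) v"
      by (rule hquad_cong) (auto simp: w_def)
    finally show "0 \<le> hquad n (\<lambda>p. c p - schur_shift n c p) v"
      using L unfolding hpsd_def by metis
  qed
next
  assume "hpsd n (\<lambda>p. c p - schur_shift n c p)"
  then show "hpsd (Suc n) c"
    using a unfolding hpsd_def by (simp add: hquad_Suc_complete_square)
qed

lemma hpsd_Suc_diag_nonneg:
  assumes "hpsd (Suc n) c"
  shows "c (n, n) \<ge> 0"
proof -
  have "0 \<le> hquad (Suc n) c (\<lambda>i. if i = n then 1 else 0)" using assms by (simp add: hpsd_def)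
  moreover have "hquad n c (\<lambda>i. if i = n then 1 else 0) = hquad n c (\<lambda>i. 0)" by (rule hquad_cong) auto
  ultimately show ?thesis by (simp add: hquad_Suc) (simp add: hquad_def)
qed

text \<open>With a zero corner the form is real-affine in the last coordinate \<open>v n\<close>, so
  a nonzero cross term would drive it to minus infinity. Together with \<open>hpsd_Suc_pos\<close>
  this describes the cone recursively.\<close>

lemma hpsd_Suc_zero:
  assumes a: "c (n, n) = 0"
  shows "hpsd (Suc n) c \<longleftrightarrow> (\<forall>i<n. c (i, n) = 0 \<and> c (n, i) = 0) \<and> hpsd n c"
proof safe
  assume L: "hpsd (Suc n) c"
  show "hpsd n c"
    unfolding hpsd_def
  proof
    fix v
    have "0 \<le> hquad (Suc n) c (v(n := 0))" using L by (simp add: hpsd_def)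
    also have "\<dots> = hquad n c (v(n := 0))" by (simp add: hquad_Suc)
    also have "\<dots> = hquad n c v" by (rule hquad_cong) auto
    finally show "0 \<le> hquad n c v" .
  qed
  fix i assume i: "i < n"
  let ?z = "hentry c i n"
  let ?e = "\<lambda>k. if k = i then (1::complex) else 0"
  define h where "h = hquad n c ?e"
  have q: "h - 2 * r * (cmod ?z)\<^sup>2 \<ge> 0" for r :: real
  proof -
    let ?v = "?e(n := - of_real r * cnj ?z)"
    have "0 \<le> hquad (Suc n) c ?v" using L by (simp add: hpsd_def)
    also have "hquad n c ?v = h" unfolding h_def by (rule hquad_cong) auto
    then have "hquad (Suc n) c ?v = h + 2 * Re ((\<Sum>k<n. cnj (?v k) * hentry c k n) * (- of_real r * cnj ?z))"
      using a by (simp add: hquad_Suc)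
    also have "(\<Sum>k<n. cnj (?v k) * hentry c k n) = (\<Sum>k<n. if k = i then ?z else 0)"
      by (intro sum.cong) auto
    also have "\<dots> = ?z" using i by simp
    also have "h + 2 * Re (?z * (- of_real r * cnj ?z)) = h - 2 * r * (cmod ?z)\<^sup>2"
      unfolding cmod_power2 by (simp add: power2_eq_square algebra_simps)
    finally show ?thesis .
  qed
  have "?z = 0"
  proof (rule ccontr)
    assume "?z \<noteq> 0"
    \<comment> \<open>This \<open>r\<close> gives
      \<open>h - 2 * r * (cmod ?z)\<^sup>2 = -1\<close>.\<close>
    then show False using q[of "(h + 1) / (2 * (cmod ?z)\<^sup>2)"] by (simp add: field_simps)
  qed
  then show "c (i, n) = 0" "c (n, i) = 0" by (auto simp: hentry_def complex_eq_iff)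
next
  assume z: "\<forall>i<n. c (i, n) = 0 \<and> c (n, i) = 0" and "hpsd n c"
  have "(\<Sum>i<n. cnj (v i) * hentry c i n) = 0" for v
    using z by (intro sum.neutral) (auto simp: hentry_def complex_eq_iff)
  then show "hpsd (Suc n) c" using a \<open>hpsd n c\<close> by (simp add: hpsd_def hquad_Suc)
qed

definition hidx :: "nat \<Rightarrow> (nat \<times> nat) set" where "hidx n = {..<n} \<times> {..<n}"

abbreviation hmeas :: "nat \<Rightarrow> (nat \<times> nat \<Rightarrow> real) measure" where
  "hmeas n \<equiv> (\<Pi>\<^sub>M p\<in>hidx n. lborel)"

lemma schur_shift_measurable:
  assumes "p \<in> hidx n"
  shows "(\<lambda>c. schur_shift n c p) \<in> borel_measurable (hmeas (Suc n))"
proof -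
  obtain i j where p: "p = (i, j)" "i < n" "j < n" using assms by (auto simp: hidx_def)
  have m: "(\<lambda>c. c q) \<in> borel_measurable (hmeas (Suc n))" if "q \<in> hidx (Suc n)" for q
    using measurable_component_singleton[OF that, of "\<lambda>_. lborel :: real measure"] by simp
  note [measurable] = m[of "(i, n)"] m[of "(n, i)"] m[of "(j, n)"] m[of "(n, j)"] m[of "(n, n)"]
  have [simp]: "(i, n) \<in> hidx (Suc n)" "(n, i) \<in> hidx (Suc n)" "(j, n) \<in> hidx (Suc n)" "(n, j) \<in> hidx (Suc n)" "(n, n) \<in> hidx (Suc n)"
    using p by (auto simp: hidx_def)
  show ?thesis unfolding p schur_shift_def prod.case
    by (cases "i = j"; cases "i < j") simp_all
qed

text \<open>By definition \<open>hpsd\<close> quantifies over uncountably many vectors. The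
  recursion through the Schur complement and the degenerate corner replaces this by finitely many
  conditions at each step. Restricting to \<open>hidx n\<close> keeps the arrays inside the product
  space \<open>hmeas n\<close>.\<close>

lemma hpsd_measurable: "Measurable.pred (hmeas n) (hpsd n)"
proof (induction n)
  case 0
  then show ?case by (simp add: hpsd_def hquad_def)
next
  case (Suc n)
  have m: "(\<lambda>c. c q) \<in> borel_measurable (hmeas (Suc n))" if "q \<in> hidx (Suc n)" for q
    using measurable_component_singleton[OF that, of "\<lambda>_. lborel :: real measure"] by simp
  have sub: "p \<in> hidx (Suc n)" if "p \<in> hidx n" for p using that by (auto simp: hidx_def)
  have m1: "(\<lambda>c. \<lambda>p\<in>hidx n. c p - schur_shift n c p) \<in> hmeas (Suc n) \<rightarrow>\<^sub>M hmeas n"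
    by (rule measurable_restrict) (simp add: m sub schur_shift_measurable borel_measurable_diff)
  have m2: "(\<lambda>c. \<lambda>p\<in>hidx n. c p) \<in> hmeas (Suc n) \<rightarrow>\<^sub>M hmeas n"
    by (rule measurable_restrict) (simp add: m sub)
  have nn[measurable]: "(\<lambda>c. c (n, n)) \<in> borel_measurable (hmeas (Suc n))"
    by (rule m) (simp add: hidx_def)
  note p1 = measurable_compose[OF m1 Suc] and p2 = measurable_compose[OF m2 Suc]
  have p4: "Measurable.pred (hmeas (Suc n)) (\<lambda>c. c (n, n) > 0)"
    and p5: "Measurable.pred (hmeas (Suc n)) (\<lambda>c. c (n, n) = 0)" by measurable
  have p3: "Measurable.pred (hmeas (Suc n)) (\<lambda>c. \<forall>i<n. c (i, n) = 0 \<and> c (n, i) = 0)"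
  proof -
    have "Measurable.pred (hmeas (Suc n)) (\<lambda>c. c (i, n) = 0 \<and> c (n, i) = 0)" if "i < n" for i
    proof -
      have "(i, n) \<in> hidx (Suc n)" "(n, i) \<in> hidx (Suc n)" using that by (auto simp: hidx_def)
      note [measurable] = m[OF this(1)] m[OF this(2)]
      show ?thesis by measurable
    qed
    then have "Measurable.pred (hmeas (Suc n)) (\<lambda>c. \<forall>i\<in>{..<n}. c (i, n) = 0 \<and> c (n, i) = 0)"
      by (intro pred_intros_finite(3) finite_lessThan) (simp only: lessThan_iff)
    then show ?thesis unfolding Ball_def lessThan_iff .
  qed
  have eq: "hpsd (Suc n) c \<longleftrightarrow> (c (n, n) > 0 \<and> hpsd n (\<lambda>p\<in>hidx n. c p - schur_shift n c p)) \<or>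
     (c (n, n) = 0 \<and> (\<forall>i<n. c (i, n) = 0 \<and> c (n, i) = 0) \<and> hpsd n (\<lambda>p\<in>hidx n. c p))" for c
  proof -
    have "hpsd n (\<lambda>p\<in>hidx n. c p - schur_shift n c p) = hpsd n (\<lambda>p. c p - schur_shift n c p)"
      "hpsd n (\<lambda>p\<in>hidx n. c p) = hpsd n c"
      by (auto intro!: hpsd_cong simp: hidx_def)
    then show ?thesis
      using hpsd_Suc_pos[of c n] hpsd_Suc_zero[of c n] hpsd_Suc_diag_nonneg[of n c]
      by (metis less_eq_real_def less_irrefl)
  qed
  have "hpsd (Suc n) = (\<lambda>c. (c (n, n) > 0 \<and> hpsd n (\<lambda>p\<in>hidx n. c p - schur_shift n c p)) \<or>
     (c (n, n) = 0 \<and> (\<forall>i<n. c (i, n) = 0 \<and> c (n, i) = 0) \<and> hpsd n (\<lambda>p\<in>hidx n. c p)))"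
    by (rule ext) (rule eq)
  moreover have "Measurable.pred (hmeas (Suc n)) \<dots>"
    by (intro pred_intros_logic p1 p2 p3 p4 p5)
  ultimately show ?case by (simp only:)
qed

lemma nn_integral_gaussian:
  assumes a: "a > 0"
  shows "(\<integral>\<^sup>+ x. ennreal (exp (- x\<^sup>2 / (2 * a))) \<partial>lborel) = ennreal (sqrt (2 * pi * a))"
proof -
  have "(\<integral>\<^sup>+ x. ennreal (normal_density 0 (sqrt a) x) \<partial>lborel) = 1"
    using a nn_integral_eq_integral[of lborel "normal_density 0 (sqrt a)"] by simp
  moreover have "ennreal (exp (- x\<^sup>2 / (2 * a))) = ennreal (sqrt (2 * pi * a)) * ennreal (normal_density 0 (sqrt a) x)" for x
    using a by (simp add: normal_density_def ennreal_mult[symmetric] field_simps)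
  ultimately show ?thesis by (simp add: nn_integral_cmult)
qed

text \<open>Fix the corner \<open>a > 0\<close> and the last row and column \<open>y\<close>.
  Translating the remaining block by the Schur shift removes \<open>y\<close> from the positivity
  condition and puts the trace of the shift into the exponent, that is
  \<open>(y p)\<^sup>2 / (2 * a)\<close> summed over the \<open>2 * n\<close> entries of
  \<open>y\<close>. The Gaussian integrals give \<open>(2 * pi * a) ^ n\<close>, and the integral of
  \<open>a ^ n * exp (- a)\<close> gives \<open>fact n\<close>.\<close>

lemma nn_integral_exp_trace_hpsd:
  "(\<integral>\<^sup>+ c. indicator {c. hpsd n c} c * ennreal (exp (- (\<Sum>i<n. c (i, i)))) \<partial>hmeas n)
     = ennreal (\<Prod>k<n. (2 * pi) ^ k * fact k)"
proof (induction n)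
  case 0
  have "hidx 0 = {}" by (simp add: hidx_def)
  moreover have "hpsd 0 c" for c by (simp add: hpsd_def hquad_def)
  ultimately show ?case by (simp add: space_PiM nn_integral_count_space_finite PiM_empty)
next
  case (Suc n)
  interpret product_sigma_finite "\<lambda>_::nat \<times> nat. lborel :: real measure" ..
  define J where "J = (\<lambda>i. (i, n)) ` {..<n} \<union> Pair n ` {..<n}"
  have J: "finite J" "finite (hidx n)" "J \<inter> hidx n = {}" "(n, n) \<notin> J \<union> hidx n"
    by (auto simp: J_def hidx_def)
  have I: "hidx (Suc n) = insert (n, n) (J \<union> hidx n)"
    by (auto simp: J_def hidx_def less_Suc_eq)
  have m: "(\<lambda>c. c q) \<in> borel_measurable (hmeas k)" if "q \<in> hidx k" for q k
    using measurable_component_singleton[OF that, of "\<lambda>_. lborel :: real measure"] by simp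
  have tr[measurable]: "(\<lambda>c. \<Sum>i<k. c (i, i)) \<in> borel_measurable (hmeas k)" for k
    by (intro borel_measurable_sum m) (auto simp: hidx_def)
  have P[measurable]: "Measurable.pred (hmeas k) (hpsd k)" for k by (rule hpsd_measurable)
  define f where "f k c = indicator {c. hpsd k c} c * ennreal (exp (- (\<Sum>i<k. c (i, i))))" for k c
  have [measurable]: "f k \<in> borel_measurable (hmeas k)" for k
    unfolding f_def[abs_def] indicator_def by simp
  define G where "G = (\<integral>\<^sup>+ c. f n c \<partial>hmeas n)"
  \<comment> \<open>For negative \<open>a\<close> both sides vanish, because a positive semidefinite
    array has a nonnegative corner. The value \<open>a = 0\<close>, where the Schur complement would
    divide by zero, is a null set for the outer integral.\<close>
  have inner: "(\<integral>\<^sup>+ x. f (Suc n) ((merge J (hidx n) (y, x))((n, n) := a)) \<partial>hmeas n)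
      = (ennreal (exp (- a)) * indicator {0<..} a) * (\<Prod>p\<in>J. ennreal (exp (- (y p)\<^sup>2 / (2 * a)))) * G"
    if a: "a \<noteq> 0" and y: "y \<in> space (\<Pi>\<^sub>M p\<in>J. lborel :: real measure)" for a y
  proof (cases "a > 0")
    case False
    then have "f (Suc n) ((merge J (hidx n) (y, x))((n, n) := a)) = 0" for x
      using a hpsd_Suc_diag_nonneg[of n "(merge J (hidx n) (y, x))((n, n) := a)"] by (force simp: f_def indicator_def)
    with False show ?thesis by simp
  next
    case True
    \<comment> \<open>The shift depends only on the corner and the last row and column, so it is
      constant while the block \<open>x\<close> is integrated.\<close>
    define s where "s = schur_shift n (y((n, n) := a))"
    have mg: "merge J (hidx n) (y, x) (i, n) = y (i, n)" "merge J (hidx n) (y, x) (n, i) = y (n, i)"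
      "i < n \<Longrightarrow> j < n \<Longrightarrow> merge J (hidx n) (y, x) (i, j) = x (i, j)" if "i < n" for x i j
      using that by (auto simp: merge_def J_def hidx_def)
    have sh: "schur_shift n ((merge J (hidx n) (y, x))((n, n) := a)) (i, j) = s (i, j)" if "i < n" "j < n" for x i j
      using that by (simp add: s_def schur_shift_def mg)
    have psd: "hpsd (Suc n) ((merge J (hidx n) (y, x))((n, n) := a)) = hpsd n (\<lambda>p. x p - s p)" for x
      using True by (subst hpsd_Suc_pos) (auto intro!: hpsd_cong simp: sh mg)
    have "(\<Sum>i<n. s (i, i)) = (\<Sum>i<n. (y (i, n))\<^sup>2 / (2 * a)) + (\<Sum>i<n. (y (n, i))\<^sup>2 / (2 * a))"
      unfolding sum.distrib[symmetric] by (intro sum.cong) (auto simp: s_def schur_shift_def add_divide_distrib)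
    also have "\<dots> = (\<Sum>p\<in>J. (y p)\<^sup>2 / (2 * a))"
      unfolding J_def by (subst sum.union_disjoint) (auto simp: sum.reindex inj_on_def)
    finally have ss: "(\<Sum>i<n. s (i, i)) = (\<Sum>p\<in>J. (y p)\<^sup>2 / (2 * a))" .
    define h where "h x = indicator {x. hpsd n (\<lambda>p\<in>hidx n. x p - s p)} x * ennreal (exp (- (\<Sum>i<n. x (i, i))) * exp (- a))"
      for x :: "nat \<times> nat \<Rightarrow> real"
    have [measurable]: "(\<lambda>x. \<lambda>p\<in>hidx n. x p - s p) \<in> hmeas n \<rightarrow>\<^sub>M hmeas n"
      by (rule measurable_restrict) (simp add: m borel_measurable_diff)
    have [measurable]: "(\<lambda>x. \<lambda>p\<in>hidx n. x p + s p) \<in> hmeas n \<rightarrow>\<^sub>M hmeas n"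
      by (rule measurable_restrict) (simp add: m borel_measurable_add)
    have hm[measurable]: "h \<in> borel_measurable (hmeas n)"
      unfolding h_def[abs_def] indicator_def by simp
    have "(\<integral>\<^sup>+ x. f (Suc n) ((merge J (hidx n) (y, x))((n, n) := a)) \<partial>hmeas n) = (\<integral>\<^sup>+ x. h x \<partial>hmeas n)"
    proof (rule nn_integral_cong)
      fix x
      have "hpsd n (\<lambda>p\<in>hidx n. x p - s p) = hpsd n (\<lambda>p. x p - s p)"
        by (rule hpsd_cong) (auto simp: hidx_def)
      then show "f (Suc n) ((merge J (hidx n) (y, x))((n, n) := a)) = h x"
        by (simp add: f_def h_def psd mg indicator_def exp_add[symmetric] exp_diff)
    qed
    also have "\<dots> = (\<integral>\<^sup>+ x. h x \<partial>distr (hmeas n) (hmeas n) (\<lambda>x. \<lambda>p\<in>hidx n. x p + s p))"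
      by (simp add: PiM_lborel_translate J)
    also have "\<dots> = (\<integral>\<^sup>+ x. h (\<lambda>p\<in>hidx n. x p + s p) \<partial>hmeas n)"
      by (rule nn_integral_distr) measurable
    also have "\<dots> = (\<integral>\<^sup>+ x. (ennreal (exp (- a)) * (\<Prod>p\<in>J. ennreal (exp (- (y p)\<^sup>2 / (2 * a))))) * f n x \<partial>hmeas n)"
    proof (rule nn_integral_cong)
      fix x
      have e: "hpsd n (\<lambda>p\<in>hidx n. (\<lambda>p\<in>hidx n. x p + s p) p - s p) = hpsd n x"
        by (rule hpsd_cong) (auto simp: hidx_def)
      have "(\<Sum>i<n. (\<lambda>p\<in>hidx n. x p + s p) (i, i)) = (\<Sum>i<n. x (i, i)) + (\<Sum>p\<in>J. (y p)\<^sup>2 / (2 * a))"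
        unfolding ss[symmetric] sum.distrib[symmetric] by (intro sum.cong) (auto simp: hidx_def)
      then have e2: "exp (- (\<Sum>i<n. (\<lambda>p\<in>hidx n. x p + s p) (i, i))) = exp (- (\<Sum>i<n. x (i, i))) * (\<Prod>p\<in>J. exp (- (y p)\<^sup>2 / (2 * a)))"
        by (simp add: exp_sum[symmetric] J exp_add[symmetric] sum_negf)
      have "(\<Prod>p\<in>J. ennreal (exp (- (y p)\<^sup>2 / (2 * a)))) = ennreal (\<Prod>p\<in>J. exp (- (y p)\<^sup>2 / (2 * a)))"
        by (rule prod_ennreal) simp
      then show "h (\<lambda>p\<in>hidx n. x p + s p) = (ennreal (exp (- a)) * (\<Prod>p\<in>J. ennreal (exp (- (y p)\<^sup>2 / (2 * a))))) * f n x"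
        unfolding h_def f_def e2 indicator_def mem_Collect_eq e
        by (simp add: ennreal_mult[symmetric] prod_nonneg ac_simps)
    qed
    also have "\<dots> = (ennreal (exp (- a)) * (\<Prod>p\<in>J. ennreal (exp (- (y p)\<^sup>2 / (2 * a))))) * G"
      unfolding G_def by (rule nn_integral_cmult) measurable
    finally show ?thesis using True by simp
  qed
  have upd: "(\<lambda>x. f (Suc n) (x((n, n) := a))) \<in> borel_measurable (\<Pi>\<^sub>M p\<in>J \<union> hidx n. lborel)" for a
  proof -
    have "(\<lambda>x. x((n, n) := a)) \<in> (\<Pi>\<^sub>M p\<in>J \<union> hidx n. lborel :: real measure) \<rightarrow>\<^sub>M hmeas (Suc n)"
      unfolding I by (rule measurable_fun_upd[where J="J \<union> hidx n"]) auto
    then show ?thesis by measurable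
  qed
  have "(\<integral>\<^sup>+ c. f (Suc n) c \<partial>hmeas (Suc n))
      = (\<integral>\<^sup>+ a. (\<integral>\<^sup>+ x. f (Suc n) (x((n, n) := a)) \<partial>(\<Pi>\<^sub>M p\<in>J \<union> hidx n. lborel)) \<partial>lborel)"
    unfolding I by (rule product_nn_integral_insert_rev) (use J I in \<open>auto simp flip: I\<close>)
  also have "\<dots> = (\<integral>\<^sup>+ a. (\<integral>\<^sup>+ y. (\<integral>\<^sup>+ x. f (Suc n) ((merge J (hidx n) (y, x))((n, n) := a)) \<partial>hmeas n)
      \<partial>(\<Pi>\<^sub>M p\<in>J. lborel)) \<partial>lborel)"
    by (subst product_nn_integral_fold[OF J(3,1,2) upd]) simp
  also have "\<dots> = (\<integral>\<^sup>+ a. (ennreal ((2 * pi) ^ n) * G) * (ennreal (a ^ n * exp (- a)) * indicator {0..} a) \<partial>lborel)"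
  proof (rule nn_integral_cong_AE)
    have "(\<integral>\<^sup>+ y. (\<integral>\<^sup>+ x. f (Suc n) ((merge J (hidx n) (y, x))((n, n) := a)) \<partial>hmeas n) \<partial>(\<Pi>\<^sub>M p\<in>J. lborel))
        = (ennreal ((2 * pi) ^ n) * G) * (ennreal (a ^ n * exp (- a)) * indicator {0..} a)" if a: "a \<noteq> 0" for a
    proof (cases "a > 0")
      case True
      have pm: "(\<lambda>y. \<Prod>p\<in>J. ennreal (exp (- (y p)\<^sup>2 / (2 * a)))) \<in> borel_measurable (\<Pi>\<^sub>M p\<in>J. lborel)"
        by (intro borel_measurable_prod_ennreal) measurable
      have "(\<integral>\<^sup>+ y. (\<integral>\<^sup>+ x. f (Suc n) ((merge J (hidx n) (y, x))((n, n) := a)) \<partial>hmeas n) \<partial>(\<Pi>\<^sub>M p\<in>J. lborel))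
        = (\<integral>\<^sup>+ y. (ennreal (exp (- a)) * G) * (\<Prod>p\<in>J. ennreal (exp (- (y p)\<^sup>2 / (2 * a)))) \<partial>(\<Pi>\<^sub>M p\<in>J. lborel))"
        using True by (intro nn_integral_cong) (simp add: inner ac_simps)
      also have "\<dots> = (ennreal (exp (- a)) * G) * (\<integral>\<^sup>+ y. (\<Prod>p\<in>J. ennreal (exp (- (y p)\<^sup>2 / (2 * a)))) \<partial>(\<Pi>\<^sub>M p\<in>J. lborel))"
        by (rule nn_integral_cmult[OF pm])
      also have "(\<integral>\<^sup>+ y. (\<Prod>p\<in>J. ennreal (exp (- (y p)\<^sup>2 / (2 * a)))) \<partial>(\<Pi>\<^sub>M p\<in>J. lborel))
          = (\<Prod>p\<in>J. ennreal (sqrt (2 * pi * a)))"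
        using True by (subst product_nn_integral_prod) (auto simp: J nn_integral_gaussian[simplified])
      also have "\<dots> = ennreal (sqrt (2 * pi * a)) ^ (2 * n)"
      proof -
        have "card J = 2 * n" unfolding J_def
          by (subst card_Un_disjoint) (auto simp: card_image inj_on_def)
        then show ?thesis by simp
      qed
      also have "\<dots> = ennreal ((2 * pi) ^ n) * ennreal (a ^ n)"
        using True by (simp add: ennreal_power power_mult ennreal_mult[symmetric] power_mult_distrib)
      also have "ennreal (exp (- a)) * G * (ennreal ((2 * pi) ^ n) * ennreal (a ^ n))
          = (ennreal ((2 * pi) ^ n) * G) * (ennreal (a ^ n * exp (- a)) * indicator {0..} a)"
        using True by (simp add: ennreal_mult ac_simps)
      finally show ?thesis .
    next
      case False
      then have "(\<integral>\<^sup>+ y. (\<integral>\<^sup>+ x. f (Suc n) ((merge J (hidx n) (y, x))((n, n) := a)) \<partial>hmeas n) \<partial>(\<Pi>\<^sub>M p\<in>J. lborel))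
        = (\<integral>\<^sup>+ y. 0 \<partial>(\<Pi>\<^sub>M p\<in>J. lborel :: real measure))"
        using a by (intro nn_integral_cong) (simp add: inner)
      then show ?thesis using False a by simp
    qed
    then show "AE a in lborel. (\<integral>\<^sup>+ y. (\<integral>\<^sup>+ x. f (Suc n) ((merge J (hidx n) (y, x))((n, n) := a)) \<partial>hmeas n) \<partial>(\<Pi>\<^sub>M p\<in>J. lborel))
        = (ennreal ((2 * pi) ^ n) * G) * (ennreal (a ^ n * exp (- a)) * indicator {0..} a)"
      using AE_lborel_singleton[of 0] by auto
  qed
  also have "\<dots> = (ennreal ((2 * pi) ^ n) * G) * ennreal (fact n)"
    by (subst nn_integral_cmult) (auto simp: nn_intergal_power_times_exp_Ici)
  also have "G = ennreal (\<Prod>k<n. (2 * pi) ^ k * fact k)" using Suc by (simp add: G_def f_def)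
  finally show ?case
    by (simp add: f_def ennreal_mult[symmetric] prod_nonneg ac_simps)
qed

subsection \<open>Hermitian matrices in orthonormal coordinates\<close>

text \<open>On Hermitian matrices the sum is already real (\<open>hermitian_quad_Im\<close>); the
  real part makes \<open>mquad\<close> a real linear functional of the matrix.\<close>

definition mquad :: "complex^'n^'n \<Rightarrow> complex^'n \<Rightarrow> real" where
  "mquad X v = Re (\<Sum>i\<in>UNIV. \<Sum>j\<in>UNIV. cnj (v $ i) * X $ i $ j * v $ j)"

lemma mquad_add: "mquad (X + Y) v = mquad X v + mquad Y v"
  by (simp add: mquad_def algebra_simps sum.distrib)

lemma mquad_scaleR: "mquad (r *\<^sub>R X) v = r * mquad X v"
  by (simp add: mquad_def algebra_simps sum_distrib_left sum_subtractf sum.distrib)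

lemma linear_mquad: "linear (\<lambda>X. mquad X v)"
  by (intro linearI) (auto simp: mquad_add mquad_scaleR)

lemma mquad_diff: "mquad (X - Y) v = mquad X v - mquad Y v"
  using linear_diff[OF linear_mquad] .

lemma mquad_mat_1:
  fixes v :: "complex^'n"
  shows "mquad (mat 1) v = (norm v)\<^sup>2"
proof -
  have "cnj (v $ i) * (mat 1 :: complex^'n^'n) $ i $ j * v $ j = (if i = j then complex_of_real ((cmod (v $ i))\<^sup>2) else 0)" for i j
    by (simp add: mat_def complex_norm_square mult.commute del: of_real_power)
  then have "mquad (mat 1) v = (\<Sum>i\<in>UNIV. (cmod (v $ i))\<^sup>2)"
    by (simp add: mquad_def)
  then show ?thesis by (simp add: norm_vec_def L2_set_def sum_nonneg)
qed

lemma mquad_scale_vec: "mquad X (a *s v) = (cmod a)\<^sup>2 * mquad X v"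
proof -
  have e: "cnj ((a *s v) $ i) * X $ i $ j * (a *s v) $ j = complex_of_real ((cmod a)\<^sup>2) * (cnj (v $ i) * X $ i $ j * v $ j)" for i j
    unfolding complex_norm_square by (simp add: mult.assoc mult.left_commute)
  show ?thesis
    unfolding mquad_def e sum_distrib_left[symmetric] by (simp del: Re_sum)
qed

lemma hermitian_iff_cnj: "hermitian X \<longleftrightarrow> (\<forall>i j. cnj (X $ i $ j) = X $ j $ i)"
  unfolding hermitian_def by metis

lemma hermitian_quad_Im:
  assumes "hermitian X"
  shows "Im (\<Sum>i\<in>UNIV. \<Sum>j\<in>UNIV. cnj (v $ i) * X $ i $ j * v $ j) = 0" (is "Im ?q = 0")
proof -
  have X: "cnj (X $ i $ j) = X $ j $ i" for i j using assms by (simp add: hermitian_iff_cnj)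
  have "cnj ?q = (\<Sum>i\<in>UNIV. \<Sum>j\<in>UNIV. cnj (v $ j) * X $ j $ i * v $ i)"
    by (simp add: X ac_simps)
  also have "\<dots> = ?q" by (rule sum.swap)
  finally have "?q \<in> \<real>" by (simp add: Reals_cnj_iff)
  then show ?thesis by (simp add: complex_is_Real_iff del: Im_sum)
qed

lemma psd_iff_mquad:
  assumes "hermitian X"
  shows "psd X \<longleftrightarrow> (\<forall>v. 0 \<le> mquad X v)"
  unfolding psd_def mquad_def Let_def using hermitian_quad_Im[OF assms] by blast

lemma hermitian_add: "hermitian X \<Longrightarrow> hermitian Y \<Longrightarrow> hermitian (X + Y)"
  by (simp add: hermitian_iff_cnj)

lemma hermitian_scaleR: "hermitian X \<Longrightarrow> hermitian (r *\<^sub>R X)"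
  by (simp add: hermitian_iff_cnj)

lemma hermitian_diff: "hermitian X \<Longrightarrow> hermitian Y \<Longrightarrow> hermitian (X - Y)"
  by (simp add: hermitian_iff_cnj)

lemma hermitian_sum: "(\<And>i. i \<in> I \<Longrightarrow> hermitian (f i)) \<Longrightarrow> hermitian (\<Sum>i\<in>I. f i)"
proof (induction I rule: infinite_finite_induct)
  case (insert x F)
  then show ?case by (simp add: hermitian_add)
qed (auto simp: hermitian_def)

lemma hermitian_mat_1: "hermitian (mat 1)"
  by (simp add: hermitian_def mat_def)

lemma linear_mtrace: "linear mtrace"
  by (intro linearI) (auto simp: mtrace_def sum.distrib scaleR_sum_right)

lemma inner_mat_1: "inner X (mat 1) = Re (mtrace X)"
proof -
  have "inner X (mat 1) = (\<Sum>i\<in>UNIV. \<Sum>j\<in>UNIV. if i = j then Re (X $ i $ j) else 0)"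
    unfolding inner_vec_def by (intro sum.cong refl) (auto simp: mat_def inner_complex_def)
  then show ?thesis by (simp add: mtrace_def)
qed

lemma mtrace_mat_1: "mtrace (mat 1 :: complex^'n^'n) = of_nat CARD('n)"
  by (simp add: mtrace_def mat_def)

lemma hermitian_mtrace_real: "hermitian X \<Longrightarrow> mtrace X = of_real (Re (mtrace X))"
proof -
  assume "hermitian X"
  then have "cnj (X $ i $ i) = X $ i $ i" for i by (simp add: hermitian_iff_cnj)
  then have "Im (X $ i $ i) = 0" for i by (simp add: Reals_cnj_iff[symmetric] complex_is_Real_iff)
  then show ?thesis by (simp add: mtrace_def complex_eq_iff)
qed

locale hermitian_coordinates =
  fixes B :: "'m::finite \<Rightarrow> complex^'n::finite^'n"
  assumes card_m: "CARD('m) = CARD('n)\<^sup>2 - 1" and onb: "traceless_herm_onb B"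
begin

text \<open>The identity has Hilbert-Schmidt norm \<open>sqrt d\<close>, so
  \<open>I / sqrt d\<close> completes the \<open>B i\<close> to an orthonormal basis of all
  Hermitian matrices. Hence \<open>emb\<close> is an isometry onto them, and the last coordinate is
  the trace divided by \<open>sqrt d\<close>.\<close>

definition emb :: "(real^'m) \<times> real \<Rightarrow> complex^'n^'n" where
  "emb z = (\<Sum>i\<in>UNIV. (fst z $ i) *\<^sub>R B i) + (snd z / sqrt (real CARD('n))) *\<^sub>R mat 1"

lemma B_herm: "hermitian (B i)" and B_trace: "mtrace (B i) = 0"
  and B_inner: "inner (B i) (B j) = (if i = j then 1 else 0)"
  and B_span: "hermitian H \<Longrightarrow> mtrace H = 0 \<Longrightarrow> H \<in> span (range B)"
  using onb by (auto simp: traceless_herm_onb_def)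

lemma linear_emb: "linear emb"
  by (intro linearI)
    (auto simp: emb_def scaleR_add_left sum.distrib scaleR_sum_right add_divide_distrib scaleR_add_right)

lemma hermitian_emb: "hermitian (emb z)"
  unfolding emb_def by (intro hermitian_add hermitian_sum hermitian_scaleR B_herm hermitian_mat_1)

lemma mtrace_emb: "mtrace (emb z) = of_real (sqrt (real CARD('n)) * snd z)"
proof -
  have "mtrace (emb z) = (\<Sum>i\<in>UNIV. (fst z $ i) *\<^sub>R mtrace (B i)) + (snd z / sqrt (real CARD('n))) *\<^sub>R mtrace (mat 1 :: complex^'n^'n)"
    unfolding emb_def linear_add[OF linear_mtrace] linear_sum[OF linear_mtrace] linear_scale[OF linear_mtrace] ..
  also have "\<dots> = of_real (snd z / sqrt (real CARD('n)) * real CARD('n))" by (simp add: B_trace mtrace_mat_1 scaleR_conv_of_real[where 'a=complex])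
  also have "snd z / sqrt (real CARD('n)) * real CARD('n) = sqrt (real CARD('n)) * snd z"
    by (simp add: field_simps real_sqrt_mult_self flip: mult.assoc)
  finally show ?thesis .
qed

lemma inner_emb: "inner (emb z) (emb z') = inner z z'"
proof -
  have 1: "inner (B i) (mat 1) = 0" "inner (mat 1) (B i) = 0" for i
    using inner_mat_1[of "B i"] B_trace by (auto simp: inner_commute)
  have 2: "inner (mat 1 :: complex^'n^'n) (mat 1) = real CARD('n)" by (simp add: inner_mat_1 mtrace_mat_1)
  have "inner (emb z) (emb z') = (\<Sum>i\<in>UNIV. \<Sum>j\<in>UNIV. (fst z' $ i) * (fst z $ j) * inner (B j) (B i))
      + (snd z / sqrt (real CARD('n))) * (snd z' / sqrt (real CARD('n))) * real CARD('n)"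
    by (simp add: emb_def inner_add_left inner_add_right inner_sum_left inner_sum_right 1 2 sum_distrib_left mult.assoc)
  also have "(snd z / sqrt (real CARD('n))) * (snd z' / sqrt (real CARD('n))) * real CARD('n) = snd z * snd z'"
    by (simp add: field_simps)
  also have "(\<Sum>i\<in>UNIV. \<Sum>j\<in>UNIV. (fst z' $ i) * (fst z $ j) * inner (B j) (B i)) = inner (fst z) (fst z')"
    by (simp add: B_inner inner_vec_def[where 'a=real] if_distrib mult.commute cong: if_cong)
  finally show ?thesis by (simp add: inner_prod_def)
qed

lemma norm_emb: "norm (emb z) = norm z"
  by (simp add: norm_eq_sqrt_inner inner_emb)

text \<open>The traceless part of \<open>X\<close> lies in the span of the \<open>B i\<close>, so it
  equals its orthonormal expansion; the remaining multiple of the identity is the last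
  coordinate.\<close>

lemma hermitian_imp_emb:
  assumes "hermitian X"
  shows "emb ((\<chi> i. inner X (B i)), Re (mtrace X) / sqrt (real CARD('n))) = X"
proof -
  define H where "H = X - (Re (mtrace X) / real CARD('n)) *\<^sub>R mat 1"
  have "hermitian H" unfolding H_def by (intro hermitian_diff hermitian_scaleR hermitian_mat_1 assms)
  moreover have "mtrace H = 0"
    using hermitian_mtrace_real[OF assms]
    by (simp add: H_def linear_diff[OF linear_mtrace] linear_scale[OF linear_mtrace] mtrace_mat_1 scaleR_conv_of_real[where 'a=complex])
  ultimately have "H \<in> span (range B)" by (rule B_span)
  then have "(\<Sum>i\<in>UNIV. inner H (B i) *\<^sub>R B i) = H"
  proof (induction rule: span_induct_alt)
    case (step c x y)
    then obtain k where k: "x = B k" by auto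
    have "(\<Sum>i\<in>UNIV. inner (c *\<^sub>R x + y) (B i) *\<^sub>R B i)
      = c *\<^sub>R (\<Sum>i\<in>UNIV. inner (B k) (B i) *\<^sub>R B i) + (\<Sum>i\<in>UNIV. inner y (B i) *\<^sub>R B i)"
      by (simp add: inner_add_left scaleR_add_left sum.distrib scaleR_sum_right k)
    also have "(\<Sum>i\<in>UNIV. inner (B k) (B i) *\<^sub>R B i) = (\<Sum>i\<in>UNIV. if k = i then B i else 0)"
      by (intro sum.cong) (auto simp: B_inner)
    finally show ?case using step by (simp add: k)
  qed simp
  moreover have "inner H (B i) = inner X (B i)" for i
    using inner_mat_1[of "B i"] B_trace by (simp add: H_def inner_diff_left inner_commute[of "mat 1"])
  ultimately have "(\<Sum>i\<in>UNIV. inner X (B i) *\<^sub>R B i) = H" by simp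
  moreover have "Re (mtrace X) / sqrt (real CARD('n)) / sqrt (real CARD('n)) = Re (mtrace X) / real CARD('n)" by simp
  ultimately show ?thesis by (simp add: emb_def H_def del: divide_divide_eq_left)
qed

end

section \<open>Coordinate arrays as matrices\<close>

lemma sum_square_split_triangle:
  fixes f :: "nat \<Rightarrow> nat \<Rightarrow> 'a::comm_monoid_add"
  shows "(\<Sum>i<n. \<Sum>j<n. f i j) = (\<Sum>i<n. f i i) + (\<Sum>j<n. \<Sum>i<j. f i j + f j i)"
  by (induction n) (auto simp: sum.distrib ac_simps)

text \<open>The index type carries no order; the numbering \<open>g\<close> is what gives meaning to
  the upper and the lower triangle.\<close>

definition hmat :: "('n \<Rightarrow> nat) \<Rightarrow> (nat \<times> nat \<Rightarrow> real) \<Rightarrow> complex^'n^'n" where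
  "hmat g c = (\<chi> a b. if g a = g b then of_real (c (g a, g a))
     else if g a < g b then hentry c (g a) (g b) else cnj (hentry c (g b) (g a)))"

context
  fixes g :: "'n::finite \<Rightarrow> nat"
  assumes g: "bij_betw g UNIV {..<CARD('n)}"
begin

lemma hermitian_hmat: "hermitian (hmat g c)"
  by (auto simp: hermitian_def hmat_def)

lemma linear_hmat_sum:
  assumes "finite P"
  shows "hmat g (\<lambda>p. \<Sum>q\<in>P. f q * c q p) = (\<Sum>q\<in>P. f q *\<^sub>R hmat g (c q))"
proof -
  have e: "hentry (\<lambda>p. \<Sum>q\<in>P. f q * c q p) i j = (\<Sum>q\<in>P. f q *\<^sub>R hentry (c q) i j)" for i j
    by (simp add: hentry_def complex_eq_iff sum_divide_distrib)
  show ?thesis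
    unfolding vec_eq_iff by (auto simp: hmat_def e scaleR_conv_of_real[where 'a=complex])
qed

lemma sum_reindex_UNIV: "(\<Sum>a\<in>UNIV. f (g a)) = (\<Sum>i<CARD('n). f i)"
  by (rule sum.reindex_bij_betw[OF g])

lemma mtrace_hmat: "Re (mtrace (hmat g c)) = (\<Sum>i<CARD('n). c (i, i))"
  using sum_reindex_UNIV[of "\<lambda>i. c (i, i)"] by (simp add: mtrace_def hmat_def)

lemma inner_hmat: "inner (hmat g c) (hmat g c') = (\<Sum>p\<in>hidx CARD('n). c p * c' p)"
proof -
  have e: "inner (hmat g c $ a $ b) (hmat g c' $ a $ b)
      = (c (g a, g b) * c' (g a, g b) + c (g b, g a) * c' (g b, g a)) / 2" for a b
    by (auto simp: hmat_def hentry_def inner_complex_def Complex_eq field_simps)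
  have "inner (hmat g c) (hmat g c') = (\<Sum>a\<in>UNIV. \<Sum>b\<in>UNIV. (c (g a, g b) * c' (g a, g b) + c (g b, g a) * c' (g b, g a)) / 2)"
    by (simp only: inner_vec_def e)
  also have "\<dots> = (\<Sum>i<CARD('n). \<Sum>j<CARD('n). (c (i, j) * c' (i, j) + c (j, i) * c' (j, i)) / 2)"
    by (simp add: sum_reindex_UNIV sum_reindex_UNIV[of "\<lambda>j. (c (i, j) * c' (i, j) + c (j, i) * c' (j, i)) / 2" for i]
       sum_reindex_UNIV[of "\<lambda>i. \<Sum>j<CARD('n). (c (i, j) * c' (i, j) + c (j, i) * c' (j, i)) / 2"])
  also have "\<dots> = ((\<Sum>i<CARD('n). \<Sum>j<CARD('n). c (i, j) * c' (i, j)) + (\<Sum>i<CARD('n). \<Sum>j<CARD('n). c (j, i) * c' (j, i))) / 2"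
    by (simp add: sum.distrib sum_divide_distrib add_divide_distrib)
  also have "(\<Sum>i<CARD('n). \<Sum>j<CARD('n). c (j, i) * c' (j, i)) = (\<Sum>i<CARD('n). \<Sum>j<CARD('n). c (i, j) * c' (i, j))"
    by (rule sum.swap)
  finally show ?thesis by (simp add: hidx_def sum.cartesian_product)
qed

lemma hmat_cong:
  assumes "\<And>p. p \<in> hidx CARD('n) \<Longrightarrow> c p = c' p"
  shows "hmat g c = hmat g c'"
proof -
  have "g a < CARD('n)" for a using g by (auto simp: bij_betw_def)
  then have "c (g a, g b) = c' (g a, g b)" for a b using assms by (simp add: hidx_def)
  then show ?thesis by (simp add: hmat_def hentry_def cong: if_cong)
qed

lemma mquad_hmat: "mquad (hmat g c) v = hquad CARD('n) c (\<lambda>i. v $ (inv_into UNIV g i))"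
proof -
  have inv: "inv_into UNIV g (g a) = a" for a
    using g by (simp add: bij_betw_def)
  define w where "w i = v $ (inv_into UNIV g i)" for i
  have vw: "v $ a = w (g a)" for a by (simp add: w_def inv)
  define M where "M i j = (if i = j then complex_of_real (c (i, i)) else if i < j then hentry c i j else cnj (hentry c j i))" for i j
  define F where "F i j = cnj (w i) * M i j * w j" for i j
  have "mquad (hmat g c) v = Re (\<Sum>a\<in>UNIV. \<Sum>b\<in>UNIV. F (g a) (g b))"
    by (simp add: mquad_def vw F_def M_def hmat_def del: Re_sum times_complex.sel)
  also have "(\<Sum>a\<in>UNIV. \<Sum>b\<in>UNIV. F (g a) (g b)) = (\<Sum>i<CARD('n). \<Sum>j<CARD('n). F i j)"
    by (simp add: sum_reindex_UNIV sum_reindex_UNIV[of "F i" for i] sum_reindex_UNIV[of "\<lambda>i. \<Sum>j<CARD('n). F i j"])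
  also have "\<dots> = (\<Sum>i<CARD('n). F i i) + (\<Sum>j<CARD('n). \<Sum>i<j. F i j + F j i)"
    by (rule sum_square_split_triangle)
  also have "(\<Sum>i<CARD('n). F i i) = of_real (\<Sum>i<CARD('n). c (i, i) * (cmod (w i))\<^sup>2)"
    unfolding F_def M_def of_real_sum of_real_mult complex_norm_square by (intro sum.cong) (auto simp: ac_simps)
  also have "Re (of_real (\<Sum>i<CARD('n). c (i, i) * (cmod (w i))\<^sup>2) + (\<Sum>j<CARD('n). \<Sum>i<j. F i j + F j i))
     = (\<Sum>i<CARD('n). c (i, i) * (cmod (w i))\<^sup>2) + (\<Sum>j<CARD('n). \<Sum>i<j. Re (F i j + F j i))"
    by (simp del: plus_complex.sel(1)) simp
  also have "(\<Sum>j<CARD('n). \<Sum>i<j. Re (F i j + F j i)) = (\<Sum>j<CARD('n). \<Sum>i<j. 2 * Re (cnj (w i) * hentry c i j * w j))"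
  proof (intro sum.cong refl)
    fix i j assume "j \<in> {..<CARD('n)}" "i \<in> {..<j}"
    then have "F i j = cnj (w i) * hentry c i j * w j" "F j i = cnj (cnj (w i) * hentry c i j * w j)"
      by (auto simp: F_def M_def)
    then show "Re (F i j + F j i) = 2 * Re (cnj (w i) * hentry c i j * w j)"
      by (simp only: plus_complex.sel cnj.sel mult_2)
  qed
  also have "\<dots> = 2 * Re (\<Sum>j<CARD('n). \<Sum>i<j. cnj (w i) * hentry c i j * w j)"
    by (simp only: Re_sum sum_distrib_left)
  finally show ?thesis unfolding hquad_def w_def .
qed

lemma psd_hmat: "(\<forall>v. 0 \<le> mquad (hmat g c) v) \<longleftrightarrow> hpsd CARD('n) c"
proof -
  have "\<exists>v :: complex^'n. hquad CARD('n) c w = mquad (hmat g c) v" for w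
    unfolding mquad_hmat
    by (rule exI[of _ "\<chi> a. w (g a)"], rule hquad_cong)
      (use g in \<open>auto simp: bij_betw_def f_inv_into_f\<close>)
  then show ?thesis unfolding hpsd_def by (metis mquad_hmat)
qed

end

subsection \<open>The volume of the set of density matrices\<close>

lemma emeasure_lborel_scale:
  fixes A :: "'a::euclidean_space set"
  assumes A[measurable]: "A \<in> sets borel" and r: "r > 0"
  shows "emeasure lborel {x. (1 / r) *\<^sub>R x \<in> A} = ennreal (r ^ DIM('a)) * emeasure lborel A"
proof -
  let ?D = "distr lborel borel (\<lambda>x::'a. 0 + (1 / r) *\<^sub>R x)"
  have "emeasure lborel A = emeasure (density ?D (\<lambda>_. ennreal (\<bar>1 / r\<bar> ^ DIM('a)))) A"
    using r by (subst lborel_affine[of "1 / r" 0]) auto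
  also have "\<dots> = ennreal (\<bar>1 / r\<bar> ^ DIM('a)) * emeasure ?D A"
    by (subst emeasure_density) (auto simp: nn_integral_cmult)
  also have "emeasure ?D A = emeasure lborel {x. (1 / r) *\<^sub>R x \<in> A}"
    by (subst emeasure_distr) (auto simp: vimage_def)
  finally have "ennreal (r ^ DIM('a)) * emeasure lborel A
      = (ennreal (r ^ DIM('a)) * ennreal (\<bar>1 / r\<bar> ^ DIM('a))) * emeasure lborel {x. (1 / r) *\<^sub>R x \<in> A}"
    by (simp add: mult.assoc)
  also have "ennreal (r ^ DIM('a)) * ennreal (\<bar>1 / r\<bar> ^ DIM('a)) = 1"
    using r by (simp add: ennreal_mult[symmetric] power_mult_distrib[symmetric])
  finally show ?thesis by simp
qed

context hermitian_coordinates
begin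

definition pos_cone :: "((real^'m) \<times> real) set" where
  "pos_cone = {z. \<forall>v. 0 \<le> mquad (emb z) v}"

text \<open>Trace one is height \<open>1 / sqrt d\<close> along the unit vector
  \<open>I / sqrt d\<close>, so these are the coordinates of the density matrices.\<close>

definition body :: "(real^'m) set" where
  "body = {x. (x, 1 / sqrt (real CARD('n))) \<in> pos_cone}"

lemma linear_mquad_emb: "linear (\<lambda>z. mquad (emb z) v)"
  using linear_compose[OF linear_emb linear_mquad] by (simp add: o_def)

lemma closed_pos_cone: "closed pos_cone"
  unfolding pos_cone_def
  by (intro closed_Collect_all closed_Collect_le continuous_on_const linear_continuous_on
      linear_conv_bounded_linear[THEN iffD1] linear_mquad_emb)

lemma closed_body: "closed body"
proof -
  have "body = (\<lambda>x. (x, 1 / sqrt (real CARD('n)))) -` pos_cone" by (auto simp: body_def)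
  then show ?thesis
    using continuous_closed_vimage[OF closed_pos_cone, of "\<lambda>x. (x, 1 / sqrt (real CARD('n)))"]
    by (simp add: continuous_Pair)
qed

lemma borel_measurable_snd_lborel: "(snd :: (real^'m) \<times> real \<Rightarrow> real) \<in> borel_measurable borel"
  by (intro borel_measurable_continuous_onI continuous_intros)

lemma pos_cone_scale: "r > 0 \<Longrightarrow> r *\<^sub>R z \<in> pos_cone \<longleftrightarrow> z \<in> pos_cone"
  by (simp add: pos_cone_def linear_scale[OF linear_mquad_emb] zero_le_mult_iff)

text \<open>The matrices with a single array coordinate equal to 1 are orthonormal, and there are
  \<open>d\<^sup>2\<close> of them, as many as the dimension of
  \<open>real^'m \<times> real\<close>. Their coordinates \<open>b p\<close> under
  \<open>emb\<close> therefore form an orthonormal basis, and \<open>\<psi>\<close> turns the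
  product measure on arrays into Lebesgue measure.\<close>

lemma nn_integral_exp_trace_pos_cone:
  "(\<integral>\<^sup>+ z. indicator pos_cone z * ennreal (exp (- (sqrt (real CARD('n)) * snd z))) \<partial>lborel)
     = ennreal (\<Prod>k<CARD('n). (2 * pi) ^ k * fact k)"
proof -
  obtain g :: "'n \<Rightarrow> nat" where g: "bij_betw g UNIV {..<CARD('n)}"
    using ex_bij_betw_finite_nat[of "UNIV :: 'n set"] by (auto simp: atLeast0LessThan)
  let ?I = "hidx CARD('n)"
  define \<delta> where "\<delta> p q = (if q = p then 1 else 0 :: real)" for p q :: "nat \<times> nat"
  define b where "b p = ((\<chi> i. inner (hmat g (\<delta> p)) (B i)), Re (mtrace (hmat g (\<delta> p))) / sqrt (real CARD('n)))" for p
  have eb: "emb (b p) = hmat g (\<delta> p)" for p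
    unfolding b_def by (rule hermitian_imp_emb[OF hermitian_hmat[OF g]])
  have fin: "finite ?I" by (simp add: hidx_def)
  have orth: "inner (b p) (b q) = (if p = q then 1 else 0)" if "p \<in> ?I" "q \<in> ?I" for p q
  proof -
    have "inner (b p) (b q) = (\<Sum>r\<in>?I. \<delta> p r * \<delta> q r)"
      unfolding inner_emb[symmetric] eb inner_hmat[OF g] ..
    also have "\<dots> = (\<Sum>r\<in>?I. if r = p then \<delta> q r else 0)" by (intro sum.cong) (auto simp: \<delta>_def)
    finally show ?thesis using that fin by (simp add: \<delta>_def)
  qed
  have card: "card ?I = DIM((real^'m) \<times> real)"
    using card_m by (simp add: hidx_def power2_eq_square)
  define \<psi> where "\<psi> f = (\<Sum>p\<in>?I. f p *\<^sub>R b p)" for f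
  have e\<psi>: "emb (\<psi> f) = hmat g f" for f
  proof -
    have "emb (\<psi> f) = (\<Sum>p\<in>?I. f p *\<^sub>R hmat g (\<delta> p))"
      by (simp add: \<psi>_def linear_sum[OF linear_emb] linear_scale[OF linear_emb] eb)
    also have "\<dots> = hmat g (\<lambda>r. \<Sum>q\<in>?I. f q * \<delta> q r)"
      by (rule linear_hmat_sum[OF g fin, symmetric])
    also have "\<dots> = hmat g f"
      by (rule hmat_cong[OF g]) (simp add: \<delta>_def fin if_distrib cong: if_cong)
    finally show ?thesis .
  qed
  have mem: "\<psi> f \<in> pos_cone \<longleftrightarrow> hpsd CARD('n) f" for f
    unfolding pos_cone_def mem_Collect_eq e\<psi> by (rule psd_hmat[OF g])
  have tr: "sqrt (real CARD('n)) * snd (\<psi> f) = (\<Sum>i<CARD('n). f (i, i))" for f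
    using mtrace_emb[of "\<psi> f"] mtrace_hmat[OF g, of f] unfolding e\<psi> by simp
  have [measurable]: "pos_cone \<in> sets borel" using closed_pos_cone by (rule borel_closed)
  have [measurable]: "\<psi> \<in> borel_measurable (hmeas CARD('n))"
    unfolding \<psi>_def[abs_def]
    by (intro borel_measurable_sum borel_measurable_scaleR borel_measurable_const)
      (use measurable_component_singleton[of _ ?I "\<lambda>_. lborel :: real measure"] in simp)
  have lb: "lborel = distr (hmeas CARD('n)) borel \<psi>"
    unfolding \<psi>_def[abs_def] by (rule lborel_eq_distr_orthonormal[symmetric, OF fin card orth])
  have "(\<integral>\<^sup>+ z. indicator pos_cone z * ennreal (exp (- (sqrt (real CARD('n)) * snd z))) \<partial>lborel)
    = (\<integral>\<^sup>+ f. indicator pos_cone (\<psi> f) * ennreal (exp (- (sqrt (real CARD('n)) * snd (\<psi> f)))) \<partial>hmeas CARD('n))"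
    unfolding lb
  proof (rule nn_integral_distr)
    show "(\<lambda>z. indicator pos_cone z * ennreal (exp (- (sqrt (real CARD('n)) * snd z)))) \<in> borel_measurable (distr (hmeas CARD('n)) borel \<psi>)"
      using borel_measurable_snd_lborel by simp
  qed measurable
  also have "\<dots> = (\<integral>\<^sup>+ f. indicator {c. hpsd CARD('n) c} f * ennreal (exp (- (\<Sum>i<CARD('n). f (i, i)))) \<partial>hmeas CARD('n))"
    unfolding tr by (intro nn_integral_cong) (simp add: indicator_def mem)
  finally show ?thesis unfolding nn_integral_exp_trace_hpsd .
qed

lemma pos_cone_slice:
  assumes "s > 0"
  shows "(x, s) \<in> pos_cone \<longleftrightarrow> (1 / (sqrt (real CARD('n)) * s)) *\<^sub>R x \<in> body"
proof -
  have "(1 / (sqrt (real CARD('n)) * s)) *\<^sub>R (x, s) \<in> pos_cone \<longleftrightarrow> (x, s) \<in> pos_cone"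
    using assms by (intro pos_cone_scale) simp
  moreover have "(1 / (sqrt (real CARD('n)) * s)) *\<^sub>R (x, s) = ((1 / (sqrt (real CARD('n)) * s)) *\<^sub>R x, 1 / sqrt (real CARD('n)))"
    using assms by (simp add: field_simps)
  ultimately show ?thesis by (simp add: body_def)
qed

lemma pos_cone_diag:
  assumes "z \<in> pos_cone"
  shows "Re (emb z $ i $ i) \<ge> 0"
proof -
  have "mquad (emb z) (axis i 1) = Re (emb z $ i $ i)"
  proof -
    have "cnj (axis i 1 $ a) * X $ a $ b * axis i 1 $ b = (if b = i then if a = i then X $ i $ i else 0 else 0)"
      for a b and X :: "complex^'n^'n" by (simp add: axis_def)
    then show ?thesis by (simp add: mquad_def del: Re_sum)
  qed
  then show ?thesis using assms unfolding pos_cone_def by (metis mem_Collect_eq)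
qed

lemma pos_cone_snd_nonneg:
  assumes "z \<in> pos_cone"
  shows "snd z \<ge> 0"
proof -
  have "sqrt (real CARD('n)) * snd z = Re (mtrace (emb z))" by (simp add: mtrace_emb)
  also have "\<dots> \<ge> 0" unfolding mtrace_def Re_sum using pos_cone_diag[OF assms] by (intro sum_nonneg) auto
  finally show ?thesis by (simp add: zero_le_mult_iff)
qed

text \<open>The cone is sliced by trace. The slice at height \<open>s\<close> is the body dilated by
  \<open>q * s\<close> with \<open>q = sqrt d\<close>, so the known exponential integral is the
  volume times the integral of \<open>(q * s) ^ D * exp (- (q * s))\<close> over \<open>s\<close>,
  which is \<open>fact D / q\<close>.\<close>

lemma emeasure_body:
  "emeasure lborel body = ennreal (sqrt (real CARD('n)) * (\<Prod>k<CARD('n). (2 * pi) ^ k * fact k) / fact (CARD('n)\<^sup>2 - 1))"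
proof -
  define q where "q = sqrt (real CARD('n))"
  define D where "D = CARD('n)\<^sup>2 - 1"
  have q: "q > 0" by (simp add: q_def)
  have [measurable]: "pos_cone \<in> sets borel" using closed_pos_cone by (rule borel_closed)
  have bm[measurable]: "body \<in> sets borel" using closed_body by (rule borel_closed)
  have dim: "DIM(real^'m) = D" using card_m by (simp add: D_def)
  define V where "V = emeasure lborel body"
  have slice: "(\<integral>\<^sup>+ x. indicator pos_cone (x, s) * ennreal (exp (- (q * s))) \<partial>lborel)
     = V * (ennreal ((q * s) ^ D * exp (- (q * s))) * indicator {0..} (q * s))" if "s \<noteq> 0" for s
  proof (cases "s > 0")
    case True
    have "(\<lambda>x. (x, s)) -` pos_cone = {x. (1 / (q * s)) *\<^sub>R x \<in> body}"
      using pos_cone_slice[OF True] by (auto simp: q_def)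
    moreover have "emeasure lborel {x. (1 / (q * s)) *\<^sub>R x \<in> body} = ennreal ((q * s) ^ D) * V"
      using emeasure_lborel_scale[OF bm, of "q * s"] True q by (simp add: dim[simplified] V_def)
    moreover have "(\<integral>\<^sup>+ x. indicator pos_cone (x, s) * ennreal (exp (- (q * s))) \<partial>lborel)
      = emeasure lborel ((\<lambda>x. (x, s)) -` pos_cone) * ennreal (exp (- (q * s)))"
    proof -
      have [measurable]: "(\<lambda>x. (x, s)) -` pos_cone \<in> sets borel"
        using measurable_sets[of "\<lambda>x. (x, s)" borel borel pos_cone] by simp
      have "(\<integral>\<^sup>+ x. indicator pos_cone (x, s) * ennreal (exp (- (q * s))) \<partial>lborel)
        = (\<integral>\<^sup>+ x. indicator ((\<lambda>x. (x, s)) -` pos_cone) x * ennreal (exp (- (q * s))) \<partial>lborel)"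
        by (intro nn_integral_cong) (simp add: indicator_def)
      then show ?thesis by (simp add: nn_integral_multc)
    qed
    ultimately show ?thesis using True q by (simp add: ennreal_mult ac_simps)
  next
    case False
    then have "indicator pos_cone (x, s) = (0::ennreal)" for x
      using pos_cone_snd_nonneg[of "(x, s)"] that by (auto simp: indicator_def)
    then show ?thesis using False that q by (simp add: zero_le_mult_iff)
  qed
  have "ennreal (\<Prod>k<CARD('n). (2 * pi) ^ k * fact k)
    = (\<integral>\<^sup>+ z. indicator pos_cone z * ennreal (exp (- (q * snd z))) \<partial>(lborel \<Otimes>\<^sub>M lborel))"
    unfolding lborel_prod q_def nn_integral_exp_trace_pos_cone ..
  also have "\<dots> = (\<integral>\<^sup>+ s. (\<integral>\<^sup>+ x. indicator pos_cone (x, s) * ennreal (exp (- (q * s))) \<partial>lborel) \<partial>lborel)"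
  proof (subst lborel_pair.nn_integral_snd[symmetric])
    show "(\<lambda>z. indicator pos_cone z * ennreal (exp (- (q * snd z)))) \<in> borel_measurable (lborel \<Otimes>\<^sub>M lborel)"
      unfolding lborel_prod using borel_measurable_snd_lborel by simp
  qed simp
  also have "\<dots> = (\<integral>\<^sup>+ s. V * (ennreal ((q * s) ^ D * exp (- (q * s))) * indicator {0..} (q * s)) \<partial>lborel)"
    using AE_lborel_singleton[of "0::real"] by (intro nn_integral_cong_AE) (auto simp: slice)
  also have "\<dots> = V * (\<integral>\<^sup>+ s. ennreal ((q * s) ^ D * exp (- (q * s))) * indicator {0..} (q * s) \<partial>lborel)"
    by (rule nn_integral_cmult) measurable
  also have "(\<integral>\<^sup>+ s. ennreal ((q * s) ^ D * exp (- (q * s))) * indicator {0..} (q * s) \<partial>lborel) = ennreal (fact D / q)"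
  proof -
    have "ennreal (fact D) = (\<integral>\<^sup>+x. ennreal (x^D * exp (-x)) * indicator {0 ..} x \<partial>lborel)"
      by (simp add: nn_intergal_power_times_exp_Ici)
    also have "\<dots> = ennreal q * (\<integral>\<^sup>+ s. ennreal ((q * s) ^ D * exp (- (q * s))) * indicator {0..} (q * s) \<partial>lborel)"
      using nn_integral_real_affine[of "\<lambda>x. ennreal (x^D * exp (-x)) * indicator {0 ..} x" q 0] q by simp
    finally have "ennreal (1 / q) * ennreal (fact D) = (ennreal (1 / q) * ennreal q) * (\<integral>\<^sup>+ s. ennreal ((q * s) ^ D * exp (- (q * s))) * indicator {0..} (q * s) \<partial>lborel)"
      by (simp add: mult.assoc)
    also have "ennreal (1 / q) * ennreal q = 1" using q by (simp add: ennreal_mult[symmetric])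
    finally show ?thesis using q by (simp add: ennreal_mult[symmetric])
  qed
  finally have "V * ennreal (fact D / q) * ennreal (q / fact D) = ennreal (\<Prod>k<CARD('n). (2 * pi) ^ k * fact k) * ennreal (q / fact D)"
    by simp
  also have "V * ennreal (fact D / q) * ennreal (q / fact D) = V"
    using q by (simp add: mult.assoc ennreal_mult[symmetric])
  finally show ?thesis
    using q unfolding V_def by (simp add: ennreal_mult[symmetric] prod_nonneg q_def D_def field_simps)
qed

end

subsection \<open>Hermitian forms\<close>

definition mform :: "complex^'n^'n \<Rightarrow> complex^'n \<Rightarrow> complex^'n \<Rightarrow> complex" where
  "mform X u v = (\<Sum>i\<in>UNIV. \<Sum>j\<in>UNIV. cnj (u $ i) * X $ i $ j * v $ j)"

lemma mquad_mform: "mquad X v = Re (mform X v v)"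
  by (simp add: mquad_def mform_def)

lemma mform_add_vec: "mform X (u + u') v = mform X u v + mform X u' v" "mform X u (v + v') = mform X u v + mform X u v'"
  by (simp_all add: mform_def algebra_simps sum.distrib)

lemma mform_scale_vec: "mform X (a *s u) v = cnj a * mform X u v" "mform X u (a *s v) = a * mform X u v"
  by (simp_all add: mform_def sum_distrib_left ac_simps)

lemma mform_add: "mform (X + Y) u v = mform X u v + mform Y u v"
  by (simp add: mform_def algebra_simps sum.distrib)

lemma mform_scaleR: "mform (r *\<^sub>R X) u v = of_real r * mform X u v"
  by (simp add: mform_def sum_distrib_left scaleR_conv_of_real[where 'a=complex] ac_simps)

lemma mform_swap:
  assumes "hermitian X"
  shows "mform X v u = cnj (mform X u v)"
proof -
  have X: "cnj (X $ i $ j) = X $ j $ i" for i j using assms by (simp add: hermitian_iff_cnj)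
  have "cnj (mform X u v) = (\<Sum>i\<in>UNIV. \<Sum>j\<in>UNIV. cnj (v $ j) * X $ j $ i * u $ i)"
    by (simp add: mform_def X ac_simps)
  also have "\<dots> = mform X v u" unfolding mform_def by (rule sum.swap)
  finally show ?thesis ..
qed

lemma mquad_add_vec:
  assumes "hermitian X"
  shows "mquad X (u + v) = mquad X u + mquad X v + 2 * Re (mform X u v)"
  using mform_swap[OF assms, of v u] by (simp add: mquad_mform mform_add_vec)

lemma mform_mat_1: "mform (mat 1) u v = (\<Sum>i\<in>UNIV. cnj (u $ i) * v $ i)"
proof -
  have "cnj (u $ i) * (mat 1 :: complex^'a^'a) $ i $ j * v $ j = (if i = j then cnj (u $ i) * v $ i else 0)" for i j
    by (simp add: mat_def)
  then show ?thesis by (simp add: mform_def)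
qed

lemma mform_mat_1_self: "mform (mat 1) v v = of_real ((norm v)\<^sup>2)"
  using hermitian_quad_Im[OF hermitian_mat_1, of v] mquad_mat_1[of v]
  unfolding mquad_mform mform_def[symmetric] by (simp add: complex_eq_iff)

lemma mform_axis: "mform X (axis i a) (axis j b) = cnj a * X $ i $ j * b"
proof -
  have "cnj (axis i a $ p) * X $ p $ q * axis j b $ q = (if q = j then if p = i then cnj a * X $ i $ j * b else 0 else 0)" for p q
    by (simp add: axis_def)
  then show ?thesis by (simp add: mform_def)
qed

definition outer :: "complex^'n \<Rightarrow> complex^'n^'n" where
  "outer v = (\<chi> a b. v $ a * cnj (v $ b))"

lemma hermitian_outer: "hermitian (outer v)"
  by (simp add: hermitian_iff_cnj outer_def mult.commute)

lemma mtrace_outer: "mtrace (outer v) = of_real ((norm v)\<^sup>2)"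
  unfolding mform_mat_1_self[symmetric] mform_mat_1 by (simp add: mtrace_def outer_def mult.commute)

lemma mquad_outer: "mquad (outer v) u = (cmod (mform (mat 1) v u))\<^sup>2"
proof -
  have "mform (outer v) u u = (\<Sum>i\<in>UNIV. v $ i * cnj (u $ i)) * (\<Sum>j\<in>UNIV. cnj (v $ j) * u $ j)"
    unfolding mform_def sum_product by (intro sum.cong refl) (simp add: outer_def ac_simps)
  also have "(\<Sum>i\<in>UNIV. v $ i * cnj (u $ i)) = cnj (mform (mat 1) v u)"
    by (simp add: mform_mat_1)
  finally have "mform (outer v) u u = complex_of_real ((cmod (mform (mat 1) v u))\<^sup>2)"
    unfolding complex_norm_square mform_mat_1[symmetric] by (simp add: mult.commute)
  then show ?thesis by (simp add: mquad_mform)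
qed

lemma inner_outer: "inner X (outer v) = mquad X v"
proof -
  have e: "inner (X $ i $ j) (outer v $ i $ j) = Re (cnj (v $ i) * X $ i $ j * v $ j)" for i j
    by (simp add: outer_def inner_complex_def algebra_simps)
  show ?thesis by (simp only: mquad_def Re_sum inner_vec_def e)
qed

text \<open>With \<open>a = (norm v)\<^sup>2 / d\<close> and \<open>b = 1\<close> the matrix is
  minus the traceless part of \<open>outer v\<close>, and the value is
  \<open>(norm v) ^ 4 * (1 - 1 / d)\<close>. This is the origin of the constant
  \<open>sqrt (1 - 1 / d)\<close>.\<close>

lemma norm_mat_1_diff_outer:
  fixes v :: "complex^'n"
  shows "(norm (a *\<^sub>R mat 1 - b *\<^sub>R outer v))\<^sup>2 = a\<^sup>2 * CARD('n) - 2 * a * b * (norm v)\<^sup>2 + b\<^sup>2 * (norm v) ^ 4"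
proof -
  have "inner (mat 1 :: complex^'n^'n) (mat 1) = CARD('n)" by (simp add: inner_mat_1 mtrace_mat_1)
  moreover have "inner (mat 1) (outer v) = (norm v)\<^sup>2" by (simp add: inner_outer mquad_mat_1)
  moreover have "inner (outer v) (outer v) = (norm v) ^ 4"
    by (simp add: inner_outer mquad_outer mform_mat_1_self norm_power)
  ultimately show ?thesis
    unfolding power2_norm_eq_inner
    by (simp add: inner_diff_left inner_diff_right inner_commute[of "outer v" "mat 1"] power2_eq_square algebra_simps)
qed

text \<open>\<open>v\<close> minimises the form on the compact unit sphere. The last conclusion is
  the eigenvector equation in weak form: \<open>X - l * I\<close> is a nonnegative form vanishing at
  \<open>v\<close>, and such a form pairs \<open>v\<close> to zero with every vector.\<close>

lemma hermitian_min_eigenvector: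
  fixes X :: "complex^'n^'n"
  assumes X: "hermitian X"
  obtains v l where "norm v = 1" "mquad X v = l" "\<And>u. mquad X u \<ge> l * (norm u)\<^sup>2"
    "\<And>w. mform (mat 1) v w = 0 \<Longrightarrow> mform X v w = 0"
proof -
  have cont: "continuous_on (sphere 0 1) (mquad X)"
    unfolding mquad_def[abs_def] by (intro continuous_intros)
  have "sphere (0 :: complex^'n) 1 \<noteq> {}" by simp
  then obtain v where v: "v \<in> sphere 0 1" "\<And>u. u \<in> sphere 0 1 \<Longrightarrow> mquad X v \<le> mquad X u"
    using continuous_attains_inf[OF compact_sphere _ cont] by blast
  define l where "l = mquad X v"
  have nv: "norm v = 1" using v by simp
  have min: "mquad X u \<ge> l * (norm u)\<^sup>2" for u
  proof (cases "u = 0")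
    case True then show ?thesis by (simp add: mquad_def)
  next
    case False
    define c where "c = complex_of_real (1 / norm u)"
    have "norm (c *s u) = 1"
    proof -
      have "(norm (c *s u))\<^sup>2 = (cmod c)\<^sup>2 * (norm u)\<^sup>2" by (simp only: mquad_mat_1[symmetric] mquad_scale_vec)
      also have "\<dots> = 1" using False by (simp add: c_def norm_divide power_divide)
      finally show ?thesis by (simp add: power2_eq_1_iff) (smt (verit) norm_ge_zero)
    qed
    then have "l \<le> mquad X (c *s u)" using v(2) by (simp add: l_def)
    also have "\<dots> = mquad X u / (norm u)\<^sup>2" by (simp add: mquad_scale_vec c_def norm_divide power_divide)
    finally show ?thesis using False by (simp add: field_simps)
  qed
  have "mform X v w = 0" if w: "mform (mat 1) v w = 0" for w
  proof -
    define Y where "Y = X + (- l) *\<^sub>R mat 1"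
    have Y: "hermitian Y" unfolding Y_def by (intro hermitian_add hermitian_scaleR X hermitian_mat_1)
    have Ypos: "mquad Y u \<ge> 0" for u using min[of u] by (simp add: Y_def mquad_add mquad_scaleR mquad_mat_1 del: scaleR_minus_left)
    have Yv: "mquad Y v = 0" using nv by (simp add: Y_def mquad_add mquad_scaleR mquad_mat_1 l_def del: scaleR_minus_left)
    define m where "m = mform Y v w"
    define q where "q = mquad Y w"
    have q: "q \<ge> 0" using Ypos by (simp add: q_def)
    \<comment> \<open>At \<open>v - r * cnj m * w\<close> the form is
      \<open>r * (cmod m)\<^sup>2 * (r * q - 2)\<close>, which is negative for \<open>r > 0\<close>
      and \<open>r * q < 2\<close> unless \<open>m = 0\<close>.\<close>
    define r where "r = 1 / (q + 1)"
    have r: "r > 0" "r * q < 1" using q by (auto simp: r_def)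
    have "0 \<le> mquad Y (v + (- of_real r * cnj m) *s w)" by (rule Ypos)
    also have "\<dots> = r\<^sup>2 * (cmod m)\<^sup>2 * q + 2 * Re ((- of_real r * cnj m) * m)"
      unfolding mquad_add_vec[OF Y] mquad_scale_vec mform_scale_vec Yv m_def[symmetric] q_def[symmetric]
      by (simp add: norm_mult power_mult_distrib)
    also have "Re ((- of_real r * cnj m) * m) = - r * (cmod m)\<^sup>2"
      unfolding cmod_power2 by (simp add: power2_eq_square algebra_simps)
    finally have "0 \<le> (r * (cmod m)\<^sup>2) * (r * q - 2)" by (simp add: power2_eq_square algebra_simps)
    then have "r * (cmod m)\<^sup>2 \<le> 0" using r by (smt (verit) mult_pos_neg)
    then have "m = 0" using r by (simp add: mult_le_0_iff)
    then show ?thesis using w by (simp add: m_def Y_def mform_add mform_scaleR del: scaleR_minus_left)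
  qed
  with that nv min l_def show ?thesis by blast
qed

text \<open>Cramer's rule for a two by two minor of maximal modulus.\<close>
lemma orthonormal_pair_lift:
  fixes v w :: "complex^'n"
  assumes v: "norm v = 1" and w: "norm w = 1" and o: "mform (mat 1) v w = 0"
  shows "\<exists>i j. \<forall>u1 u2. \<exists>a b. let z = a *s v + b *s w in z $ i = u1 \<and> z $ j = u2 \<and> (\<forall>k. cmod (z $ k) \<le> cmod u1 + cmod u2)"
proof -
  define M where "M i j = v $ i * w $ j - v $ j * w $ i" for i j
  define S where "S = range (\<lambda>(i, j). cmod (M i j))"
  have S: "finite S" "S \<noteq> {}" by (auto simp: S_def)
  have "\<exists>i j. s = cmod (M i j)" if "s \<in> S" for s using that by (auto simp: S_def)
  from this[OF Max_in[OF S]] obtain i j where ij: "Max S = cmod (M i j)" by blast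
  have mx: "cmod (M a b) \<le> cmod (M i j)" for a b
    unfolding ij[symmetric] using S by (intro Max_ge) (auto simp: S_def)
  \<comment> \<open>If all two by two minors vanish, \<open>w\<close> is a multiple of
    \<open>v\<close>, and orthogonality to \<open>v\<close> makes it zero.\<close>
  have M0: "M i j \<noteq> 0"
  proof
    assume "M i j = 0"
    then have "M a b = 0" for a b using mx[of a b] by simp
    then have z: "v $ a * w $ b = v $ b * w $ a" for a b by (simp add: M_def)
    have "w $ b = 0" for b
    proof -
      have "w $ b = (\<Sum>a\<in>UNIV. cnj (v $ a) * v $ a) * w $ b"
        using mform_mat_1_self[of v] v by (simp add: mform_mat_1)
      also have "\<dots> = (\<Sum>a\<in>UNIV. cnj (v $ a) * w $ a) * v $ b"
        unfolding sum_distrib_right by (intro sum.cong refl) (use z in \<open>simp add: mult.assoc mult.commute\<close>)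
      finally show ?thesis using o by (simp add: mform_mat_1)
    qed
    then have "w = 0" by (simp add: vec_eq_iff)
    then show False using w by simp
  qed
  show ?thesis
  proof (rule exI[of _ i], rule exI[of _ j], intro allI)
    fix u1 u2
    define a where "a = (u1 * w $ j - u2 * w $ i) / M i j"
    define b where "b = (v $ i * u2 - v $ j * u1) / M i j"
    define z where "z = a *s v + b *s w"
    \<comment> \<open>Every coordinate is a combination of \<open>u1\<close> and \<open>u2\<close>
      whose coefficients are minors divided by the maximal one, hence of modulus at most
      one.\<close>
    have zk: "z $ k = (u1 * M k j + u2 * M i k) / M i j" for k
    proof -
      have "z $ k = ((u1 * w $ j - u2 * w $ i) * v $ k + (v $ i * u2 - v $ j * u1) * w $ k) / M i j"
        by (simp add: z_def a_def b_def add_divide_distrib)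
      also have "(u1 * w $ j - u2 * w $ i) * v $ k + (v $ i * u2 - v $ j * u1) * w $ k = u1 * M k j + u2 * M i k"
        by (simp add: M_def algebra_simps)
      finally show ?thesis .
    qed
    have "M j j = 0" "M i i = 0" by (auto simp: M_def)
    then have "z $ i = u1" "z $ j = u2" using M0 by (auto simp: zk)
    moreover have "cmod (z $ k) \<le> cmod u1 + cmod u2" for k
    proof -
      have "cmod (z $ k) \<le> (cmod u1 * cmod (M k j) + cmod u2 * cmod (M i k)) / cmod (M i j)"
        unfolding zk norm_divide
        by (intro divide_right_mono) (auto intro: order_trans[OF norm_triangle_ineq] simp: norm_mult)
      also have "\<dots> \<le> (cmod u1 * cmod (M i j) + cmod u2 * cmod (M i j)) / cmod (M i j)"
        by (intro divide_right_mono add_mono mult_left_mono mx) auto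
      also have "\<dots> = cmod u1 + cmod u2" using M0 by (simp add: field_simps)
      finally show ?thesis .
    qed
    ultimately show "\<exists>a b. let z = a *s v + b *s w in z $ i = u1 \<and> z $ j = u2 \<and> (\<forall>k. cmod (z $ k) \<le> cmod u1 + cmod u2)"
      unfolding z_def Let_def by blast
  qed
qed

subsection \<open>Matrices with two small eigenvalues\<close>

text \<open>Two points of \<open>Z\<close> that differ by \<open>T \<alpha>\<close> have all
  coordinates of \<open>\<alpha>\<close> at most \<open>e\<close> in modulus, so the translates of
  \<open>Z\<close> by the images under \<open>T\<close> of a grid of spacing \<open>2 * e\<close>
  are disjoint. About \<open>(1 / e) ^ k\<close> of them, with \<open>k = DIM('b)\<close>, fit into
  a ball of fixed radius.\<close>

lemma packing_measure_bound:
  fixes T :: "'b::euclidean_space \<Rightarrow> 'a::euclidean_space"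
  assumes T: "linear T"
  obtains C where "C \<ge> 0" "\<And>Z e. \<lbrakk>Z \<in> sets borel; Z \<subseteq> cball 0 R; 0 < e; e \<le> 1;
      \<And>z z' \<alpha>. z \<in> Z \<Longrightarrow> z' \<in> Z \<Longrightarrow> z - z' = T \<alpha> \<Longrightarrow> \<forall>b\<in>Basis. \<bar>\<alpha> \<bullet> b\<bar> \<le> e\<rbrakk>
    \<Longrightarrow> measure lborel Z \<le> C * e ^ DIM('b)"
proof -
  obtain K where K: "\<And>x. norm (T x) \<le> K * norm x" "K > 0"
    using linear_bounded_pos[OF T] by metis
  \<comment> \<open>Grid coordinates lie between 0 and 2, so a grid vector has norm at most
    \<open>2 * DIM('b)\<close> and its image at most \<open>K\<close> times that. The factor
    \<open>2 ^ DIM('b)\<close> in \<open>C\<close> comes from having at least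
    \<open>1 / (2 * e)\<close> grid points in each direction.\<close>
  define R' where "R' = R + K * (2 * DIM('b))"
  define C where "C = 2 ^ DIM('b) * measure lborel (cball (0::'a) R')"
  show ?thesis
  proof (rule that)
    show "C \<ge> 0" by (simp add: C_def)
    fix Z :: "'a set" and e :: real
    assume Z[measurable]: "Z \<in> sets borel" and ZR: "Z \<subseteq> cball 0 R" and e: "0 < e" "e \<le> 1"
      and sep: "\<And>z z' \<alpha>. z \<in> Z \<Longrightarrow> z' \<in> Z \<Longrightarrow> z - z' = T \<alpha> \<Longrightarrow> \<forall>b\<in>Basis. \<bar>\<alpha> \<bullet> b\<bar> \<le> e"
    define M where "M = nat \<lfloor>1 / e\<rfloor>"
    have M: "real M \<le> 1 / e" "real M \<ge> 1 / (2 * e)"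
    proof -
      have "1 / e \<ge> 1" using e by simp
      then have "\<lfloor>1 / e\<rfloor> \<ge> 1" by linarith
      then have f: "real M = of_int \<lfloor>1 / e\<rfloor>" "\<lfloor>1 / e\<rfloor> \<ge> 1" by (auto simp only: M_def of_nat_nat)
      show "real M \<le> 1 / e" unfolding f by simp
      have "1 / e < of_int \<lfloor>1 / e\<rfloor> + 1" by linarith
      moreover have "of_int \<lfloor>1 / e\<rfloor> \<ge> (1::real)" using f(2) by linarith
      ultimately have "1 / e \<le> 2 * of_int \<lfloor>1 / e\<rfloor>" by linarith
      then show "real M \<ge> 1 / (2 * e)" unfolding f by simp
    qed
    define N where "N = (\<Pi>\<^sub>E b\<in>(Basis::'b set). {..<M})"
    define \<alpha> where "\<alpha> n = (\<Sum>b\<in>Basis. (2 * e * real (n b)) *\<^sub>R b)" for n :: "'b \<Rightarrow> nat"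
    have \<alpha>: "\<alpha> n \<bullet> b = 2 * e * real (n b)" if "b \<in> Basis" for n b
      unfolding \<alpha>_def using that by simp
    define W where "W n = (+) (- T (\<alpha> n)) -` Z" for n
    have Wm: "W n \<in> sets lborel" for n
      unfolding W_def using measurable_sets[of "(+) (- T (\<alpha> n))" borel borel Z] by simp
    have WZ: "emeasure lborel (W n) = emeasure lborel Z" for n
      unfolding W_def using emeasure_distr[of "(+) (- T (\<alpha> n))" lborel borel Z]
      by (simp add: lborel_distr_plus)
    have finN: "finite N" by (simp add: N_def finite_PiE)
    have disj: "disjoint_family_on W N"
      unfolding disjoint_family_on_def
    proof (intro ballI impI)
      fix n n' assume n: "n \<in> N" "n' \<in> N" "n \<noteq> n'"
      show "W n \<inter> W n' = {}"
      proof (rule ccontr)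
        assume "W n \<inter> W n' \<noteq> {}"
        then obtain x where x: "- T (\<alpha> n) + x \<in> Z" "- T (\<alpha> n') + x \<in> Z" by (auto simp: W_def)
        have "(- T (\<alpha> n) + x) - (- T (\<alpha> n') + x) = T (\<alpha> n' - \<alpha> n)"
          by (simp add: linear_diff[OF T])
        from sep[OF x this] have s: "\<bar>2 * e * (real (n' b) - real (n b))\<bar> \<le> e" if "b \<in> Basis" for b
          using that by (simp add: inner_diff_left \<alpha> algebra_simps)
        have "n b = n' b" if "b \<in> Basis" for b
        proof -
          have "e * (2 * \<bar>real (n' b) - real (n b)\<bar>) \<le> e * 1" using s[OF that] e by (simp add: abs_mult)
          then have "2 * \<bar>real (n' b) - real (n b)\<bar> \<le> 1" using e by (simp only: mult_le_cancel_left_pos)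
          then have "real_of_int (2 * \<bar>int (n' b) - int (n b)\<bar>) \<le> real_of_int 1" by simp
          then have "2 * \<bar>int (n' b) - int (n b)\<bar> \<le> 1" by (simp only: of_int_le_iff)
          then show ?thesis by presburger
        qed
        then have "n = n'" using n unfolding N_def by (intro PiE_ext) auto
        with n show False by simp
      qed
    qed
    have sub: "W n \<subseteq> cball 0 R'" if "n \<in> N" for n
    proof
      fix x assume "x \<in> W n"
      then have "norm (- T (\<alpha> n) + x) \<le> R" using ZR by (auto simp: W_def)
      moreover have "norm (T (\<alpha> n)) \<le> K * (2 * DIM('b))"
      proof -
        have "norm (\<alpha> n) \<le> (\<Sum>b\<in>Basis. \<bar>\<alpha> n \<bullet> b\<bar>)" by (rule norm_le_l1)
        also have "\<dots> \<le> (\<Sum>b\<in>(Basis::'b set). 2)"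
        proof (rule sum_mono)
          fix b :: 'b assume b: "b \<in> Basis"
          have "n b < M" using that b by (auto simp: N_def PiE_iff)
          then have "real (n b) \<le> 1 / e" using M(1) by linarith
          then have "e * real (n b) \<le> 1" using e by (simp add: field_simps)
          then show "\<bar>\<alpha> n \<bullet> b\<bar> \<le> 2" using b e by (simp add: \<alpha> abs_mult)
        qed
        finally have "norm (\<alpha> n) \<le> 2 * DIM('b)" by simp
        then show ?thesis using K(1)[of "\<alpha> n"] K(2) by (meson mult_left_mono less_imp_le order_trans)
      qed
      moreover have "norm x \<le> norm (- T (\<alpha> n) + x) + norm (T (\<alpha> n))"
        by (metis add.commute add_uminus_conv_diff diff_add_cancel norm_triangle_ineq)
      ultimately show "x \<in> cball 0 R'" by (simp add: R'_def)
    qed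
    have fin: "emeasure lborel Z \<noteq> \<infinity>"
    proof -
      have "emeasure lborel Z \<le> emeasure lborel (cball (0::'a) R)" using ZR by (intro emeasure_mono) auto
      then show ?thesis using emeasure_lborel_cball_finite[of "0::'a" R] by (auto simp: less_top[symmetric] top_unique)
    qed
    have "real (card N) * measure lborel Z = (\<Sum>n\<in>N. measure lborel (W n))"
      by (simp add: measure_def WZ)
    also have "\<dots> = measure lborel (\<Union>n\<in>N. W n)"
      using finN disj Wm fin WZ by (intro measure_finite_Union[symmetric]) (auto simp: image_subset_iff)
    also have "\<dots> \<le> measure lborel (cball (0::'a) R')"
      using sub Wm finN by (intro measure_mono_fmeasurable fmeasurable_compact) auto
    finally have 1: "real (card N) * measure lborel Z \<le> measure lborel (cball (0::'a) R')" .
    have "card N = M ^ DIM('b)" by (simp add: N_def card_PiE)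
    then have "(1 / (2 * e)) ^ DIM('b) \<le> real (card N)" using M(2) e by (auto intro!: power_mono)
    then have "(1 / (2 * e)) ^ DIM('b) * measure lborel Z \<le> measure lborel (cball (0::'a) R')"
      using 1 by (meson measure_nonneg mult_right_mono order_trans)
    then show "measure lborel Z \<le> C * e ^ DIM('b)"
      using e by (simp add: C_def power_divide power_mult_distrib field_simps)
  qed
qed

definition munit :: "'n \<Rightarrow> 'n \<Rightarrow> complex \<Rightarrow> complex^'n^'n" where
  "munit i j h = (\<chi> a b. if a = i then if b = j then h else 0 else 0)"

lemma mform_munit: "mform (munit i j h) u v = cnj (u $ i) * h * v $ j"
proof -
  have "cnj (u $ a) * munit i j h $ a $ b * v $ b = (if b = j then if a = i then cnj (u $ i) * h * v $ j else 0 else 0)" for a b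
    by (simp add: munit_def)
  then show ?thesis by (simp add: mform_def)
qed

text \<open>For \<open>i \<noteq> j\<close> these are the Hermitian matrices supported on the rows
  and columns \<open>i, j\<close>, a real space of dimension four; this dimension becomes the
  exponent in the volume bound.\<close>

definition mblock :: "'n \<Rightarrow> 'n \<Rightarrow> complex \<times> real \<times> real \<Rightarrow> complex^'n^'n" where
  "mblock i j = (\<lambda>(h, p, q). munit i i (of_real p) + munit j j (of_real q) + munit i j h + munit j i (cnj h))"

lemma linear_mblock: "linear (mblock i j)"
  by (intro linearI) (auto simp: mblock_def munit_def vec_eq_iff scaleR_conv_of_real[where 'a=complex] distrib_left)

lemma hermitian_mblock: "hermitian (mblock i j \<alpha>)"
  by (cases \<alpha>) (auto simp: hermitian_iff_cnj mblock_def munit_def)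

lemma mquad_mblock:
  "mquad (mblock i j (h, p, q)) w = p * (cmod (w $ i))\<^sup>2 + q * (cmod (w $ j))\<^sup>2 + 2 * Re (cnj (w $ i) * h * w $ j)"
  unfolding mquad_mform mblock_def prod.case mform_add mform_munit cmod_power2
  by (simp add: power2_eq_square algebra_simps)

context hermitian_coordinates
begin

text \<open>Neighbourhood of the corank-two matrices, described without eigenvectors. Instead of a
  plane on which the form is at most \<open>e\<close>, every pair of values at the coordinates
  \<open>i, j\<close> has a lift \<open>w\<close> with that bound; the cap on the coordinates of
  \<open>w\<close> keeps the lifts in a compact set. For \<open>i = j\<close> the set is empty,
  since \<open>u1\<close> and \<open>u2\<close> may differ.\<close>

definition near_corank2 :: "'n \<Rightarrow> 'n \<Rightarrow> real \<Rightarrow> real \<Rightarrow> ((real^'m) \<times> real) set" where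
  "near_corank2 i j R e = {z. norm z \<le> R \<and> (\<forall>v. mquad (emb z) v \<ge> - e * (norm v)\<^sup>2) \<and>
     (\<forall>u1 u2. \<exists>w. w $ i = u1 \<and> w $ j = u2 \<and> (\<forall>k. cmod (w $ k) \<le> cmod u1 + cmod u2) \<and>
        mquad (emb z) w \<le> e * (norm w)\<^sup>2)}"

lemma norm_le_card_mult:
  fixes w :: "complex^'n"
  assumes "\<And>k. cmod (w $ k) \<le> r"
  shows "(norm w)\<^sup>2 \<le> real CARD('n) * r\<^sup>2"
proof -
  have "(norm w)\<^sup>2 = (\<Sum>k\<in>UNIV. (cmod (w $ k))\<^sup>2)" by (simp add: norm_vec_def L2_set_def sum_nonneg)
  also have "\<dots> \<le> (\<Sum>k\<in>(UNIV::'n set). r\<^sup>2)" using assms by (intro sum_mono power_mono) auto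
  finally show ?thesis by simp
qed

text \<open>For fixed \<open>u1, u2\<close> the admissible pairs \<open>(z, w)\<close> form a
  compact set, so projecting away the witness \<open>w\<close> leaves a closed set of
  \<open>z\<close>; the quantifiers over \<open>u1, u2\<close> are then an intersection.\<close>

lemma closed_near_corank2: "closed (near_corank2 i j R e)"
proof -
  define P where "P u1 u2 = {(z, w). norm z \<le> R \<and> w $ i = u1 \<and> w $ j = u2 \<and>
      (\<forall>k. cmod (w $ k) \<le> cmod u1 + cmod u2) \<and> mquad (emb z) w \<le> e * (norm w)\<^sup>2}" for u1 u2
  have ce: "continuous_on S emb" for S
    using linear_emb by (intro linear_continuous_on linear_conv_bounded_linear[THEN iffD1])
  have cef: "continuous_on UNIV (\<lambda>p :: ((real^'m) \<times> real) \<times> (complex^'n). emb (fst p))"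
    by (rule continuous_on_compose2[OF ce[of UNIV]]) (auto intro: continuous_intros)
  have "compact (P u1 u2)" for u1 u2
  proof -
    have "closed (P u1 u2)"
      unfolding P_def case_prod_beta mquad_def
      by (intro closed_Collect_conj closed_Collect_all closed_Collect_le closed_Collect_eq continuous_intros cef)
    moreover have "P u1 u2 \<subseteq> cball 0 R \<times> cball 0 (sqrt (real CARD('n) * (cmod u1 + cmod u2)\<^sup>2))"
      using norm_le_card_mult[of _ "cmod u1 + cmod u2"] by (auto simp: P_def intro!: real_le_rsqrt)
    then have "bounded (P u1 u2)" by (rule bounded_subset[rotated]) (intro bounded_Times bounded_cball)
    ultimately show ?thesis by (simp add: compact_eq_bounded_closed)
  qed
  then have cl: "closed (fst ` P u1 u2)" for u1 u2
    by (intro compact_imp_closed compact_continuous_image continuous_intros)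
  have mem: "fst ` P u1 u2 = {z. norm z \<le> R \<and> (\<exists>w. w $ i = u1 \<and> w $ j = u2 \<and>
      (\<forall>k. cmod (w $ k) \<le> cmod u1 + cmod u2) \<and> mquad (emb z) w \<le> e * (norm w)\<^sup>2)}" for u1 u2
    unfolding P_def by (force simp: image_def)
  have "near_corank2 i j R e = {z. norm z \<le> R \<and> (\<forall>v. mquad (emb z) v \<ge> - e * (norm v)\<^sup>2)} \<inter> (\<Inter>u1. \<Inter>u2. fst ` P u1 u2)"
    unfolding near_corank2_def mem by auto
  moreover have "closed {z. norm z \<le> R \<and> (\<forall>v. mquad (emb z) v \<ge> - e * (norm v)\<^sup>2)}"
    by (intro closed_Collect_conj closed_Collect_all closed_Collect_le continuous_intros linear_continuous_on
      linear_conv_bounded_linear[THEN iffD1] linear_mquad_emb)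
  ultimately show ?thesis using cl by (auto intro!: closed_Int closed_INT)
qed

text \<open>Each of the two matrices is almost nonpositive on a plane that projects onto the coordinates \<open>i, j\<close>, and
  the other one is almost nonnegative there. Hence translates of this set along the four-dimensional
  space of blocks at \<open>i, j\<close> can be packed into a ball, which bounds its volume by \<open>O(e ^ 4)\<close>.\<close>
lemma near_corank2_separated:
  assumes z: "z \<in> near_corank2 i j R e" "z' \<in> near_corank2 i j R e"
    and H: "emb z - emb z' = mblock i j (h, p, q)" and e: "e \<ge> 0"
  defines "\<eta> \<equiv> 6 * real CARD('n) * e"
  shows "\<bar>p\<bar> \<le> \<eta>" "\<bar>q\<bar> \<le> \<eta>" "\<bar>Re h\<bar> \<le> \<eta>" "\<bar>Im h\<bar> \<le> \<eta>"
proof -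
  define f where "f u1 u2 = p * (cmod u1)\<^sup>2 + q * (cmod u2)\<^sup>2 + 2 * Re (cnj u1 * h * u2)" for u1 u2
  have fq: "mquad (emb z) w - mquad (emb z') w = f (w $ i) (w $ j)" for w
    unfolding f_def mquad_mblock[symmetric] H[symmetric] mquad_diff ..
  have b: "\<bar>f u1 u2\<bar> \<le> 2 * e * (real CARD('n) * (cmod u1 + cmod u2)\<^sup>2)" for u1 u2
  proof -
    obtain w where w: "w $ i = u1" "w $ j = u2" "\<And>k. cmod (w $ k) \<le> cmod u1 + cmod u2" "mquad (emb z) w \<le> e * (norm w)\<^sup>2"
      using z(1) unfolding near_corank2_def by blast
    obtain w' where w': "w' $ i = u1" "w' $ j = u2" "\<And>k. cmod (w' $ k) \<le> cmod u1 + cmod u2" "mquad (emb z') w' \<le> e * (norm w')\<^sup>2"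
      using z(2) unfolding near_corank2_def by blast
    have "mquad (emb z) w' \<ge> - e * (norm w')\<^sup>2" "mquad (emb z') w \<ge> - e * (norm w)\<^sup>2"
      using z unfolding near_corank2_def by auto
    then have "f u1 u2 \<le> 2 * (e * (norm w)\<^sup>2)" "f u1 u2 \<ge> - 2 * (e * (norm w')\<^sup>2)"
      using fq[of w] fq[of w'] w w' by auto
    moreover have "e * (norm w)\<^sup>2 \<le> e * (real CARD('n) * (cmod u1 + cmod u2)\<^sup>2)"
      "e * (norm w')\<^sup>2 \<le> e * (real CARD('n) * (cmod u1 + cmod u2)\<^sup>2)"
      using norm_le_card_mult[of w] norm_le_card_mult[of w'] w(3) w'(3) e by (auto intro!: mult_left_mono)
    ultimately show ?thesis by linarith
  qed
  \<comment> \<open>These test values isolate \<open>p\<close>, \<open>q\<close>,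
    \<open>p + q + 2 * Re h\<close> and \<open>p + q - 2 * Im h\<close>, with bounds 2, 2, 8 and 8
    times \<open>d * e\<close>. Solving for \<open>Re h\<close> and \<open>Im h\<close> gives the
    constant \<open>6 = (8 + 2 + 2) / 2\<close>.\<close>
  note bs = b[of 1 0] b[of 0 1] b[of 1 1] b[of 1 \<i>]
  have "\<eta> = 6 * (e * real CARD('n))" "e * real CARD('n) \<ge> 0" using e by (simp_all add: \<eta>_def)
  moreover have "\<bar>p\<bar> \<le> 2 * (e * real CARD('n))" "\<bar>q\<bar> \<le> 2 * (e * real CARD('n))"
    "\<bar>p + q + 2 * Re h\<bar> \<le> 8 * (e * real CARD('n))" "\<bar>p + q - 2 * Im h\<bar> \<le> 8 * (e * real CARD('n))"
    using bs by (simp_all add: f_def)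
  ultimately have "\<bar>p\<bar> \<le> \<eta> \<and> \<bar>q\<bar> \<le> \<eta> \<and> \<bar>Re h\<bar> \<le> \<eta> \<and> \<bar>Im h\<bar> \<le> \<eta>"
    by linarith
  then show "\<bar>p\<bar> \<le> \<eta>" "\<bar>q\<bar> \<le> \<eta>" "\<bar>Re h\<bar> \<le> \<eta>" "\<bar>Im h\<bar> \<le> \<eta>" by auto
qed

lemma measure_near_corank2:
  obtains C where "C \<ge> 0" "\<And>e. 0 < e \<Longrightarrow> 6 * real CARD('n) * e \<le> 1 \<Longrightarrow> measure lborel (near_corank2 i j R e) \<le> C * e ^ 4"
proof -
  define T :: "complex \<times> real \<times> real \<Rightarrow> (real^'m) \<times> real"
    where "T \<alpha> = ((\<chi> k. inner (mblock i j \<alpha>) (B k)), Re (mtrace (mblock i j \<alpha>)) / sqrt (real CARD('n)))" for \<alpha>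
  have T: "linear T"
    by (intro linearI) (auto simp: T_def linear_add[OF linear_mblock] linear_scale[OF linear_mblock] inner_add_left
        linear_add[OF linear_mtrace] linear_scale[OF linear_mtrace] vec_eq_iff add_divide_distrib)
  have eT: "emb (T \<alpha>) = mblock i j \<alpha>" for \<alpha>
    unfolding T_def by (rule hermitian_imp_emb[OF hermitian_mblock])
  obtain C where C: "C \<ge> 0" "\<And>Z e. \<lbrakk>Z \<in> sets borel; Z \<subseteq> cball 0 R; 0 < e; e \<le> 1;
      \<And>z z' \<alpha>. z \<in> Z \<Longrightarrow> z' \<in> Z \<Longrightarrow> z - z' = T \<alpha> \<Longrightarrow> \<forall>b\<in>Basis. \<bar>\<alpha> \<bullet> b\<bar> \<le> e\<rbrakk>
    \<Longrightarrow> measure lborel Z \<le> C * e ^ DIM(complex \<times> real \<times> real)"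
    using packing_measure_bound[OF T, of R] by blast
  show ?thesis
  proof (rule that)
    show "C * (6 * real CARD('n)) ^ 4 \<ge> 0" using C(1) by simp
    fix e :: real assume e: "0 < e" "6 * real CARD('n) * e \<le> 1"
    have "measure lborel (near_corank2 i j R e) \<le> C * (6 * real CARD('n) * e) ^ DIM(complex \<times> real \<times> real)"
    proof (rule C(2))
      show "near_corank2 i j R e \<in> sets borel" by (rule borel_closed[OF closed_near_corank2])
      show "near_corank2 i j R e \<subseteq> cball 0 R" by (auto simp: near_corank2_def)
      fix z z' \<alpha> assume z: "z \<in> near_corank2 i j R e" "z' \<in> near_corank2 i j R e" and zz: "z - z' = T \<alpha>"
      obtain h p q where \<alpha>: "\<alpha> = (h, p, q)" by (cases \<alpha>)
      have "emb z - emb z' = mblock i j (h, p, q)"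
        using arg_cong[OF zz, of emb] unfolding linear_diff[OF linear_emb] eT \<alpha> .
      from near_corank2_separated[OF z this] e
      show "\<forall>b\<in>Basis. \<bar>\<alpha> \<bullet> b\<bar> \<le> 6 * real CARD('n) * e"
        by (auto simp: \<alpha> Basis_prod_def Basis_complex_def)
    qed (use e in auto)
    then show "measure lborel (near_corank2 i j R e) \<le> C * (6 * real CARD('n)) ^ 4 * e ^ 4"
      by (simp add: power_mult_distrib mult.assoc)
  qed
qed

end

subsection \<open>Parallel bodies of the set of density matrices\<close>

context hermitian_coordinates
begin

definition dmat :: "real^'m \<Rightarrow> complex^'n^'n" where
  "dmat x = emb (x, 1 / sqrt (real CARD('n)))"

lemma dmat_eq: "dmat x = mat (1 / of_nat CARD('n)) + (\<Sum>i\<in>UNIV. (x $ i) *\<^sub>R B i)"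
proof -
  have "(1 / sqrt (real CARD('n)) / sqrt (real CARD('n))) *\<^sub>R (mat 1 :: complex^'n^'n) = mat (1 / of_nat CARD('n))"
    by (simp add: mat_def vec_eq_iff scaleR_conv_of_real[where 'a=complex])
  then show ?thesis by (simp add: dmat_def emb_def del: divide_divide_eq_left)
qed

lemma body_iff: "x \<in> body \<longleftrightarrow> (\<forall>v. 0 \<le> mquad (dmat x) v)"
  by (simp add: body_def pos_cone_def dmat_def)

lemma hermitian_dmat: "hermitian (dmat x)" and mtrace_dmat: "mtrace (dmat x) = 1"
  by (simp_all add: dmat_def hermitian_emb mtrace_emb)

lemma dmat_diff: "dmat x - dmat y = emb (x - y, 0)"
  using linear_diff[OF linear_emb, of "(x, 1 / sqrt (real CARD('n)))" "(y, 1 / sqrt (real CARD('n)))"]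
  by (simp add: dmat_def)

lemma dist_dmat: "dist (dmat x) (dmat y) = dist x y"
  by (simp add: dist_norm dmat_diff norm_emb norm_Pair)

lemma ex_dmat:
  assumes "hermitian X" "mtrace X = 1"
  obtains x where "dmat x = X"
  using hermitian_imp_emb[OF assms(1)] assms(2) by (auto simp: dmat_def)

lemma density_matrices_eq: "density_matrices = dmat ` body"
proof -
  have "\<exists>x\<in>body. X = dmat x" if X: "hermitian X" "mtrace X = 1" "psd X" for X
  proof -
    obtain x where "dmat x = X" using ex_dmat[OF X(1,2)] by blast
    then show ?thesis using X psd_iff_mquad[of X] body_iff[of x] by auto
  qed
  then show ?thesis
    unfolding density_matrices_def
    using psd_iff_mquad[OF hermitian_dmat] by (auto simp: body_iff hermitian_dmat mtrace_dmat)
qed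

lemma mquad_dmat: "mquad (dmat x) v = mquad (emb (x, 0)) v + (norm v)\<^sup>2 / real CARD('n)"
proof -
  have "dmat x = emb (x, 0) + (1 / real CARD('n)) *\<^sub>R mat 1"
    using linear_add[OF linear_emb, of "(x, 0)" "(0, 1 / sqrt (real CARD('n)))"]
    by (simp add: dmat_def emb_def)
  then show ?thesis by (simp add: mquad_add mquad_scaleR mquad_mat_1)
qed

lemma linear_mquad_emb0: "linear (\<lambda>x. mquad (emb (x, 0)) v)"
proof -
  have "linear (\<lambda>x. (x, 0::real))" by (intro linearI) auto
  from linear_compose[OF this linear_mquad_emb] show ?thesis by (simp add: o_def)
qed

lemma zero_in_body: "0 \<in> body"
  using linear_0[OF linear_mquad_emb0] by (simp add: body_iff mquad_dmat)

lemma convex_body: "convex body"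
proof -
  have "convex {x. 0 \<le> mquad (dmat x) v}" for v
  proof (rule convexI)
    fix x y and a b :: real
    assume *: "x \<in> {x. 0 \<le> mquad (dmat x) v}" "y \<in> {x. 0 \<le> mquad (dmat x) v}" "0 \<le> a" "0 \<le> b" "a + b = 1"
    have "mquad (dmat (a *\<^sub>R x + b *\<^sub>R y)) v = a * mquad (dmat x) v + b * mquad (dmat y) v + (1 - (a + b)) * ((norm v)\<^sup>2 / real CARD('n))"
      unfolding mquad_dmat linear_add[OF linear_mquad_emb0] linear_scale[OF linear_mquad_emb0]
      by (simp add: algebra_simps diff_divide_distrib add_divide_distrib)
    then show "a *\<^sub>R x + b *\<^sub>R y \<in> {x. 0 \<le> mquad (dmat x) v}" using * by simp
  qed
  moreover have "body = (\<Inter>v. {x. 0 \<le> mquad (dmat x) v})" by (auto simp: body_iff)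
  ultimately show ?thesis by (simp add: convex_INT)
qed

text \<open>Positivity on vectors supported on two coordinates bounds every entry of a density
  matrix by 1 in modulus, and the norm is at most the sum of the \<open>d\<^sup>2\<close>
  moduli.\<close>

lemma norm_body:
  assumes "x \<in> body"
  shows "norm x \<le> (real CARD('n))\<^sup>2"
proof -
  define X where "X = dmat x"
  have X: "hermitian X" "mtrace X = 1" "\<And>v. mquad X v \<ge> 0"
    using assms by (auto simp: X_def hermitian_dmat mtrace_dmat body_iff)
  have c: "cnj (X $ i $ j) = X $ j $ i" for i j using X(1) by (simp add: hermitian_iff_cnj)
  have d: "Re (X $ i $ i) \<ge> 0" for i
    using X(3)[of "axis i 1"] by (simp add: mquad_mform mform_axis)
  have d1: "Re (X $ i $ i) \<le> 1" for i
  proof -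
    have "Re (X $ i $ i) \<le> (\<Sum>i\<in>UNIV. Re (X $ i $ i))" using d by (intro member_le_sum) auto
    also have "\<dots> = 1" using arg_cong[OF X(2), of Re] by (simp add: mtrace_def)
    finally show ?thesis .
  qed
  have e: "cmod (X $ i $ j) \<le> 1" for i j
  proof -
    \<comment> \<open>The phase is chosen so that the cross term of the form becomes
      \<open>- 2 * cmod (X $ i $ j)\<close>.\<close>
    define s where "s = - cnj (sgn (X $ i $ j))"
    have s: "cmod s \<le> 1" by (simp add: s_def norm_sgn)
    have "0 \<le> mquad X (axis i 1 + axis j s)" by (rule X(3))
    also have "\<dots> = Re (X $ i $ i) + (cmod s)\<^sup>2 * Re (X $ j $ j) + 2 * Re (X $ i $ j * s)"
    proof -
      have e: "cnj s * X $ j $ j * s = of_real ((cmod s)\<^sup>2) * X $ j $ j"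
        unfolding complex_norm_square by (simp add: ac_simps)
      show ?thesis unfolding mquad_add_vec[OF X(1)] unfolding mquad_mform mform_axis e by simp
    qed
    also have "X $ i $ j * s = - of_real (cmod (X $ i $ j))"
    proof -
      have "X $ i $ j * cnj (sgn (X $ i $ j)) = of_real (cmod (X $ i $ j))"
        using complex_norm_square[of "X $ i $ j"]
        by (cases "X $ i $ j = 0") (auto simp: sgn_div_norm scaleR_conv_of_real[where 'a=complex] power2_eq_square field_simps)
      then show ?thesis by (simp add: s_def)
    qed
    finally have "2 * cmod (X $ i $ j) \<le> Re (X $ i $ i) + (cmod s)\<^sup>2 * Re (X $ j $ j)" by simp
    also have "\<dots> \<le> 1 + 1 * 1"
      using d1 d s by (intro add_mono mult_mono) (auto simp: power_le_one)
    finally show ?thesis by simp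
  qed
  have "norm x \<le> norm (x, 1 / sqrt (real CARD('n)))" by (simp add: norm_Pair real_le_rsqrt)
  also have "\<dots> = norm X" by (simp add: X_def dmat_def norm_emb)
  also have "\<dots> \<le> (\<Sum>i\<in>UNIV. norm (X $ i))" unfolding norm_vec_def[of X] by (rule L2_set_le_sum) simp
  also have "\<dots> \<le> (\<Sum>i\<in>(UNIV::'n set). \<Sum>j\<in>(UNIV::'n set). 1)"
  proof (rule sum_mono)
    fix i
    have "norm (X $ i) \<le> (\<Sum>j\<in>UNIV. cmod (X $ i $ j))" unfolding norm_vec_def[of "X $ i"] by (rule L2_set_le_sum) simp
    also have "\<dots> \<le> (\<Sum>j\<in>(UNIV::'n set). 1)" by (intro sum_mono e)
    finally show "norm (X $ i) \<le> (\<Sum>j\<in>(UNIV::'n set). 1)" .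
  qed
  finally show ?thesis by (simp add: power2_eq_square)
qed

lemma compact_body: "compact body"
  using closed_body norm_body by (auto simp: compact_eq_bounded_closed bounded_iff)

lemma p_vol_eq: "p_vol B e = measure lborel {x. infdist x body \<le> e}"
proof -
  have "infdist (dmat x) density_matrices = infdist x body" for x
    using zero_in_body by (auto simp: infdist_def density_matrices_eq image_image dist_dmat)
  then have "dmat x \<in> density_nbhd e \<longleftrightarrow> infdist x body \<le> e" for x
    by (simp add: density_nbhd_def trace_one_herm_def hermitian_dmat mtrace_dmat)
  then show ?thesis by (simp add: p_vol_def vol_S1_def dmat_eq)
qed

text \<open>For \<open>t \<ge> 0\<close> these are the coordinates of the trace-one Hermitian matrices \<open>A \<ge> - t * I\<close>.\<close>
definition outer_body :: "real \<Rightarrow> (real^'m) set" where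
  "outer_body t = {x. \<forall>v. mquad (dmat x) v \<ge> - t * (norm v)\<^sup>2}"

text \<open>\<open>X + t * I\<close> is positive semidefinite with trace \<open>1 + d * t\<close>.
  Dividing by the trace gives a density matrix, and in coordinates centred at \<open>I / d\<close>
  this divides \<open>x\<close> by \<open>1 + d * t\<close>.\<close>

lemma outer_body_eq:
  assumes t: "t \<ge> 0"
  shows "outer_body t = {x. (1 / (1 + real CARD('n) * t)) *\<^sub>R x \<in> body}"
proof -
  define s where "s = 1 + real CARD('n) * t"
  have s: "s > 0" using t by (simp add: s_def add_pos_nonneg)
  have "mquad (dmat x) v \<ge> - t * (norm v)\<^sup>2 \<longleftrightarrow> 0 \<le> mquad (dmat ((1 / s) *\<^sub>R x)) v" for x v
  proof -
    have "mquad (dmat ((1 / s) *\<^sub>R x)) v = (mquad (emb (x, 0)) v + (norm v)\<^sup>2 * s / real CARD('n)) / s"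
      unfolding mquad_dmat linear_scale[OF linear_mquad_emb0] using s by (simp add: add_divide_distrib)
    also have "(norm v)\<^sup>2 * s / real CARD('n) = (norm v)\<^sup>2 / real CARD('n) + t * (norm v)\<^sup>2"
      by (simp add: s_def field_simps)
    finally have "mquad (dmat ((1 / s) *\<^sub>R x)) v = (mquad (dmat x) v + t * (norm v)\<^sup>2) / s"
      by (simp add: mquad_dmat)
    then show ?thesis using s by (auto simp: zero_le_divide_iff)
  qed
  then show ?thesis unfolding outer_body_def body_iff s_def[symmetric] by simp
qed

lemma measure_outer_body:
  assumes t: "t \<ge> 0"
  shows "measure lborel (outer_body t) = (1 + real CARD('n) * t) ^ (CARD('n)\<^sup>2 - 1) * measure lborel body"
proof -
  have s: "1 + real CARD('n) * t > 0" using t by (simp add: add_pos_nonneg)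
  show ?thesis
    unfolding outer_body_eq[OF t] measure_def emeasure_lborel_scale[OF borel_closed[OF closed_body] s]
    using s card_m by (simp add: enn2real_mult)
qed

text \<open>The difference \<open>N\<close> to a nearest density matrix is traceless, so pairing it
  with \<open>outer v\<close> is the same as pairing it with the traceless part of
  \<open>outer v\<close>, to which Cauchy-Schwarz applies.\<close>

lemma parallel_body_subset_outer_body:
  assumes "infdist x body \<le> e"
  shows "x \<in> outer_body (e * sqrt (1 - 1 / real CARD('n)))"
  unfolding outer_body_def
proof (safe)
  fix v
  let ?d = "real CARD('n)"
  obtain y where y: "y \<in> body" "infdist x body = dist x y"
    using infdist_attains_inf[OF closed_body] zero_in_body by blast
  define N where "N = dmat x - dmat y"
  have nN: "norm N \<le> e" using y assms dist_dmat[of x y] by (simp add: N_def dist_norm)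
  have "mtrace N = 0" by (simp add: N_def linear_diff[OF linear_mtrace] mtrace_dmat)
  then have "inner N (mat 1) = 0" by (simp add: inner_mat_1)
  then have "mquad N v = - inner N (((norm v)\<^sup>2 / ?d) *\<^sub>R mat 1 - 1 *\<^sub>R outer v)"
    by (simp add: inner_outer[symmetric] inner_diff_right)
  moreover have "norm (((norm v)\<^sup>2 / ?d) *\<^sub>R mat 1 - 1 *\<^sub>R outer v) = (norm v)\<^sup>2 * sqrt (1 - 1 / ?d)"
  proof -
    have "(norm (((norm v)\<^sup>2 / ?d) *\<^sub>R mat 1 - 1 *\<^sub>R outer v))\<^sup>2 = ((norm v)\<^sup>2)\<^sup>2 * (1 - 1 / ?d)"
      unfolding norm_mat_1_diff_outer by (simp add: power2_eq_square power4_eq_xxxx field_simps)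
    then have "norm (((norm v)\<^sup>2 / ?d) *\<^sub>R mat 1 - 1 *\<^sub>R outer v) = sqrt (((norm v)\<^sup>2)\<^sup>2 * (1 - 1 / ?d))"
      by (metis norm_ge_zero real_sqrt_abs abs_of_nonneg)
    then show ?thesis by (simp only: real_sqrt_mult real_sqrt_abs abs_power2)
  qed
  moreover have "inner N (((norm v)\<^sup>2 / ?d) *\<^sub>R mat 1 - 1 *\<^sub>R outer v) \<le> norm N * norm (((norm v)\<^sup>2 / ?d) *\<^sub>R mat 1 - 1 *\<^sub>R outer v)"
    by (rule norm_cauchy_schwarz)
  ultimately have "mquad N v \<ge> - (norm N * ((norm v)\<^sup>2 * sqrt (1 - 1 / ?d)))" by simp
  moreover have "norm N * ((norm v)\<^sup>2 * sqrt (1 - 1 / ?d)) \<le> e * ((norm v)\<^sup>2 * sqrt (1 - 1 / ?d))"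
    by (intro mult_right_mono nN mult_nonneg_nonneg) auto
  moreover have "mquad (dmat y) v \<ge> 0" using y by (simp add: body_iff)
  moreover have "mquad (dmat x) v = mquad (dmat y) v + mquad N v" by (simp add: N_def mquad_diff)
  moreover have "- (e * sqrt (1 - 1 / ?d)) * (norm v)\<^sup>2 = - (e * ((norm v)\<^sup>2 * sqrt (1 - 1 / ?d)))" by simp
  ultimately show "- (e * sqrt (1 - 1 / ?d)) * (norm v)\<^sup>2 \<le> mquad (dmat x) v" by linarith
qed

end

section \<open>The difference of the two bodies\<close>

context hermitian_coordinates
begin

text \<open>If the form were at least \<open>m / d\<close> on all unit vectors orthogonal to the
  lowest eigenvector \<open>v\<close>, the matrix \<open>r\<close> would be a density matrix within
  distance \<open>e\<close>. So there is a second direction \<open>w\<close> with a smaller value,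
  and the form is bounded by \<open>e\<close> on the plane spanned by \<open>v\<close> and
  \<open>w\<close>.\<close>

lemma outside_parallel_body_near_corank2:
  assumes d2: "CARD('n) \<ge> 2" and e: "e > 0"
    and x: "x \<in> outer_body (e * sqrt (1 - 1 / real CARD('n)))" "infdist x body > e"
  obtains i j where "\<And>u1 u2. \<exists>w. w $ i = u1 \<and> w $ j = u2 \<and> (\<forall>k. cmod (w $ k) \<le> cmod u1 + cmod u2) \<and>
    mquad (dmat x) w \<le> e * (norm w)\<^sup>2"
proof -
  let ?d = "real CARD('n)"
  define X where "X = dmat x"
  have X: "hermitian X" by (simp add: X_def hermitian_dmat)
  define \<kappa> where "\<kappa> = 1 - 1 / ?d"
  have \<kappa>: "\<kappa> \<ge> 1 / 2" using d2 by (simp add: \<kappa>_def field_simps)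
  obtain v l where v: "norm v = 1" "mquad X v = l" "\<And>u. mquad X u \<ge> l * (norm u)\<^sup>2"
    "\<And>w. mform (mat 1) v w = 0 \<Longrightarrow> mform X v w = 0"
    using hermitian_min_eigenvector[OF X] by blast
  have l0: "l < 0"
  proof (rule ccontr)
    assume "\<not> l < 0"
    then have "mquad X u \<ge> 0" for u
      using v(3)[of u] by (meson not_less mult_nonneg_nonneg order_trans zero_le_power2)
    then have "x \<in> body" by (simp add: body_iff X_def)
    then show False using x(2) e by simp
  qed
  have "mquad X v \<ge> - (e * sqrt \<kappa>) * (norm v)\<^sup>2"
    using x(1) unfolding outer_body_def X_def \<kappa>_def by blast
  then have lt: "- l \<le> e * sqrt \<kappa>" using v(1,2) by simp
  \<comment> \<open>Subtracting \<open>m * (I / d - outer v)\<close> changes the value at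
    \<open>v\<close> from \<open>l\<close> to \<open>l + m * \<kappa>\<close> and lowers the form by
    \<open>m / d\<close> on unit vectors orthogonal to \<open>v\<close>. This \<open>m\<close>
    brings the value at \<open>v\<close> to zero; the distance moved is
    \<open>m * sqrt \<kappa>\<close>.\<close>
  define m where "m = - l / \<kappa>"
  have m: "m > 0" "m * \<kappa> = - l" using l0 \<kappa> by (auto simp: m_def field_simps)
  have "(m * \<kappa>)\<^sup>2 \<le> (e * sqrt \<kappa>)\<^sup>2" using lt l0 m by (intro power_mono) auto
  moreover have "(m * \<kappa>)\<^sup>2 = \<kappa> * (m\<^sup>2 * \<kappa>)" by (simp add: power2_eq_square)
  moreover have "(e * sqrt \<kappa>)\<^sup>2 = \<kappa> * e\<^sup>2" using \<kappa> by (simp add: power_mult_distrib)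
  ultimately have "\<kappa> * (m\<^sup>2 * \<kappa>) \<le> \<kappa> * e\<^sup>2" by simp
  then have m\<kappa>: "m\<^sup>2 * \<kappa> \<le> e\<^sup>2" by (rule mult_left_le_imp_le) (use \<kappa> in simp)
  \<comment> \<open>The hypothesis \<open>d \<ge> 2\<close> enters twice: through
    \<open>\<kappa> \<ge> 1 / 2\<close>, which gives \<open>m \<le> 2 * e\<close>, and through
    \<open>2 * e \<le> d * e\<close>.\<close>
  have md: "m / ?d \<le> e"
  proof -
    have "m\<^sup>2 * (1 / 2) \<le> m\<^sup>2 * \<kappa>" using \<kappa> by (intro mult_left_mono) auto
    then have "m\<^sup>2 \<le> 2 * e\<^sup>2" using m\<kappa> by linarith
    also have "\<dots> \<le> 4 * e\<^sup>2" by simp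
    also have "\<dots> = (2 * e)\<^sup>2" by (simp add: power2_eq_square)
    finally have "m \<le> 2 * e" by (rule power2_le_imp_le) (use e in simp)
    also have "\<dots> \<le> ?d * e" using d2 e by (intro mult_right_mono) auto
    finally show ?thesis using d2 by (simp add: field_simps)
  qed
  have "\<exists>w. norm w = 1 \<and> mform (mat 1) v w = 0 \<and> mquad X w < m / ?d"
  proof (rule ccontr)
    assume "\<not> ?thesis"
    then have far: "mquad X w \<ge> m / ?d" if "norm w = 1" "mform (mat 1) v w = 0" for w
      using that by (meson not_less)
    have far': "mquad X w \<ge> (m / ?d) * (norm w)\<^sup>2" if w: "mform (mat 1) v w = 0" for w
    proof (cases "w = 0")
      case True then show ?thesis by (simp add: mquad_def)
    next
      case False
      define c where "c = complex_of_real (1 / norm w)"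
      have "(norm (c *s w))\<^sup>2 = (cmod c)\<^sup>2 * (norm w)\<^sup>2" by (simp only: mquad_mat_1[symmetric] mquad_scale_vec)
      also have "\<dots> = 1" using False by (simp add: c_def norm_divide power_divide)
      finally have "norm (c *s w) = 1" by (simp add: power2_eq_1_iff) (smt (verit) norm_ge_zero)
      moreover have "mform (mat 1) v (c *s w) = 0" using w by (simp add: mform_scale_vec)
      ultimately have "m / ?d \<le> mquad X (c *s w)" by (rule far)
      also have "\<dots> = mquad X w / (norm w)\<^sup>2" by (simp add: mquad_scale_vec c_def norm_divide power_divide)
      finally show ?thesis using False by (simp add: field_simps)
    qed
    define r where "r = X - ((m / ?d) *\<^sub>R mat 1 - m *\<^sub>R outer v)"
    have "hermitian r"
      unfolding r_def by (intro hermitian_diff hermitian_scaleR hermitian_mat_1 hermitian_outer X)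
    moreover have "mtrace r = 1"
      using v(1) by (simp add: r_def linear_diff[OF linear_mtrace] linear_scale[OF linear_mtrace]
        mtrace_mat_1 mtrace_outer X_def mtrace_dmat scaleR_conv_of_real[where 'a=complex])
    ultimately obtain y where y: "dmat y = r" using ex_dmat by blast
    have "mquad r u \<ge> 0" for u
    proof -
      define a where "a = mform (mat 1) v u"
      define u' where "u' = u - a *s v"
      have u: "u = a *s v + u'" by (simp add: u'_def)
      have o: "mform (mat 1) v u' = 0"
      proof -
        have "a = mform (mat 1) v (a *s v) + mform (mat 1) v u'" unfolding mform_add_vec[symmetric] u[symmetric] by (simp add: a_def)
        then show ?thesis using v(1) by (simp add: mform_scale_vec mform_mat_1_self)
      qed
      have q: "mquad Y u = (cmod a)\<^sup>2 * mquad Y v + mquad Y u' + 2 * Re (cnj a * mform Y v u')" if "hermitian Y" for Y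
        unfolding u using that by (simp add: mquad_add_vec mquad_scale_vec mform_scale_vec)
      have nu: "(norm u)\<^sup>2 = (cmod a)\<^sup>2 + (norm u')\<^sup>2"
        using q[OF hermitian_mat_1] o v(1) by (simp add: mquad_mat_1)
      have "mquad X u = (cmod a)\<^sup>2 * l + mquad X u'"
        using q[OF X] v(4)[OF o] v(2) by simp
      then have "mquad r u = (cmod a)\<^sup>2 * l + mquad X u' - ((m / ?d) * ((cmod a)\<^sup>2 + (norm u')\<^sup>2) - m * (cmod a)\<^sup>2)"
        by (simp add: r_def mquad_diff mquad_scaleR mquad_mat_1 nu[symmetric] mquad_outer a_def[symmetric])
      also have "\<dots> = (cmod a)\<^sup>2 * (l + m * \<kappa>) + (mquad X u' - (m / ?d) * (norm u')\<^sup>2)"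
        by (simp add: \<kappa>_def algebra_simps)
      also have "\<dots> \<ge> 0" using far'[OF o] m by simp
      finally show ?thesis .
    qed
    then have yb: "y \<in> body" by (simp add: body_iff y)
    have "(dist x y)\<^sup>2 = (norm ((m / ?d) *\<^sub>R mat 1 - m *\<^sub>R outer v))\<^sup>2"
      unfolding dist_dmat[symmetric] y dist_norm by (simp add: r_def X_def)
    also have "\<dots> = m\<^sup>2 * \<kappa>"
      unfolding norm_mat_1_diff_outer using v(1) by (simp add: \<kappa>_def power2_eq_square field_simps)
    finally have "(dist x y)\<^sup>2 \<le> e\<^sup>2" using m\<kappa> by simp
    then have "dist x y \<le> e" by (rule power2_le_imp_le) (use e in simp)
    then show False using infdist_le[OF yb, of x] x(2) by simp
  qed
  then obtain w where w: "norm w = 1" "mform (mat 1) v w = 0" "mquad X w < m / ?d" by blast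
  obtain i j where ij: "\<forall>u1 u2. \<exists>a b. let z = a *s v + b *s w in z $ i = u1 \<and> z $ j = u2 \<and> (\<forall>k. cmod (z $ k) \<le> cmod u1 + cmod u2)"
    using orthonormal_pair_lift[OF v(1) w(1,2)] by (elim exE)
  have qz: "mquad X (a *s v + b *s w) \<le> e * (norm (a *s v + b *s w))\<^sup>2" for a b
  proof -
    have "(norm (a *s v + b *s w))\<^sup>2 = (cmod a)\<^sup>2 + (cmod b)\<^sup>2"
      unfolding mquad_mat_1[symmetric] mquad_add_vec[OF hermitian_mat_1]
      using v(1) w(1,2) by (simp add: mquad_scale_vec mquad_mat_1 mform_scale_vec)
    moreover have "mquad X (a *s v + b *s w) = (cmod a)\<^sup>2 * l + (cmod b)\<^sup>2 * mquad X w"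
      unfolding mquad_add_vec[OF X] using v(2) v(4)[OF w(2)] by (simp add: mquad_scale_vec mform_scale_vec)
    moreover have "(cmod a)\<^sup>2 * l \<le> (cmod a)\<^sup>2 * e" "(cmod b)\<^sup>2 * mquad X w \<le> (cmod b)\<^sup>2 * e"
      using l0 e w(3) md by (intro mult_left_mono; simp)+
    ultimately show ?thesis by (simp add: algebra_simps)
  qed
  show ?thesis
  proof (rule that)
    fix u1 u2
    obtain a b where "let z = a *s v + b *s w in z $ i = u1 \<and> z $ j = u2 \<and> (\<forall>k. cmod (z $ k) \<le> cmod u1 + cmod u2)"
      using ij by blast
    then show "\<exists>w. w $ i = u1 \<and> w $ j = u2 \<and> (\<forall>k. cmod (w $ k) \<le> cmod u1 + cmod u2) \<and>
        mquad (dmat x) w \<le> e * (norm w)\<^sup>2"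
      using qz[of a b] unfolding Let_def X_def by blast
  qed
qed

text \<open>This passes from the trace-one slice to the cone over it, where translation by blocks of
  nonzero trace makes sense. \<open>W\<close> consists of the dilates of \<open>S\<close> with trace
  between 1 and 2; each slice is at least as large as \<open>S\<close>, and the heights fill an
  interval of length \<open>1 / sqrt d\<close>.\<close>

lemma cone_measure_bound:
  assumes S[measurable]: "S \<in> sets borel"
  defines "W \<equiv> {z :: (real^'m) \<times> real. 1 \<le> sqrt (real CARD('n)) * snd z \<and> sqrt (real CARD('n)) * snd z \<le> 2 \<and>
      (1 / (sqrt (real CARD('n)) * snd z)) *\<^sub>R fst z \<in> S}"
  shows "W \<in> sets borel" "emeasure lborel S \<le> ennreal (sqrt (real CARD('n))) * emeasure lborel W"
proof -
  define q where "q = sqrt (real CARD('n))"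
  have q: "q > 0" by (simp add: q_def)
  have m1: "(fst :: (real^'m) \<times> real \<Rightarrow> real^'m) \<in> borel_measurable borel"
    by (intro borel_measurable_continuous_onI continuous_intros)
  note m2 = borel_measurable_snd_lborel
  have m3: "(\<lambda>z :: (real^'m) \<times> real. (1 / (q * snd z)) *\<^sub>R fst z) \<in> borel_measurable borel"
    using m1 m2 by simp
  have "W = {z. 1 \<le> q * snd z} \<inter> {z. q * snd z \<le> 2} \<inter> (\<lambda>z. (1 / (q * snd z)) *\<^sub>R fst z) -` S"
    by (auto simp: W_def q_def)
  moreover have "closed {z :: (real^'m) \<times> real. 1 \<le> q * snd z}" "closed {z :: (real^'m) \<times> real. q * snd z \<le> 2}"
    by (intro closed_Collect_le continuous_intros)+
  moreover have "(\<lambda>z :: (real^'m) \<times> real. (1 / (q * snd z)) *\<^sub>R fst z) -` S \<in> sets borel"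
    using measurable_sets[OF m3 S] by simp
  ultimately show W: "W \<in> sets borel" by (auto intro: borel_closed)
  have "emeasure lborel W = emeasure (lborel \<Otimes>\<^sub>M lborel) W" by (simp add: lborel_prod)
  also have "\<dots> = (\<integral>\<^sup>+ s. emeasure lborel ((\<lambda>x. (x, s)) -` W) \<partial>lborel)"
    using W by (intro lborel_pair.emeasure_pair_measure_alt2) (simp only: lborel_prod sets_lborel)
  also have "\<dots> \<ge> (\<integral>\<^sup>+ s. emeasure lborel S * indicator {1 / q..2 / q} s \<partial>lborel)"
  proof (rule nn_integral_mono)
    fix s :: real
    show "emeasure lborel S * indicator {1 / q..2 / q} s \<le> emeasure lborel ((\<lambda>x. (x, s)) -` W)"
    proof (cases "s \<in> {1 / q..2 / q}")
      case True
      then have s: "1 \<le> q * s" "q * s \<le> 2" using q by (auto simp: field_simps)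
      then have "(\<lambda>x. (x, s)) -` W = {x. (1 / (q * s)) *\<^sub>R x \<in> S}" by (auto simp: W_def q_def)
      then have "emeasure lborel ((\<lambda>x. (x, s)) -` W) = ennreal ((q * s) ^ DIM(real^'m)) * emeasure lborel S"
        using emeasure_lborel_scale[OF S, of "q * s"] s by simp
      also have "\<dots> \<ge> 1 * emeasure lborel S"
        using s by (intro mult_right_mono) (auto simp: ennreal_ge_1)
      finally show ?thesis using True by simp
    qed simp
  qed
  finally have "emeasure lborel S * ennreal (1 / q) \<le> emeasure lborel W"
  proof -
    have "2 / q - 1 / q = 1 / q" by (simp add: field_simps)
    then have "emeasure lborel {1 / q..2 / q} = ennreal (1 / q)"
      using q by (simp add: divide_right_mono)
    then have "(\<integral>\<^sup>+ s. emeasure lborel S * indicator {1 / q..2 / q} s \<partial>lborel) = emeasure lborel S * ennreal (1 / q)"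
      by (subst nn_integral_cmult) auto
    then show "(\<integral>\<^sup>+ s. emeasure lborel S * indicator {1 / q..2 / q} s \<partial>lborel) \<le> emeasure lborel W
       \<Longrightarrow> emeasure lborel S * ennreal (1 / q) \<le> emeasure lborel W" by simp
  qed
  then have "ennreal q * (emeasure lborel S * ennreal (1 / q)) \<le> ennreal q * emeasure lborel W"
    by (rule mult_left_mono) simp
  moreover have "ennreal q * (emeasure lborel S * ennreal (1 / q)) = emeasure lborel S"
  proof -
    have "ennreal q * (emeasure lborel S * ennreal (1 / q)) = (ennreal q * ennreal (1 / q)) * emeasure lborel S"
      by (simp only: ac_simps)
    also have "ennreal q * ennreal (1 / q) = 1" using q by (simp add: ennreal_mult[symmetric])
    finally show ?thesis by simp
  qed
  ultimately show "emeasure lborel S \<le> ennreal (sqrt (real CARD('n))) * emeasure lborel W" by (simp add: q_def)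
qed

lemma measure_outer_minus_parallel_body:
  assumes d2: "CARD('n) \<ge> 2"
  obtains C e0 where "e0 > 0" "\<And>e. 0 < e \<Longrightarrow> e \<le> e0 \<Longrightarrow>
    measure lborel (outer_body (e * sqrt (1 - 1 / real CARD('n))) - {x. infdist x body \<le> e}) \<le> C * e ^ 4"
proof -
  let ?d = "real CARD('n)"
  \<comment> \<open>Bound for the norm on the cone piece \<open>W\<close>: the scale is at most 2,
    the dilation factor \<open>1 + d * t\<close> at most \<open>1 + d\<close>, the body lies within
    radius \<open>d\<^sup>2\<close>, and the height contributes at most 1.\<close>
  define R where "R = 2 * ((1 + ?d) * ?d\<^sup>2 + 1)"
  have "\<exists>C. C \<ge> 0 \<and> (\<forall>e. 0 < e \<longrightarrow> 6 * ?d * e \<le> 1 \<longrightarrow> measure lborel (near_corank2 i j R e) \<le> C * e ^ 4)" for i j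
    using measure_near_corank2[of i j R] by metis
  then obtain K where K: "\<And>i j. K i j \<ge> 0"
      "\<And>i j e. 0 < e \<Longrightarrow> 6 * ?d * e \<le> 1 \<Longrightarrow> measure lborel (near_corank2 i j R e) \<le> K i j * e ^ 4"
    by metis
  define C where "C = sqrt ?d * (\<Sum>(i, j)\<in>UNIV. K i j * 2 ^ 4)"
  show ?thesis
  proof (rule that)
    \<comment> \<open>Scaling up to trace 2 replaces \<open>e\<close> by \<open>2 * e\<close>, and
      the packing bound asks for \<open>6 * d * (2 * e) \<le> 1\<close>.\<close>
    show "1 / (12 * ?d) > 0" by simp
    fix e :: real assume e: "0 < e" "e \<le> 1 / (12 * ?d)"
    have e12: "6 * ?d * (2 * e) \<le> 1" using e by (simp add: field_simps)
    have "1 / (12 * ?d) \<le> 1" using d2 by simp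
    then have e1: "e \<le> 1" using e by linarith
    define t where "t = e * sqrt (1 - 1 / ?d)"
    have t: "0 \<le> t" "t \<le> e" using e d2 by (auto simp: t_def mult_left_le)
    define S where "S = outer_body t - {x. infdist x body \<le> e}"
    have clo: "closed (outer_body t)"
    proof -
      have "outer_body t = (\<lambda>x. (1 / (1 + ?d * t)) *\<^sub>R x) -` body" using outer_body_eq[OF t(1)] by auto
      then show ?thesis
        using continuous_closed_vimage[OF closed_body, of "\<lambda>x. (1 / (1 + ?d * t)) *\<^sub>R x"] by (simp add: continuous_intros)
    qed
    have clp: "closed {x. infdist x body \<le> e}" by (intro closed_Collect_le continuous_intros)
    have S: "S \<in> sets borel" unfolding S_def using clo clp by (intro sets.Diff borel_closed)
    define W where "W = {z :: (real^'m) \<times> real. 1 \<le> sqrt ?d * snd z \<and> sqrt ?d * snd z \<le> 2 \<and>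
      (1 / (sqrt ?d * snd z)) *\<^sub>R fst z \<in> S}"
    have W: "W \<in> sets borel" "emeasure lborel S \<le> ennreal (sqrt ?d) * emeasure lborel W"
      using cone_measure_bound[OF S] unfolding W_def by auto
    have sub: "W \<subseteq> (\<Union>(i, j)\<in>UNIV. near_corank2 i j R (2 * e))"
    proof
      fix z assume "z \<in> W"
      define s where "s = sqrt ?d * snd z"
      define x where "x = (1 / s) *\<^sub>R fst z"
      have s: "1 \<le> s" "s \<le> 2" and xS: "x \<in> S" using \<open>z \<in> W\<close> by (auto simp: W_def s_def x_def)
      have z: "z = s *\<^sub>R (x, 1 / sqrt ?d)"
        using s by (cases z) (simp add: x_def, simp add: s_def)
      then have ez: "emb z = s *\<^sub>R dmat x" by (simp add: dmat_def linear_scale[OF linear_emb, symmetric])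
      have xo: "x \<in> outer_body t" "infdist x body > e" using xS by (auto simp: S_def)
      obtain i j where ij: "\<And>u1 u2. \<exists>w. w $ i = u1 \<and> w $ j = u2 \<and> (\<forall>k. cmod (w $ k) \<le> cmod u1 + cmod u2) \<and>
          mquad (dmat x) w \<le> e * (norm w)\<^sup>2"
        using outside_parallel_body_near_corank2[OF d2 e(1) xo(1)[unfolded t_def] xo(2)] by blast
      have "norm z \<le> R"
      proof -
        have nn: "1 + ?d * t > 0" using t by (simp add: add_pos_nonneg)
        have "(1 / (1 + ?d * t)) *\<^sub>R x \<in> body" using xo(1) outer_body_eq[OF t(1)] by auto
        from norm_body[OF this] have "norm x \<le> (1 + ?d * t) * ?d\<^sup>2" using nn by (simp add: field_simps)
        also have "\<dots> \<le> (1 + ?d) * ?d\<^sup>2" using t e1 by (intro mult_right_mono add_left_mono) (auto simp: mult_left_le)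
        finally have nx: "norm x \<le> (1 + ?d) * ?d\<^sup>2" .
        have "norm z = s * norm (x, 1 / sqrt ?d)" using s unfolding z norm_scaleR by simp
        also have "\<dots> \<le> 2 * (norm x + norm (1 / sqrt ?d))" using s by (intro mult_mono norm_Pair_le) auto
        also have "norm (1 / sqrt ?d) \<le> 1" using d2 by simp
        finally show ?thesis using nx by (simp add: R_def)
      qed
      moreover have "mquad (emb z) v \<ge> - (2 * e) * (norm v)\<^sup>2" for v
      proof -
        have "mquad (dmat x) v \<ge> - t * (norm v)\<^sup>2" using xo by (simp add: outer_body_def)
        then have "s * mquad (dmat x) v \<ge> s * (- t * (norm v)\<^sup>2)" using s by (intro mult_left_mono) auto
        moreover have "s * t \<le> 2 * e" using s t by (intro mult_mono) auto
        then have "(s * t) * (norm v)\<^sup>2 \<le> (2 * e) * (norm v)\<^sup>2" by (intro mult_right_mono) auto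
        ultimately show ?thesis unfolding ez mquad_scaleR by simp
      qed
      moreover have "\<exists>w. w $ i = u1 \<and> w $ j = u2 \<and> (\<forall>k. cmod (w $ k) \<le> cmod u1 + cmod u2) \<and>
          mquad (emb z) w \<le> (2 * e) * (norm w)\<^sup>2" for u1 u2
      proof -
        obtain w where w: "w $ i = u1" "w $ j = u2" "\<forall>k. cmod (w $ k) \<le> cmod u1 + cmod u2" "mquad (dmat x) w \<le> e * (norm w)\<^sup>2"
          using ij by blast
        have "s * mquad (dmat x) w \<le> s * (e * (norm w)\<^sup>2)" using s w(4) by (intro mult_left_mono) auto
        also have "\<dots> \<le> 2 * (e * (norm w)\<^sup>2)" using s e by (intro mult_right_mono) auto
        finally show ?thesis using w(1-3) unfolding ez mquad_scaleR by (intro exI[of _ w]) simp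
      qed
      ultimately have "z \<in> near_corank2 i j R (2 * e)" unfolding near_corank2_def by blast
      then show "z \<in> (\<Union>(i, j)\<in>UNIV. near_corank2 i j R (2 * e))" by blast
    qed
    have Nm: "near_corank2 i j R (2 * e) \<in> sets lborel" for i j
      using borel_closed[OF closed_near_corank2] by simp
    have Nf: "near_corank2 i j R (2 * e) \<in> fmeasurable lborel" for i j
    proof (rule fmeasurable_compact)
      have "near_corank2 i j R (2 * e) \<subseteq> cball 0 R" by (auto simp: near_corank2_def)
      then show "compact (near_corank2 i j R (2 * e))"
        using closed_near_corank2 bounded_subset[OF bounded_cball] by (auto simp: compact_eq_bounded_closed)
    qed
    have Uf: "(\<Union>(i, j)\<in>UNIV. near_corank2 i j R (2 * e)) \<in> fmeasurable lborel"
      using Nf by (intro fmeasurable.finite_UN) auto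
    have "measure lborel W \<le> measure lborel (\<Union>(i, j)\<in>UNIV. near_corank2 i j R (2 * e))"
      using sub W(1) Uf by (intro measure_mono_fmeasurable) auto
    also have "\<dots> \<le> (\<Sum>(i, j)\<in>UNIV. measure lborel (near_corank2 i j R (2 * e)))"
      using measure_UNION_le[of UNIV "\<lambda>(i, j). near_corank2 i j R (2 * e)" lborel] Nm by (auto simp: case_prod_beta)
    also have "\<dots> \<le> (\<Sum>(i, j)\<in>UNIV. K i j * (2 * e) ^ 4)"
      using K(2)[of "2 * e"] e e12 by (intro sum_mono) (auto simp: case_prod_beta)
    also have "\<dots> = (\<Sum>(i, j)\<in>UNIV. K i j * 2 ^ 4) * e ^ 4"
      unfolding sum_distrib_right by (intro sum.cong) (auto simp: power_mult_distrib)
    finally have mW: "measure lborel W \<le> (\<Sum>(i, j)\<in>UNIV. K i j * 2 ^ 4) * e ^ 4" .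
    have "W \<in> fmeasurable lborel" using fmeasurableI2[OF Uf sub] W(1) by simp
    then have Wfin: "emeasure lborel W = ennreal (measure lborel W)" by (rule emeasure_eq_measure2)
    have "emeasure lborel S \<le> ennreal (sqrt ?d * measure lborel W)"
      using W(2) unfolding Wfin by (simp add: ennreal_mult)
    then have "measure lborel S \<le> sqrt ?d * measure lborel W"
      unfolding measure_def[of lborel S] by (simp add: enn2real_leI)
    also have "\<dots> \<le> sqrt ?d * ((\<Sum>(i, j)\<in>UNIV. K i j * 2 ^ 4) * e ^ 4)" by (intro mult_left_mono mW) simp
    finally show "measure lborel (outer_body (e * sqrt (1 - 1 / ?d)) - {x. infdist x body \<le> e}) \<le> C * e ^ 4"
      by (simp add: S_def t_def C_def mult.assoc)
  qed
qed

end

section \<open>Comparison of coefficients and Gamma factors\<close>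

text \<open>Letting \<open>e\<close> tend to 0 kills the constant term; dividing by \<open>e\<close>
  then lowers the exponent in the bound by one, which drives the induction on
  \<open>n\<close>.\<close>

lemma poly_bounded_by_power_imp_coeff_0:
  fixes p :: "real poly"
  assumes "e0 > 0" "\<And>e. 0 < e \<Longrightarrow> e \<le> e0 \<Longrightarrow> \<bar>poly p e\<bar> \<le> C * e ^ n" "k < n"
  shows "coeff p k = 0"
  using assms(2,3)
proof (induction n arbitrary: p k)
  case (Suc n)
  have ev: "eventually (\<lambda>e. 0 < e \<and> e \<le> e0) (at_right 0)"
    using assms(1) eventually_at_right_real[OF assms(1)] by (auto elim: eventually_mono)
  have "((\<lambda>e. poly p e) \<longlongrightarrow> poly p 0) (at_right 0)"
    by (intro tendsto_poly tendsto_ident_at)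
  moreover have "((\<lambda>e. poly p e) \<longlongrightarrow> 0) (at_right 0)"
  proof (rule Lim_null_comparison)
    show "\<forall>\<^sub>F e in at_right 0. norm (poly p e) \<le> C * e ^ Suc n"
      using ev by (rule eventually_mono) (use Suc.prems(1) in auto)
    have "((\<lambda>e. C * e ^ Suc n) \<longlongrightarrow> C * 0 ^ Suc n) (at_right 0)"
      by (intro tendsto_intros)
    then show "((\<lambda>e. C * e ^ Suc n) \<longlongrightarrow> 0) (at_right 0)" by simp
  qed
  ultimately have "poly p 0 = 0" using tendsto_unique trivial_limit_at_right_real by blast
  obtain a q where p: "p = pCons a q" by (cases p)
  with \<open>poly p 0 = 0\<close> have a: "a = 0" by simp
  have "\<bar>poly q e\<bar> \<le> C * e ^ n" if "0 < e" "e \<le> e0" for e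
  proof -
    have "e * \<bar>poly q e\<bar> \<le> e * (C * e ^ n)" using Suc.prems(1)[OF that] that by (simp add: p a abs_mult)
    then show ?thesis using that by simp
  qed
  then have "coeff q j = 0" if "j < n" for j using Suc.IH that by blast
  then show ?case using Suc.prems(2) by (cases k) (auto simp: p a)
qed simp

lemma prod_power_eq_powr:
  fixes x :: real
  assumes "x > 0"
  shows "(\<Prod>k<n. x ^ k) = x powr (real (n * (n - 1)) / 2)"
proof -
  have "real (n * (n - 1)) / 2 = (\<Sum>k<n. real k)"
  proof (induction n)
    case (Suc n)
    have "real (Suc n * (Suc n - 1)) / 2 = real (n * (n - 1)) / 2 + real n"
      by (cases n) (auto simp: field_simps)
    with Suc show ?case by simp
  qed simp
  also have "x powr \<dots> = (\<Prod>k<n. x ^ k)"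
    using assms by (simp add: powr_sum powr_realpow)
  finally show ?thesis ..
qed

lemma prod_Gamma_eq_prod_fact: "(\<Prod>k=1..n. Gamma (real k)) = (\<Prod>k<n. fact k)"
  by (induction n) (auto simp: Gamma_fact prod.nat_ivl_Suc' mult.commute add.commute)

lemma powr_three_halves: "x \<ge> 0 \<Longrightarrow> x powr (3 / 2) = x * sqrt x" for x :: real
proof -
  assume "x \<ge> 0"
  have "x powr (3 / 2) = x powr 1 * x powr (1 / 2)" unfolding powr_add[symmetric] by simp
  then show ?thesis using \<open>x \<ge> 0\<close> by (simp add: powr_half_sqrt)
qed

lemma Gamma_square_minus:
  assumes "j \<ge> 1" "j < n"
  shows "Gamma (real n - real j) = fact (n - 1 - j)"
proof -
  have "real n - real j = 1 + real (n - 1 - j)" using assms by (simp add: of_nat_diff)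
  then show ?thesis by (simp only: Gamma_fact)
qed

theorem theorem1:
  fixes B :: "'m::finite \<Rightarrow> complex^'n::finite^'n"
  assumes "CARD('n) \<ge> 2"
    and "CARD('m) = CARD('n)^2 - 1"
    and "traceless_herm_onb B"
  shows "\<exists>q :: real poly.
     (\<forall>eps \<ge> 0. p_vol B eps = poly q eps) \<and>
     poly ((pderiv ^^ 2) q) 0 =
       (real CARD('n) - 1) * real CARD('n) powr (3/2)
       * (2 * pi) powr (real (CARD('n) * (CARD('n) - 1)) / 2)
       * (\<Prod>k=1..CARD('n). Gamma (real k)) / Gamma (real (CARD('n)^2) - 2) \<and>
     poly ((pderiv ^^ 3) q) 0 =
       real CARD('n) * (real CARD('n) - 1) powr (3/2)
       * (2 * pi) powr (real (CARD('n) * (CARD('n) - 1)) / 2)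
       * (\<Prod>k=1..CARD('n)+1. Gamma (real k))
       / (Gamma (real CARD('n)) * Gamma (real (CARD('n)^2) - 3))"
proof -
  interpret hermitian_coordinates B using assms by unfold_locales auto
  let ?d = "real CARD('n)"
  define D where "D = CARD('n)\<^sup>2 - 1"
  have D3: "D \<ge> 3"
  proof -
    have "2\<^sup>2 \<le> CARD('n)\<^sup>2" using assms(1) by (rule power_mono) simp
    then show ?thesis by (simp add: D_def)
  qed
  define V where "V = measure lborel body"
  \<comment> \<open>\<open>c\<close> equals \<open>sqrt (d * (d - 1))\<close>, and the dilation
    factor \<open>1 + d * t\<close> of the enlarged body becomes \<open>1 + c * e\<close>.\<close>
  define c where "c = ?d * sqrt (1 - 1 / ?d)"
  obtain q where q: "\<And>e. e \<ge> 0 \<Longrightarrow> measure lborel {x. infdist x body \<le> e} = poly q e"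
    using Steiner_formula[OF compact_body convex_body] zero_in_body by blast
  obtain C e0 where e0: "e0 > 0" "\<And>e. 0 < e \<Longrightarrow> e \<le> e0 \<Longrightarrow>
      measure lborel (outer_body (e * sqrt (1 - 1 / ?d)) - {x. infdist x body \<le> e}) \<le> C * e ^ 4"
    using measure_outer_minus_parallel_body[OF assms(1)] by blast
  \<comment> \<open>Volume polynomial of the enlarged body minus the Steiner polynomial; at positive
    \<open>e\<close> up to \<open>e0\<close> it is the volume of the set difference.\<close>
  define Q where "Q = smult V ([:1, c:] ^ D) - q"
  have Q0: "coeff Q k = 0" if "k < 4" for k
  proof (rule poly_bounded_by_power_imp_coeff_0[OF e0(1) _ that])
    fix e :: real assume e: "0 < e" "e \<le> e0"
    define t where "t = e * sqrt (1 - 1 / ?d)"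
    have t: "t \<ge> 0" using e by (simp add: t_def)
    have ob: "outer_body t \<in> fmeasurable lborel"
    proof -
      have s: "1 + ?d * t > 0" using t by (simp add: add_pos_nonneg)
      have "outer_body t = (\<lambda>x. (1 + ?d * t) *\<^sub>R x) ` body"
        unfolding outer_body_eq[OF t] using s by (auto simp: image_iff intro!: bexI[rotated])
      then show ?thesis using compact_scaling[OF compact_body] by (intro fmeasurable_compact) simp
    qed
    have sub: "{x. infdist x body \<le> e} \<subseteq> outer_body t"
      using parallel_body_subset_outer_body unfolding t_def by blast
    have pb: "{x. infdist x body \<le> e} \<in> fmeasurable lborel"
      using compact_parallel_body[OF compact_body] zero_in_body by (intro fmeasurable_compact) blast
    have "poly Q e = V * (1 + c * e) ^ D - measure lborel {x. infdist x body \<le> e}"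
      using e q by (simp add: Q_def poly_power mult.commute)
    also have "V * (1 + c * e) ^ D = measure lborel (outer_body t)"
      unfolding measure_outer_body[OF t] by (simp add: V_def D_def c_def t_def mult.assoc mult.commute mult.left_commute)
    also have "\<dots> - measure lborel {x. infdist x body \<le> e} = measure lborel (outer_body t - {x. infdist x body \<le> e})"
      by (rule measurable_measure_Diff[symmetric, OF ob _ sub]) (use pb in auto)
    finally show "\<bar>poly Q e\<bar> \<le> C * e ^ 4" using e0(2)[OF e] by (simp add: t_def)
  qed
  have coeff: "coeff q k = V * (real (D choose k) * c ^ k)" if "k < 4" for k
    using Q0[OF that] that D3 coeff_linear_poly_power[of k D 1 c] by (simp add: Q_def)
  define G where "G = (2 * pi) powr (real (CARD('n) * (CARD('n) - 1)) / 2) * (\<Prod>k=1..CARD('n). Gamma (real k))"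
  have V: "V = sqrt ?d * G / fact D"
  proof -
    have "(\<Prod>k<CARD('n). (2 * pi) ^ k * fact k) = G"
    proof -
      have "2 * pi > 0" by simp
      from prod_power_eq_powr[OF this] show ?thesis
        by (simp only: G_def prod_Gamma_eq_prod_fact prod.distrib)
    qed
    moreover have "G \<ge> 0" unfolding G_def prod_Gamma_eq_prod_fact by (intro mult_nonneg_nonneg prod_nonneg) auto
    ultimately show ?thesis unfolding V_def measure_def emeasure_body D_def by simp
  qed
  have d2: "?d \<ge> 2" using assms(1) by simp
  have c2: "c\<^sup>2 = ?d * (?d - 1)"
  proof -
    have "1 - 1 / ?d \<ge> 0" by simp
    then have "c\<^sup>2 = ?d\<^sup>2 * (1 - 1 / ?d)" by (simp add: c_def power_mult_distrib)
    also have "?d\<^sup>2 * (1 - 1 / ?d) = ?d * (?d - 1)" by (simp add: power2_eq_square field_simps)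
    finally show ?thesis .
  qed
  have c: "c = sqrt ?d * sqrt (?d - 1)"
  proof -
    have "c \<ge> 0" by (simp add: c_def)
    then have "c = sqrt (?d * (?d - 1))" using c2 by (metis real_sqrt_unique)
    then show ?thesis by (simp add: real_sqrt_mult)
  qed
  \<comment> \<open>Here \<open>r = d\<^sup>2 - 4\<close>, so \<open>Gamma (d\<^sup>2 - 3)\<close>
    is \<open>fact r\<close> and \<open>Gamma (d\<^sup>2 - 2)\<close> is
    \<open>fact (Suc r)\<close>; for \<open>d = 2\<close> the former is
    \<open>Gamma 1\<close>.\<close>
  obtain r where "D = 3 + r" using le_Suc_ex[OF D3] by blast
  then have r: "D = Suc (Suc (Suc r))" by simp
  have Dsq: "CARD('n)\<^sup>2 = Suc D" using D3 by (simp add: D_def)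
  have G2: "Gamma (real (CARD('n)\<^sup>2) - 2) = fact (Suc r)"
    using Gamma_square_minus[of 2 "CARD('n)\<^sup>2"] by (simp add: Dsq r)
  have G3: "Gamma (real (CARD('n)\<^sup>2) - 3) = fact r"
    using Gamma_square_minus[of 3 "CARD('n)\<^sup>2"] by (simp add: Dsq r)
  have choose: "fact k * real (D choose k) / fact D = 1 / fact (D - k)" if "k \<le> D" for k
    using binomial_fact[OF that, where 'a=real] by simp
  have choose2: "2 * real (D choose 2) / fact D = 1 / fact (Suc r)"
    using choose[of 2] D3 by (simp add: r del: fact_Suc binomial_Suc_Suc)
  have choose3: "6 * real (D choose 3) / fact D = 1 / fact r"
    using choose[of 3] D3 by (simp add: r fact_numeral del: fact_Suc binomial_Suc_Suc)
  have "poly ((pderiv ^^ 2) q) 0 = 2 * coeff q 2"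
    by (simp add: poly_0_coeff_0 coeff_pderiv numeral_2_eq_2)
  also have "\<dots> = sqrt ?d * G * c\<^sup>2 * (2 * real (D choose 2) / fact D)"
    by (simp add: coeff V)
  also have "\<dots> = (?d - 1) * (?d * sqrt ?d) * G / fact (Suc r)"
    unfolding choose2 c2 by (simp add: ac_simps)
  finally have p2: "poly ((pderiv ^^ 2) q) 0 = (?d - 1) * (?d powr (3/2)) * G / Gamma (real (CARD('n)\<^sup>2) - 2)"
    by (simp only: powr_three_halves[OF of_nat_0_le_iff] G2)
  have "poly ((pderiv ^^ 3) q) 0 = 6 * coeff q 3"
    by (simp add: poly_0_coeff_0 coeff_pderiv numeral_3_eq_3)
  also have "\<dots> = sqrt ?d * G * (c\<^sup>2 * c) * (6 * real (D choose 3) / fact D)"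
    by (simp add: coeff V power3_eq_cube power2_eq_square)
  also have "\<dots> = ?d * ((?d - 1) * sqrt (?d - 1)) * G * (sqrt ?d * sqrt ?d) / fact r"
    unfolding choose3 c2 unfolding c by simp
  also have "\<dots> = ?d * (?d - 1) powr (3/2) * (G * ?d) / Gamma (real (CARD('n)\<^sup>2) - 3)"
    using d2 powr_three_halves[of "?d - 1"] unfolding G3 by simp
  \<comment> \<open>The spare factor \<open>d\<close> is written as
    \<open>Gamma (d + 1) / Gamma d\<close>, which extends the product to \<open>d + 1\<close> and
    produces the \<open>Gamma d\<close> in the denominator.\<close>
  also have "G * ?d = G * Gamma (?d + 1) / Gamma ?d"
  proof -
    have "?d \<notin> \<int>\<^sub>\<le>\<^sub>0" using d2 by (auto elim!: nonpos_Ints_cases)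
    moreover have "Gamma ?d \<noteq> 0" using Gamma_real_pos[of ?d] d2 by linarith
    ultimately show ?thesis using Gamma_plus1[of ?d] by simp
  qed
  finally have p3: "poly ((pderiv ^^ 3) q) 0 = ?d * (?d - 1) powr (3/2) * (G * Gamma (?d + 1)) / (Gamma ?d * Gamma (real (CARD('n)\<^sup>2) - 3))"
    by (simp add: mult.assoc)
  have prod_Suc: "(\<Prod>k=1..CARD('n)+1. Gamma (real k)) = (\<Prod>k=1..CARD('n). Gamma (real k)) * Gamma (?d + 1)"
    by (simp add: add.commute mult.commute)
  show ?thesis
  proof (intro exI[of _ q] conjI allI impI)
    show "p_vol B eps = poly q eps" if "eps \<ge> 0" for eps
      using q[OF that] by (simp only: p_vol_eq)
  qed (use p2 p3 in \<open>simp_all only: G_def prod_Suc mult.assoc\<close>)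
qed

end
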